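(* For each dimension $d$ let $X_d=R_dU_d\in\mathbb R^d$, where $U_d\sim\operatorname{Unif}(S^{d-1})$, $R_d$ is a real random variable independent of $U_d$ with $R_d>0$ almost surely, $\rho_d=\mathbb E R_d$, $\epsilon_d=\operatorname{sd}(R_d)>0$, $\xi_d=(R_d-\rho_d)/\epsilon_d$, $\tau_d=\epsilon_d/\rho_d$ and $\lambda_d=\sqrt d\,\tau_d$. Assume that, as $d\to\infty$, $\tau_d\to0$ and $\xi_d\Rightarrow\Xi$ in distribution, and let $F=\mathcal L(\Xi)$ be the law of $\Xi$. Let $P_d$ be the law of $X_d$ and let $\mathsf d_{\mathrm{Euc}}$ be the Euclidean distance on $\mathbb R^d$. Then: (1) if $\lambda_d\to0$, then $H_3(P_d,\mathsf d_{\mathrm{Euc}})\to\log 3$; (2) if $\lambda_d\to\lambda\in(0,\infty)$, then $H_3(P_d,\mathsf d_{\mathrm{Euc}})\to H_\infty(\lambda;F)$; (3) if $\lambda_d\to\infty$ and $F$ is continuous (i.e. has a continuous distribution function), then $H_3(P_d,\mathsf d_{\mathrm{Euc}})\to0$.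
   Context: Farthest-cell triplet entropy. Let $(\mathcal X,\mathsf d,P)$ be a metric probability space. Draw a query $X\sim P$ and a prototype triple $V=(V_1,V_2,V_3)\sim P^3$ independently. For fixed $v=(v_1,v_2,v_3)$ let $L_v(X)\in\arg\max_{1\le i\le3}\mathsf d(X,v_i)$ be the farthest-prototype label, with independent uniform randomization among exact ties. Put $q_i(v)=\mathbb P\{L_V(X)=i\mid V=v\}$, $q(v)=(q_1(v),q_2(v),q_3(v))$, and for a probability vector $q$ let $h(q)=-\sum_{i=1}^3q_i\log q_i$ (natural logarithm, $0\log0=0$). Then $H_3(P,\mathsf d)=\mathbb E_V\,h\{q(V)\}$. Master entropy curve. Let $\Xi_1,\Xi_2,\Xi_3$ be i.i.d. with law $F$ and $Z_1,Z_2,Z_3$ be i.i.d. $N(0,1)$, the two triples being independent. For deterministic $w=(w_1,w_2,w_3)\in\mathbb R^3$ and $\lambda\ge0$ define $$q_i^\lambda(w)=\mathbb P\Bigl(\lambda w_i-Z_i=\max_{1\le j\le3}\{\lambda w_j-Z_j\}\Bigr),\qquad i=1,2,3,$$ $q^\lambda(w)=(q_1^\lambda(w),q_2^\lambda(w),q_3^\lambda(w))$, and $$H_\infty(\lambda;F)=\mathbb E\bigl[h\{q^\lambda(\Xi_1,\Xi_2,\Xi_3)\}\bigr].$$ *)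

theory Defs
  imports "HOL-Probability.Probability"
begin

text \<open>
  Since the dimension is a running index, $\mathbb{R}^d$ is represented by the extensional functions
  on \<open>{..<d}\<close>, i.e. the space of the product measures \<open>PiM {..<d}\<close>.
\<close>

definition euclid_borel :: "nat \<Rightarrow> (nat \<Rightarrow> real) measure" where
  "euclid_borel d = PiM {..<d} (\<lambda>_. borel)"

definition euclid_dist :: "nat \<Rightarrow> (nat \<Rightarrow> real) \<Rightarrow> (nat \<Rightarrow> real) \<Rightarrow> real" where
  "euclid_dist d x y = L2_set (\<lambda>i. x i - y i) {..<d}"

definition euclid_scale :: "nat \<Rightarrow> real \<Rightarrow> (nat \<Rightarrow> real) \<Rightarrow> (nat \<Rightarrow> real)" where
  "euclid_scale d r x = (\<lambda>i\<in>{..<d}. r * x i)"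

definition euclid_lebesgue :: "nat \<Rightarrow> (nat \<Rightarrow> real) measure" where
  "euclid_lebesgue d = PiM {..<d} (\<lambda>_. lborel)"

definition euclid_unit_ball :: "nat \<Rightarrow> (nat \<Rightarrow> real) set" where
  "euclid_unit_ball d = {x \<in> space (euclid_lebesgue d). L2_set x {..<d} \<le> 1}"

text \<open>
  The uniform distribution on the unit sphere is normalized surface measure, surface measure being
  given as in the polar decomposition of Lebesgue measure: the mass of a Borel set \<open>A\<close> of directions
  is proportional to the volume of the cone of all \<open>x\<close> in the unit ball with \<open>x / norm x \<in> A\<close>.
  The origin is a null set for \<open>d \<ge> 1\<close>; for \<open>d = 0\<close> the sphere is empty and the value is a dummy.
\<close>

definition unif_sphere :: "nat \<Rightarrow> (nat \<Rightarrow> real) measure" where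
  "unif_sphere d =
     distr (uniform_measure (euclid_lebesgue d) (euclid_unit_ball d)) (euclid_borel d)
       (\<lambda>x. euclid_scale d (1 / L2_set x {..<d}) x)"

text \<open>$0 \log 0 = 0$ holds automatically since \<open>0 * ln 0 = 0\<close>.\<close>

definition entropy3 :: "(nat \<Rightarrow> real) \<Rightarrow> real" where
  "entropy3 q = - (\<Sum>i=1..3. q i * ln (q i))"

text \<open>The conditional law of the randomized label \<open>L\<^sub>v(X)\<close> given \<open>X = x\<close>.\<close>

definition farthest_label :: "('a \<Rightarrow> 'a \<Rightarrow> real) \<Rightarrow> (nat \<Rightarrow> 'a) \<Rightarrow> 'a \<Rightarrow> nat pmf" where
  "farthest_label dst v x = pmf_of_set {i. is_arg_max (\<lambda>i. dst x (v i)) (\<lambda>i. i \<in> {1..3}) i}"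

text \<open>
  The query is independent of the prototypes and of the randomization, so conditioning on
  \<open>V = v\<close> amounts to integrating over the query with \<open>v\<close> fixed.
\<close>

definition label_prob :: "'a measure \<Rightarrow> ('a \<Rightarrow> 'a \<Rightarrow> real) \<Rightarrow> (nat \<Rightarrow> 'a) \<Rightarrow> nat \<Rightarrow> real" where
  "label_prob P dst v i = (\<integral>x. pmf (farthest_label dst v x) i \<partial>P)"

definition triplet_entropy :: "'a measure \<Rightarrow> ('a \<Rightarrow> 'a \<Rightarrow> real) \<Rightarrow> real" where
  "triplet_entropy P dst = (\<integral>v. entropy3 (label_prob P dst v) \<partial>PiM {1..3} (\<lambda>_. P))"

definition std_normal :: "real measure" where
  "std_normal = density lborel (\<lambda>x. ennreal (std_normal_density x))"

definition master_prob :: "real \<Rightarrow> (nat \<Rightarrow> real) \<Rightarrow> nat \<Rightarrow> real" where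
  "master_prob l w i =
     measure (PiM {1..3} (\<lambda>_. std_normal))
       {z \<in> space (PiM {1..3} (\<lambda>_. std_normal)).
          l * w i - z i = (MAX j\<in>{1..3}. l * w j - z j)}"

definition master_entropy :: "real \<Rightarrow> real measure \<Rightarrow> real" where
  "master_entropy l F = (\<integral>w. entropy3 (master_prob l w) \<partial>PiM {1..3} (\<lambda>_. F))"

end

theory Submission
  imports Defs
begin

text \<open>
  Write \<open>R\<^sub>d = \<rho>(1 + \<tau>\<xi>)\<close> for the radii. In the squared distances
  \<open>\<parallel>X - V\<^sub>j\<parallel>\<^sup>2 = R\<^sup>2 + R\<^sub>j\<^sup>2 - 2RR\<^sub>j\<langle>U, U\<^sub>j\<rangle>\<close> the first term is common to the three
  labels. After subtraction of \<open>R\<^sup>2 + \<rho>\<^sup>2\<close> and multiplication by \<open>\<surd>d / (2\<rho>\<^sup>2)\<close>, the farthest label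
  maximizes the score
  \<open>\<lambda> w\<^sub>j - (R/\<rho>) (R\<^sub>j/\<rho>) \<surd>d \<langle>U, U\<^sub>j\<rangle>\<close> with \<open>w\<^sub>j = \<xi>\<^sub>j + \<tau>\<xi>\<^sub>j\<^sup>2/2\<close>. The radial factors tend
  to 1 because \<open>\<tau> \<rightarrow> 0\<close>, and for given prototypes the numbers \<open>\<surd>d \<langle>U, U\<^sub>j\<rangle>\<close> are asymptotically three
  independent standard normal variables. Hence the label probabilities given the prototypes are
  close to the master probabilities at \<open>\<lambda>\<close> and \<open>w\<close>. The error does not depend on \<open>\<lambda>\<close> or \<open>w\<close>, so
  one estimate serves the three regimes.

  The conditional Gaussian limit is made quantitative as follows. A uniform direction is a normalized
  Gaussian vector \<open>G\<close> (\<open>unif_sphere_eq_normal_direction\<close>), so \<open>\<surd>d \<langle>U, u\<^sub>j\<rangle>\<close> is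
  \<open>\<langle>G, u\<^sub>j\<rangle>\<close> up to the factor \<open>\<surd>d / \<parallel>G\<parallel>\<close>, which is close to 1. The three numbers \<open>\<langle>G, u\<^sub>j\<rangle>\<close>
  have exactly the law of \<open>Lz\<close> for a standard normal \<open>z\<close> in three dimensions and the Cholesky factor
  \<open>L\<close> of the Gram matrix of the \<open>u\<^sub>j\<close> (\<open>std_normal_three_linear_forms\<close>). Independent directions are nearly
  orthogonal, so \<open>L\<close> is close to the identity. Finally a small perturbation of the scores can change
  the maximizer only near a tie (\<open>argmax_stability\<close>), and a difference of two Gaussian scores is
  rarely small (\<open>std_normal_anti_concentration\<close>). This gives \<open>expected_label_gap\<close>, and with
  the uniform continuity of the entropy \<open>triplet_entropy_near_master\<close>.

  What remains is the limit of the expected entropy of the master probabilities at \<open>\<lambda>\<^sub>d\<close> and \<open>w\<close>, in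
  which only the laws of the standardized radii enter. By Skorohod's theorem these may be assumed to
  converge pointwise, and then \<open>w\<close> has the same limit. If \<open>\<lambda>\<^sub>d\<close> converges, the integrand
  converges by the continuity of the master probabilities; at \<open>\<lambda> = 0\<close> all three are \<open>1/3\<close> by symmetry. If \<open>\<lambda>\<^sub>d \<rightarrow> \<infinity>\<close> and the limit law has no
  atoms, the three limiting radii are distinct, the largest one wins, and the
  entropy tends to 0. Dominated convergence concludes in both cases.
\<close>

section \<open>Rotation invariance of Gaussian vectors\<close>

lemma prob_space_std_normal: "prob_space std_normal"
  unfolding std_normal_def by (rule prob_space_normal_density) simp

lemma sets_std_normal [simp, measurable_cong]: "sets std_normal = sets borel"
  by (simp add: std_normal_def)

lemma space_std_normal [simp]: "space std_normal = UNIV"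
  by (simp add: std_normal_def)

interpretation std_normal: prob_space std_normal
  by (rule prob_space_std_normal)

abbreviation normal_mean :: "(real \<Rightarrow> ennreal) \<Rightarrow> ennreal" (binder "\<E>" 10) where
  "normal_mean f \<equiv> \<integral>\<^sup>+x. f x \<partial>std_normal"

abbreviation gauss :: "'i set \<Rightarrow> ('i \<Rightarrow> real) measure" where
  "gauss I \<equiv> PiM I (\<lambda>_. std_normal)"

abbreviation triple_measurable :: "(real \<Rightarrow> real \<Rightarrow> real \<Rightarrow> ennreal) \<Rightarrow> bool" where
  "triple_measurable f \<equiv> (\<lambda>(x, y, z). f x y z) \<in> borel_measurable (borel \<Otimes>\<^sub>M borel \<Otimes>\<^sub>M borel)"

lemma nn_integral_std_normal:
  "f \<in> borel_measurable borel \<Longrightarrow>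
    (\<E> z. f z) = (\<integral>\<^sup>+z. ennreal (std_normal_density z) * f z \<partial>lborel)"
  unfolding std_normal_def by (subst nn_integral_density) auto

lemma std_normal_density_mult:
  "std_normal_density x * std_normal_density y = exp (- (x\<^sup>2 + y\<^sup>2) / 2) / (2 * pi)"
  by (simp add: std_normal_density_def mult_exp_exp real_sqrt_mult field_simps
      flip: exp_add power2_eq_square)

lemma nn_integral_std_normal2:
  assumes [measurable]: "case_prod f \<in> borel_measurable (borel \<Otimes>\<^sub>M borel)"
  shows "(\<E> x. \<E> y. f x y) =
    (\<integral>\<^sup>+x. \<integral>\<^sup>+y. ennreal (exp (- (x\<^sup>2 + y\<^sup>2) / 2) / (2 * pi)) * f x y \<partial>lborel \<partial>lborel)"
proof -
  have eq: "ennreal (exp (- (x\<^sup>2 + y\<^sup>2) / 2) / (2 * pi)) * w =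
      ennreal (std_normal_density x) * (ennreal (std_normal_density y) * w)" for x y w
    unfolding std_normal_density_mult[symmetric] by (simp add: ennreal_mult mult.assoc)
  show ?thesis
    unfolding eq by (simp add: nn_integral_std_normal nn_integral_cmult)
qed

lemma nn_integral_std_normal_swap:
  assumes [measurable]: "case_prod f \<in> borel_measurable (borel \<Otimes>\<^sub>M borel)"
  shows "(\<E> x. \<E> y. f x y) = (\<E> y. \<E> x. f x y)"
proof -
  interpret pair_sigma_finite std_normal std_normal ..
  show ?thesis by (rule Fubini') measurable
qed

lemma nn_integral_lborel_swap:
  assumes [measurable]: "case_prod f \<in> borel_measurable (borel \<Otimes>\<^sub>M borel)"
  shows "(\<integral>\<^sup>+x. \<integral>\<^sup>+y. f x y \<partial>lborel \<partial>lborel) = (\<integral>\<^sup>+y. \<integral>\<^sup>+x. f x y \<partial>(lborel :: real measure) \<partial>(lborel :: real measure))"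
  by (rule lborel_pair.Fubini') measurable

text \<open>
  A rotation with \<open>c \<noteq> 0\<close> is a composition of two maps that change one coordinate each, so two affine
  substitutions on the line suffice; their Jacobians \<open>1/c\<close> and \<open>c\<close> cancel.
\<close>

lemma lborel_rotation_generic:
  fixes c s :: real
  assumes cs: "c\<^sup>2 + s\<^sup>2 = 1" and c: "c \<noteq> 0"
    and [measurable]: "case_prod f \<in> borel_measurable (borel \<Otimes>\<^sub>M borel)"
  shows "(\<integral>\<^sup>+x. \<integral>\<^sup>+y. f x y \<partial>lborel \<partial>lborel) =
    (\<integral>\<^sup>+x. \<integral>\<^sup>+y. f (c * x - s * y) (s * x + c * y) \<partial>lborel \<partial>lborel)"
proof -
  have "(\<integral>\<^sup>+x. \<integral>\<^sup>+y. f x y \<partial>lborel \<partial>lborel) =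
      (\<integral>\<^sup>+x. ennreal \<bar>1/c\<bar> * (\<integral>\<^sup>+y. f x ((s/c) * x + 1/c * y) \<partial>lborel) \<partial>lborel)"
    by (intro nn_integral_cong nn_integral_real_affine) (use c in auto)
  also have "\<dots> = ennreal \<bar>1/c\<bar> * (\<integral>\<^sup>+x. \<integral>\<^sup>+y. f x ((s/c) * x + 1/c * y) \<partial>lborel \<partial>lborel)"
    by (intro nn_integral_cmult) measurable
  also have "(\<integral>\<^sup>+x. \<integral>\<^sup>+y. f x ((s/c) * x + 1/c * y) \<partial>lborel \<partial>lborel) =
      (\<integral>\<^sup>+y. \<integral>\<^sup>+x. f x ((s/c) * x + 1/c * y) \<partial>lborel \<partial>lborel)"
    by (rule nn_integral_lborel_swap) measurable
  also have "\<dots> = (\<integral>\<^sup>+y. ennreal \<bar>c\<bar> * (\<integral>\<^sup>+x. f (- s * y + c * x) ((s/c) * (- s * y + c * x) + 1/c * y) \<partial>lborel) \<partial>lborel)"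
    by (intro nn_integral_cong nn_integral_real_affine) (use c in auto)
  also have "\<dots> = (\<integral>\<^sup>+y. ennreal \<bar>c\<bar> * (\<integral>\<^sup>+x. f (c * x - s * y) (s * x + c * y) \<partial>lborel) \<partial>lborel)"
  proof -
    have "(s/c) * (- s * y + c * x) + 1/c * y = s * x + c * y" for x y
    proof -
      have "(s/c) * (- s * y + c * x) + 1/c * y = s * x + (1 - s\<^sup>2) / c * y"
        using c by (simp add: field_simps power2_eq_square)
      also have "1 - s\<^sup>2 = c\<^sup>2" using cs by simp
      finally show ?thesis using c by (simp add: power2_eq_square)
    qed
    then show ?thesis by (simp add: algebra_simps)
  qed
  also have "\<dots> = ennreal \<bar>c\<bar> * (\<integral>\<^sup>+y. \<integral>\<^sup>+x. f (c * x - s * y) (s * x + c * y) \<partial>lborel \<partial>lborel)"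
    by (intro nn_integral_cmult) measurable
  also have "(\<integral>\<^sup>+y. \<integral>\<^sup>+x. f (c * x - s * y) (s * x + c * y) \<partial>lborel \<partial>lborel) =
      (\<integral>\<^sup>+x. \<integral>\<^sup>+y. f (c * x - s * y) (s * x + c * y) \<partial>lborel \<partial>lborel)"
    by (rule nn_integral_lborel_swap) measurable
  also have "ennreal \<bar>1/c\<bar> * (ennreal \<bar>c\<bar> * A) = A" for A
    using c by (simp add: mult.assoc[symmetric] flip: ennreal_mult)
  finally show ?thesis .
qed

lemma lborel_rotation:
  fixes c s :: real
  assumes cs: "c\<^sup>2 + s\<^sup>2 = 1"
    and [measurable]: "case_prod f \<in> borel_measurable (borel \<Otimes>\<^sub>M borel)"
  shows "(\<integral>\<^sup>+x. \<integral>\<^sup>+y. f x y \<partial>lborel \<partial>lborel) =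
    (\<integral>\<^sup>+x. \<integral>\<^sup>+y. f (c * x - s * y) (s * x + c * y) \<partial>lborel \<partial>lborel)"
proof (cases "c = 0")
  case False
  then show ?thesis using assms by (intro lborel_rotation_generic)
next
  case True
  have s: "s \<noteq> 0" "\<bar>s\<bar> = 1" using cs True by (auto simp: abs_square_eq_1)
  have "(\<integral>\<^sup>+x. \<integral>\<^sup>+y. f x y \<partial>lborel \<partial>lborel) =
     (\<integral>\<^sup>+x. ennreal \<bar>s\<bar> * (\<integral>\<^sup>+y. f x (0 + s * y) \<partial>lborel) \<partial>lborel)"
    by (intro nn_integral_cong nn_integral_real_affine) (use s in auto)
  also have "\<dots> = ennreal \<bar>-s\<bar> * (\<integral>\<^sup>+x. \<integral>\<^sup>+y. f (0 + (-s) * x) (0 + s * y) \<partial>lborel \<partial>lborel)"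
    using s by (subst nn_integral_real_affine[of _ "-s" 0]) auto
  also have "\<dots> = (\<integral>\<^sup>+y. \<integral>\<^sup>+x. f (0 + (-s) * x) (0 + s * y) \<partial>lborel \<partial>lborel)"
    by (subst nn_integral_lborel_swap) (use s in auto)
  finally show ?thesis using True by simp
qed

text \<open>
  Lebesgue measure is invariant under the rotation, and so is the density, a function of \<open>x\<^sup>2 + y\<^sup>2\<close>.
\<close>

lemma std_normal_rotation:
  assumes cs: "c\<^sup>2 + s\<^sup>2 = (1::real)"
    and [measurable]: "case_prod f \<in> borel_measurable (borel \<Otimes>\<^sub>M borel)"
  shows "(\<E> x. \<E> y. f x y) =
    (\<E> x. \<E> y. f (c * x - s * y) (s * x + c * y))"
proof -
  have eq: "(c * x - s * y)\<^sup>2 + (s * x + c * y)\<^sup>2 = x\<^sup>2 + y\<^sup>2" for x y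
  proof -
    have "(c * x - s * y)\<^sup>2 + (s * x + c * y)\<^sup>2 = (c\<^sup>2 + s\<^sup>2) * (x\<^sup>2 + y\<^sup>2)" by algebra
    then show ?thesis by (simp add: cs)
  qed
  have "(\<E> x. \<E> y. f x y) =
    (\<integral>\<^sup>+x. \<integral>\<^sup>+y. ennreal (exp (- (x\<^sup>2 + y\<^sup>2) / 2) / (2 * pi)) * f x y \<partial>lborel \<partial>lborel)"
    by (rule nn_integral_std_normal2) measurable
  also have "\<dots> = (\<integral>\<^sup>+x. \<integral>\<^sup>+y. ennreal (exp (- ((c * x - s * y)\<^sup>2 + (s * x + c * y)\<^sup>2) / 2) / (2 * pi)) *
      f (c * x - s * y) (s * x + c * y) \<partial>lborel \<partial>lborel)"
    by (rule lborel_rotation[OF cs]) measurable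
  also have "\<dots> = (\<E> x. \<E> y. f (c * x - s * y) (s * x + c * y))"
    unfolding eq by (rule nn_integral_std_normal2[symmetric]) measurable
  finally show ?thesis .
qed

text \<open>
  The Givens rotation, which turns the vector \<open>(l, a)\<close> onto the first axis.
\<close>

lemma std_normal_givens:
  fixes l a :: real
  obtains c s where "c\<^sup>2 + s\<^sup>2 = (1::real)" "l * c + a * s = sqrt (l\<^sup>2 + a\<^sup>2)" "l * s = a * c"
proof (cases "l = 0 \<and> a = 0")
  case True
  then show ?thesis by (intro that[of 1 0]) auto
next
  case False
  define m where "m = sqrt (l\<^sup>2 + a\<^sup>2)"
  have m: "m > 0" "m\<^sup>2 = l\<^sup>2 + a\<^sup>2"
    using False by (auto simp: m_def sum_power2_gt_zero_iff)
  have "(l/m)\<^sup>2 + (a/m)\<^sup>2 = 1"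
    using m False by (simp add: power_divide add_divide_distrib[symmetric])
  moreover have "l * (l/m) + a * (a/m) = m"
    using m by (simp add: field_simps power2_eq_square)
  ultimately show ?thesis by (intro that[of "l/m" "a/m"]) (auto simp: m_def)
qed

lemma measurable_triple_app:
  assumes f: "(\<lambda>(x, y, z). f x y z) \<in> measurable (borel \<Otimes>\<^sub>M borel \<Otimes>\<^sub>M borel) L"
    and [measurable]: "a \<in> measurable N borel" "b \<in> measurable N borel" "c \<in> measurable N borel"
  shows "(\<lambda>w. f (a w) (b w) (c w)) \<in> measurable N L"
  using measurable_compose[OF _ f, of "\<lambda>w. (a w, b w, c w)" N] by simp

text \<open>
  Rewriting three linear forms in two independent standard normals so that the first one no longer
  involves \<open>g\<close>.
\<close>

abbreviation givens_law :: "real \<Rightarrow> real \<Rightarrow> real \<Rightarrow> real \<Rightarrow> real \<Rightarrow> real \<Rightarrow>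
    real \<Rightarrow> real \<Rightarrow> real \<Rightarrow> real \<Rightarrow> real \<Rightarrow> bool" where
  "givens_law l1 a1 l2 a2 l3 a3 k1 k2 b2 k3 b3 \<equiv> \<forall>f. triple_measurable f \<longrightarrow>
    (\<E> g. \<E> x. f (l1 * x + a1 * g) (l2 * x + a2 * g) (l3 * x + a3 * g)) =
    (\<E> x. \<E> g. f (k1 * x) (k2 * x + b2 * g) (k3 * x + b3 * g))"

text \<open>
  The new coefficients come from the Givens rotation for the first form. The equations say that the
  inner products of the coefficient vectors \<open>(l\<^sub>j, a\<^sub>j)\<close> are preserved, as they are by every rotation.
\<close>

lemma std_normal_givens_step:
  fixes l1 l2 l3 a1 a2 a3 :: real
  obtains k1 k2 k3 b2 b3 where
    "k1 \<ge> 0" "k1\<^sup>2 = l1\<^sup>2 + a1\<^sup>2" "k1 * k2 = l1 * l2 + a1 * a2" "k1 * k3 = l1 * l3 + a1 * a3"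
    "k2\<^sup>2 + b2\<^sup>2 = l2\<^sup>2 + a2\<^sup>2" "k2 * k3 + b2 * b3 = l2 * l3 + a2 * a3" "k3\<^sup>2 + b3\<^sup>2 = l3\<^sup>2 + a3\<^sup>2"
    "givens_law l1 a1 l2 a2 l3 a3 k1 k2 b2 k3 b3"
proof -
  obtain c s where cs: "c\<^sup>2 + s\<^sup>2 = (1::real)" "l1 * c + a1 * s = sqrt (l1\<^sup>2 + a1\<^sup>2)" "l1 * s = a1 * c"
    by (rule std_normal_givens)
  have inner: "(l * c + a * s) * (l' * c + a' * s) + (a * c - l * s) * (a' * c - l' * s) = l * l' + a * a'"
    for l a l' a'
  proof -
    have "(l * c + a * s) * (l' * c + a' * s) + (a * c - l * s) * (a' * c - l' * s)
      = (c\<^sup>2 + s\<^sup>2) * (l * l' + a * a')" by algebra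
    then show ?thesis using cs(1) by simp
  qed
  have comb: "l * (c * x - s * g) + a * (s * x + c * g) = (l * c + a * s) * x + (a * c - l * s) * g"
    for l a x g by algebra
  have z: "a1 * c - l1 * s = 0" using cs(3) by simp
  show ?thesis
  proof (rule that[of "l1 * c + a1 * s" "l2 * c + a2 * s" "l3 * c + a3 * s"
        "a2 * c - l2 * s" "a3 * c - l3 * s"], goal_cases)
    case 8
    show ?case
    proof (intro allI impI)
    fix f :: "real \<Rightarrow> real \<Rightarrow> real \<Rightarrow> ennreal"
    assume f: "triple_measurable f"
    note [measurable (raw)] = measurable_triple_app[OF f]
    have "(\<E> g. \<E> x. f (l1 * x + a1 * g) (l2 * x + a2 * g) (l3 * x + a3 * g)) =
        (\<E> x. \<E> g. f (l1 * x + a1 * g) (l2 * x + a2 * g) (l3 * x + a3 * g))"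
      by (rule nn_integral_std_normal_swap) measurable
    also have "\<dots> = (\<E> x. \<E> g. f (l1 * (c * x - s * g) + a1 * (s * x + c * g))
        (l2 * (c * x - s * g) + a2 * (s * x + c * g))
        (l3 * (c * x - s * g) + a3 * (s * x + c * g)))"
      by (rule std_normal_rotation[OF cs(1)]) measurable
    also have "\<dots> = (\<E> x. \<E> g. f ((l1 * c + a1 * s) * x) ((l2 * c + a2 * s) * x + (a2 * c - l2 * s) * g)
          ((l3 * c + a3 * s) * x + (a3 * c - l3 * s) * g))"
      unfolding comb by (simp add: z)
    finally show "(\<E> g. \<E> x. f (l1 * x + a1 * g) (l2 * x + a2 * g) (l3 * x + a3 * g)) = \<dots>" .
    qed
  qed (use cs(2) inner[of l1 a1 l1 a1] inner[of l1 a1 l2 a2] inner[of l1 a1 l3 a3] inner[of l2 a2 l2 a2]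
      inner[of l3 a3 l3 a3] inner[of l2 a2 l3 a3] z in \<open>auto simp: power2_eq_square\<close>)
qed

interpretation std_normal_PiM: product_prob_space "\<lambda>_. std_normal" UNIV ..

text \<open>
  The lower triangular matrix with rows \<open>(l11, 0, 0)\<close>, \<open>(l21, l22, 0)\<close>, \<open>(l31, l32, l33)\<close> is a Cholesky
  factor of the Gram matrix of \<open>u1\<close>, \<open>u2\<close>, \<open>u3\<close>.
\<close>

definition cholesky3 :: "'i set \<Rightarrow> ('i \<Rightarrow> real) \<Rightarrow> ('i \<Rightarrow> real) \<Rightarrow> ('i \<Rightarrow> real) \<Rightarrow>
    real \<Rightarrow> real \<Rightarrow> real \<Rightarrow> real \<Rightarrow> real \<Rightarrow> real \<Rightarrow> bool" where
  "cholesky3 I u1 u2 u3 l11 l21 l22 l31 l32 l33 \<longleftrightarrow> l11 \<ge> 0 \<and> l22 \<ge> 0 \<and> l33 \<ge> 0 \<and>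
    l11\<^sup>2 = (\<Sum>i\<in>I. (u1 i)\<^sup>2) \<and> l11 * l21 = (\<Sum>i\<in>I. u1 i * u2 i) \<and> l11 * l31 = (\<Sum>i\<in>I. u1 i * u3 i) \<and>
    l21\<^sup>2 + l22\<^sup>2 = (\<Sum>i\<in>I. (u2 i)\<^sup>2) \<and> l21 * l31 + l22 * l32 = (\<Sum>i\<in>I. u2 i * u3 i) \<and>
    l31\<^sup>2 + l32\<^sup>2 + l33\<^sup>2 = (\<Sum>i\<in>I. (u3 i)\<^sup>2)"

lemma cholesky3D:
  assumes "cholesky3 I u1 u2 u3 l11 l21 l22 l31 l32 l33"
  shows "l11 \<ge> 0" "l22 \<ge> 0" "l33 \<ge> 0"
    "l11\<^sup>2 = (\<Sum>i\<in>I. (u1 i)\<^sup>2)" "l11 * l21 = (\<Sum>i\<in>I. u1 i * u2 i)" "l11 * l31 = (\<Sum>i\<in>I. u1 i * u3 i)"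
    "l21\<^sup>2 + l22\<^sup>2 = (\<Sum>i\<in>I. (u2 i)\<^sup>2)" "l21 * l31 + l22 * l32 = (\<Sum>i\<in>I. u2 i * u3 i)"
    "l31\<^sup>2 + l32\<^sup>2 + l33\<^sup>2 = (\<Sum>i\<in>I. (u3 i)\<^sup>2)"
  using assms unfolding cholesky3_def by auto

text \<open>
  Equality in law of the three inner products of \<open>u1\<close>, \<open>u2\<close>, \<open>u3\<close> with a standard normal vector and of the
  triangular matrix applied to a three-dimensional one, tested on nonnegative functions.
\<close>

abbreviation linear_forms_law :: "'i set \<Rightarrow> ('i \<Rightarrow> real) \<Rightarrow> ('i \<Rightarrow> real) \<Rightarrow> ('i \<Rightarrow> real) \<Rightarrow>
    real \<Rightarrow> real \<Rightarrow> real \<Rightarrow> real \<Rightarrow> real \<Rightarrow> real \<Rightarrow> bool" where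
  "linear_forms_law I u1 u2 u3 l11 l21 l22 l31 l32 l33 \<equiv> \<forall>f. triple_measurable f \<longrightarrow>
    (\<integral>\<^sup>+g. f (\<Sum>i\<in>I. g i * u1 i) (\<Sum>i\<in>I. g i * u2 i) (\<Sum>i\<in>I. g i * u3 i) \<partial>gauss I) =
    (\<E> x. \<E> y. \<E> z. f (l11 * x) (l21 * x + l22 * y) (l31 * x + l32 * y + l33 * z))"

text \<open>
  Coordinates are added one at a time. A new one makes the triangular \<open>3 \<times> 3\<close> matrix a \<open>3 \<times> 4\<close> matrix,
  which three Givens rotations make triangular again. Rotations preserve Gram matrices and the
  Gaussian law.
\<close>

lemma std_normal_three_linear_forms:
  fixes u1 u2 u3 :: "'i \<Rightarrow> real"
  assumes "finite I"
  obtains l11 l21 l22 l31 l32 l33 where "cholesky3 I u1 u2 u3 l11 l21 l22 l31 l32 l33"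
    "linear_forms_law I u1 u2 u3 l11 l21 l22 l31 l32 l33"
  using assms
proof (induction I arbitrary: thesis)
  case empty
  have "emeasure (PiM {} (\<lambda>_::'i. std_normal)) (space (PiM {} (\<lambda>_. std_normal))) = 1"
    by (intro prob_space.emeasure_space_1 prob_space_PiM prob_space_std_normal)
  then show ?case
    by (intro empty(1)[of 0 0 0 0 0 0]) (simp_all add: cholesky3_def std_normal.emeasure_space_1[simplified])
next
  case (insert j I)
  obtain l11 l21 l22 l31 l32 l33 where ch: "cholesky3 I u1 u2 u3 l11 l21 l22 l31 l32 l33"
    and law: "linear_forms_law I u1 u2 u3 l11 l21 l22 l31 l32 l33"
    by (rule insert.IH)
  note gram = cholesky3D(4-9)[OF ch] and law = law[rule_format]
  obtain m1 m21 m31 b2 b3 where G1: "m1 \<ge> 0" "m1\<^sup>2 = l11\<^sup>2 + (u1 j)\<^sup>2" "m1 * m21 = l11 * l21 + u1 j * u2 j"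
    "m1 * m31 = l11 * l31 + u1 j * u3 j"
    "m21\<^sup>2 + b2\<^sup>2 = l21\<^sup>2 + (u2 j)\<^sup>2" "m21 * m31 + b2 * b3 = l21 * l31 + u2 j * u3 j" "m31\<^sup>2 + b3\<^sup>2 = l31\<^sup>2 + (u3 j)\<^sup>2"
    and R1: "givens_law l11 (u1 j) l21 (u2 j) l31 (u3 j) m1 m21 b2 m31 b3"
    by (rule std_normal_givens_step[of l11 "u1 j" l21 "u2 j" l31 "u3 j"]) (rule that; assumption)
  obtain m2 m32 c3 m' c' where G2: "m2 \<ge> 0" "m2\<^sup>2 = l22\<^sup>2 + b2\<^sup>2" "m2 * m32 = l22 * l32 + b2 * b3" "m32\<^sup>2 + c3\<^sup>2 = l32\<^sup>2 + b3\<^sup>2"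
    and R2: "givens_law l22 b2 l32 b3 0 0 m2 m32 c3 m' c'"
    by (rule std_normal_givens_step[of l22 b2 l32 b3 0 0]) (rule that; assumption)
  obtain m3 n2 n3 e2 e3 where G3: "m3 \<ge> 0" "m3\<^sup>2 = l33\<^sup>2 + c3\<^sup>2"
    and R3: "givens_law l33 c3 0 0 0 0 m3 n2 e2 n3 e3"
    by (rule std_normal_givens_step[of l33 c3 0 0 0 0]) (rule that; assumption)
  have split: "(\<Sum>i\<in>insert j I. (g(j := h)) i * u i) = (\<Sum>i\<in>I. g i * u i) + u j * h" for g u and h :: real
  proof -
    have "(\<Sum>i\<in>I. (g(j := h)) i * u i) = (\<Sum>i\<in>I. g i * u i)"
      using insert.hyps by (intro sum.cong) auto
    then show ?thesis using insert.hyps by simp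
  qed
  have law': "(\<integral>\<^sup>+g. f (\<Sum>i\<in>insert j I. g i * u1 i) (\<Sum>i\<in>insert j I. g i * u2 i) (\<Sum>i\<in>insert j I. g i * u3 i)
        \<partial>gauss (insert j I)) =
      (\<E> x. \<E> y. \<E> z. f (m1 * x) (m21 * x + m2 * y) (m31 * x + m32 * y + m3 * z))"
    if f: "triple_measurable f" for f
  proof -
    note [measurable (raw)] = measurable_triple_app[OF f]
    have "(\<integral>\<^sup>+g. f (\<Sum>i\<in>insert j I. g i * u1 i) (\<Sum>i\<in>insert j I. g i * u2 i) (\<Sum>i\<in>insert j I. g i * u3 i)
        \<partial>gauss (insert j I)) =
      (\<E> h. \<integral>\<^sup>+g. f (\<Sum>i\<in>insert j I. (g(j := h)) i * u1 i) (\<Sum>i\<in>insert j I. (g(j := h)) i * u2 i)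
        (\<Sum>i\<in>insert j I. (g(j := h)) i * u3 i) \<partial>gauss I)"
      by (intro std_normal_PiM.product_nn_integral_insert_rev insert.hyps) measurable
    also have "\<dots> = (\<E> h. \<integral>\<^sup>+g. f ((\<Sum>i\<in>I. g i * u1 i) + u1 j * h) ((\<Sum>i\<in>I. g i * u2 i) + u2 j * h)
        ((\<Sum>i\<in>I. g i * u3 i) + u3 j * h) \<partial>gauss I)"
      unfolding split ..
    also have "\<dots> = (\<E> h. \<E> x. \<E> y. \<E> z. f (l11 * x + u1 j * h) (l21 * x + l22 * y + u2 j * h)
        (l31 * x + l32 * y + l33 * z + u3 j * h))"
      by (intro nn_integral_cong law) measurable
    \<comment> \<open>Each rotation acts on the new coordinate \<open>h\<close> and one old coordinate and removes \<open>h\<close> from one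
      more of the three forms; after the third one \<open>h\<close> is gone and integrates to 1.\<close>
    also have "\<dots> = (\<E> h. \<E> x. \<E> y. \<E> z. f (l11 * x + u1 j * h) ((l21 * x + u2 j * h) + l22 * y)
        ((l31 * x + u3 j * h) + l32 * y + l33 * z))"
      by (simp only: add_ac)
    also have "\<dots> = (\<E> x. \<E> h. \<E> y. \<E> z. f (m1 * x) ((m21 * x + b2 * h) + l22 * y)
        ((m31 * x + b3 * h) + l32 * y + l33 * z))"
      by (rule R1[rule_format]) measurable
    also have "\<dots> = (\<E> x. \<E> h. \<E> y. \<E> z. f (m1 * x) (m21 * x + (l22 * y + b2 * h))
        (m31 * x + (l32 * y + b3 * h) + l33 * z))"
      by (simp only: add_ac)
    also have "\<dots> = (\<E> x. \<E> y. \<E> h. \<E> z. f (m1 * x) (m21 * x + m2 * y) (m31 * x + (m32 * y + c3 * h) + l33 * z))"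
      by (intro nn_integral_cong R2[rule_format]) measurable
    also have "\<dots> = (\<E> x. \<E> y. \<E> h. \<E> z. f (m1 * x) (m21 * x + m2 * y) (m31 * x + m32 * y + (l33 * z + c3 * h)))"
      by (simp only: add_ac)
    also have "\<dots> = (\<E> x. \<E> y. \<E> z. \<E> h. f (m1 * x) (m21 * x + m2 * y) (m31 * x + m32 * y + m3 * z))"
      by (intro nn_integral_cong R3[rule_format]) measurable
    also have "\<dots> = (\<E> x. \<E> y. \<E> z. f (m1 * x) (m21 * x + m2 * y) (m31 * x + m32 * y + m3 * z))"
      by (simp add: std_normal.emeasure_space_1[simplified])
    finally show ?thesis .
  qed
  have ins: "(\<Sum>i\<in>insert j I. q i) = q j + (\<Sum>i\<in>I. q i)" for q :: "'i \<Rightarrow> real"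
    by (rule sum.insert[OF insert.hyps(1,2)])
  have "cholesky3 (insert j I) u1 u2 u3 m1 m21 m2 m31 m32 m3"
    unfolding cholesky3_def ins gram[symmetric]
    using G1(1) G2(1) G3(1) G1(2-7) G2(2-4) G3(2) by (intro conjI) linarith+
  then show ?case
    using law' by (intro insert.prems) blast+
qed

section \<open>Tails and anti-concentration of Gaussian linear forms\<close>

(* Keeps the set of labels in the form {1..3} during simplification. *)
declare One_nat_def [simp del]

lemma prob_space_std_normal_PiM: "prob_space (gauss I)"
  by (intro prob_space_PiM prob_space_std_normal)

text \<open>
  The inner product with \<open>u\<close> has law \<open>N(0, \<parallel>u\<parallel>\<^sup>2)\<close>, as the first of the three forms.
\<close>

lemma std_normal_linear_form:
  fixes u :: "'i \<Rightarrow> real"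
  assumes I: "finite I" and f: "f \<in> borel_measurable borel"
  shows "(\<integral>\<^sup>+g. f (\<Sum>i\<in>I. g i * u i) \<partial>gauss I) =
    (\<E> x. f (sqrt (\<Sum>i\<in>I. (u i)\<^sup>2) * x))"
proof -
  obtain l l21 l22 l31 l32 l33 where ch: "cholesky3 I u u u l l21 l22 l31 l32 l33"
    and law: "linear_forms_law I u u u l l21 l22 l31 l32 l33"
    by (rule std_normal_three_linear_forms[OF I])
  have "l = sqrt (\<Sum>i\<in>I. (u i)\<^sup>2)"
    using cholesky3D(1,4)[OF ch] real_sqrt_unique by metis
  then show ?thesis
    using law[rule_format, of "\<lambda>x _ _. f x"] f by (simp add: std_normal.emeasure_space_1[simplified])
qed

lemma std_normal_second_moment: "(\<E> x. ennreal (x\<^sup>2)) = 1"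
proof -
  have "(\<E> x. ennreal (x\<^sup>2)) = (\<integral>\<^sup>+x. ennreal (std_normal_density x * x ^ (2 * 1)) \<partial>lborel)"
    by (subst nn_integral_std_normal) (auto simp: ennreal_mult)
  also have "\<dots> = ennreal (fact (2 * 1) / (2 ^ 1 * fact 1))"
    using std_normal_moment_even[of 1] unfolding has_bochner_integral_iff
    by (subst nn_integral_eq_integral) auto
  finally show ?thesis by (simp add: numeral_2_eq_2)
qed

lemma emeasure_Collect_eq_nn_integral:
  assumes [measurable]: "X \<in> borel_measurable M" "Measurable.pred borel Q"
  shows "emeasure M {x \<in> space M. Q (X x)} = (\<integral>\<^sup>+x. indicator {t. Q t} (X x) \<partial>M)"
proof -
  have "(\<integral>\<^sup>+x. indicator {t. Q t} (X x) \<partial>M) = (\<integral>\<^sup>+x. indicator {x \<in> space M. Q (X x)} x \<partial>M)"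
    by (intro nn_integral_cong) (auto split: split_indicator)
  then show ?thesis by simp
qed

lemma std_normal_tail:
  fixes u :: "'i \<Rightarrow> real"
  assumes I: "finite I" and K: "K > 0"
  shows "\<P>(g in gauss I. \<bar>\<Sum>i\<in>I. g i * u i\<bar> > K) \<le>
    (\<Sum>i\<in>I. (u i)\<^sup>2) / K\<^sup>2"
proof -
  let ?G = "gauss I" and ?s = "\<Sum>i\<in>I. (u i)\<^sup>2"
  interpret prob_space ?G by (rule prob_space_std_normal_PiM)
  have s: "?s \<ge> 0" by (simp add: sum_nonneg)
  have "emeasure ?G {g \<in> space ?G. \<bar>\<Sum>i\<in>I. g i * u i\<bar> > K} =
      (\<integral>\<^sup>+g. indicator {t. \<bar>t\<bar> > K} (\<Sum>i\<in>I. g i * u i) \<partial>?G)"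
    by (rule emeasure_Collect_eq_nn_integral) measurable
  also have "\<dots> \<le> (\<integral>\<^sup>+g. ennreal ((\<Sum>i\<in>I. g i * u i)\<^sup>2 / K\<^sup>2) \<partial>?G)"
  proof (intro nn_integral_mono)
    fix g
    have "K\<^sup>2 \<le> t\<^sup>2" if "\<bar>t\<bar> > K" for t :: real
      using that K power_mono[of K "\<bar>t\<bar>" 2] by simp
    then show "indicator {t. \<bar>t\<bar> > K} (\<Sum>i\<in>I. g i * u i) \<le> ennreal ((\<Sum>i\<in>I. g i * u i)\<^sup>2 / K\<^sup>2)"
      using K by (auto split: split_indicator simp: field_simps)
  qed
  also have "\<dots> = (\<E> x. ennreal ((sqrt ?s * x)\<^sup>2 / K\<^sup>2))"
    by (rule std_normal_linear_form[OF I]) measurable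
  also have "\<dots> = (\<E> x. ennreal (?s / K\<^sup>2) * ennreal (x\<^sup>2))"
    using s by (intro nn_integral_cong) (simp add: power_mult_distrib flip: ennreal_mult)
  also have "\<dots> = ennreal (?s / K\<^sup>2)"
    by (subst nn_integral_cmult) (auto simp: std_normal_second_moment)
  finally show ?thesis
    unfolding emeasure_eq_measure using s by (subst (asm) ennreal_le_iff) auto
qed

text \<open>
  A centred normal variable of variance at least 1 has a density of at most \<open>1/2\<close>, which is integrated
  over an interval of length \<open>2t\<close>.
\<close>

lemma std_normal_anti_concentration:
  fixes u :: "'i \<Rightarrow> real"
  assumes I: "finite I" and t: "t \<ge> 0" and s: "(\<Sum>i\<in>I. (u i)\<^sup>2) \<ge> 1"
  shows "\<P>(g in gauss I. \<bar>c - (\<Sum>i\<in>I. g i * u i)\<bar> \<le> t) \<le> t"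
proof -
  let ?G = "gauss I" and ?s = "sqrt (\<Sum>i\<in>I. (u i)\<^sup>2)"
  interpret prob_space ?G by (rule prob_space_std_normal_PiM)
  have s: "?s \<ge> 1" using s by simp
  have dens: "std_normal_density x \<le> 1 / 2" for x
  proof -
    have "std_normal_density x \<le> 1 / sqrt (2 * pi) * 1"
      unfolding std_normal_density_def by (intro mult_left_mono) auto
    moreover have "2 \<le> sqrt (2 * pi)"
      using pi_gt3 by (intro real_le_rsqrt) auto
    ultimately show ?thesis by (smt (verit) frac_le)
  qed
  have "emeasure ?G {g \<in> space ?G. \<bar>c - (\<Sum>i\<in>I. g i * u i)\<bar> \<le> t} =
      (\<integral>\<^sup>+g. indicator {x. \<bar>c - x\<bar> \<le> t} (\<Sum>i\<in>I. g i * u i) \<partial>?G)"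
    by (rule emeasure_Collect_eq_nn_integral) measurable
  also have "\<dots> = (\<E> x. indicator {x. \<bar>c - x\<bar> \<le> t} (?s * x))"
    by (rule std_normal_linear_form[OF I]) measurable
  also have "\<dots> = (\<integral>\<^sup>+x. ennreal (std_normal_density x) * indicator {x. \<bar>c - x\<bar> \<le> t} (?s * x) \<partial>lborel)"
    by (rule nn_integral_std_normal) measurable
  also have "\<dots> \<le> (\<integral>\<^sup>+x. ennreal (1 / 2) * indicator {c / ?s - t .. c / ?s + t} x \<partial>lborel)"
  proof (intro nn_integral_mono mult_mono)
    fix x
    show "ennreal (std_normal_density x) \<le> ennreal (1 / 2)" using dens by (rule ennreal_leI)
    have "\<bar>c / ?s - x\<bar> \<le> t" if "\<bar>c - ?s * x\<bar> \<le> t"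
    proof -
      have "\<bar>c / ?s - x\<bar> = \<bar>c - ?s * x\<bar> / ?s"
      proof -
        have "c / ?s - x = (c - ?s * x) / ?s" using s by (simp add: diff_divide_distrib)
        then show ?thesis using s by (simp add: abs_divide)
      qed
      also have "\<dots> \<le> t / 1" using that s t by (intro frac_le) auto
      finally show ?thesis by simp
    qed
    then show "indicator {x. \<bar>c - x\<bar> \<le> t} (?s * x) \<le> (indicator {c / ?s - t .. c / ?s + t} x :: ennreal)"
      by (auto split: split_indicator simp: abs_le_iff)
  qed auto
  also have "\<dots> = ennreal (1 / 2) * ennreal (2 * t)"
    using t by (subst nn_integral_cmult_indicator) auto
  also have "\<dots> = ennreal t" using t by (subst ennreal_mult[symmetric]) auto
  finally show ?thesis
    unfolding emeasure_eq_measure using t by simp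
qed

section \<open>Stability of the argmax\<close>

text \<open>
  The number \<open>p\<close> is a probability with which label \<open>i\<close> may be chosen when the scores are \<open>T\<close>: it is
  prescribed unless \<open>i\<close> is tied for the maximum. This covers both the randomized farthest label
  and the indicator function of the event that \<open>i\<close> is a maximizer.
\<close>

definition argmax_weight :: "(nat \<Rightarrow> real) \<Rightarrow> nat \<Rightarrow> real \<Rightarrow> bool" where
  "argmax_weight T i p \<longleftrightarrow> 0 \<le> p \<and> p \<le> 1 \<and>
    ((\<forall>j\<in>{1..3} - {i}. T j < T i) \<longrightarrow> p = 1) \<and> ((\<exists>j\<in>{1..3}. T i < T j) \<longrightarrow> p = 0)"

lemma argmax_weight_transform:
  assumes "argmax_weight D i p" "i \<in> {1..3}"
    and "\<And>j k. j \<in> {1..3} \<Longrightarrow> k \<in> {1..3} \<Longrightarrow> T j < T k \<longleftrightarrow> D j < D k"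
  shows "argmax_weight T i p"
  using assms unfolding argmax_weight_def by (metis DiffE)

lemma argmax_weight_Max:
  assumes "i \<in> {1..3}"
  shows "argmax_weight T i (of_bool (T i = (MAX j\<in>{1..3}. T j)))"
proof -
  have "T i = (MAX j\<in>{1..3}. T j) \<longleftrightarrow> (\<forall>j\<in>{1..3}. T j \<le> T i)"
    using assms by (subst eq_commute, subst Max_eq_iff) auto
  moreover have "(\<forall>j\<in>{1..3}-{i}. T j < T i) \<Longrightarrow> (\<forall>j\<in>{1..3}. T j \<le> T i)"
    by (metis DiffI less_eq_real_def singletonD)
  ultimately show ?thesis unfolding argmax_weight_def by (auto simp: not_le)
qed

lemma finite_arg_max_set: "finite {i. is_arg_max D (\<lambda>i. i \<in> {1..3::nat}) i}"
  by (rule finite_subset[of _ "{1..3}"]) (auto simp: is_arg_max_def)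

lemma arg_max_set_nonempty: "{i. is_arg_max (D :: nat \<Rightarrow> real) (\<lambda>i. i \<in> {1..3::nat}) i} \<noteq> {}"
proof -
  have "(MAX j\<in>{1..3::nat}. D j) \<in> D ` {1..3}" by (intro Max_in) auto
  then obtain i where i: "i \<in> {1..3}" "D i = (MAX j\<in>{1..3}. D j)" by (metis imageE)
  have "D j \<le> D i" if "j \<in> {1..3}" for j using that by (simp add: i(2))
  then have "is_arg_max D (\<lambda>i. i \<in> {1..3}) i"
    using i(1) by (force simp: is_arg_max_def not_less)
  then show ?thesis by blast
qed

lemma set_pmf_farthest_label: "set_pmf (farthest_label dst v x) \<subseteq> {1..3}"
  unfolding farthest_label_def set_pmf_of_set[OF arg_max_set_nonempty finite_arg_max_set]
  by (auto simp: is_arg_max_def)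

lemma argmax_weight_farthest_label:
  assumes "i \<in> {1..3}"
  shows "argmax_weight (\<lambda>i. dst x (v i)) i (pmf (farthest_label dst v x) i)"
proof -
  let ?D = "\<lambda>i. dst x (v i)"
  let ?A = "{i. is_arg_max ?D (\<lambda>i. i \<in> {1..3}) i}"
  have le1: "pmf (farthest_label dst v x) i \<le> 1" by (rule pmf_le_1)
  have p: "pmf (farthest_label dst v x) i = indicator ?A i / card ?A"
    unfolding farthest_label_def by (rule pmf_of_set[OF arg_max_set_nonempty finite_arg_max_set])
  have "?A = {i}" if "\<forall>j\<in>{1..3} - {i}. ?D j < ?D i"
    using that assms by (auto simp: is_arg_max_def) (metis DiffI atLeastAtMost_iff less_asym singletonD)+
  moreover have "i \<notin> ?A" if "\<exists>j\<in>{1..3}. ?D i < ?D j"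
    using that by (auto simp: is_arg_max_def)
  ultimately show ?thesis
    unfolding argmax_weight_def using le1 p by (intro conjI impI pmf_nonneg; simp)
qed

lemma measurable_pmf_farthest_label:
  assumes i: "i \<in> {1..3}" and D: "\<And>j. j \<in> {1..3} \<Longrightarrow> (\<lambda>\<omega>. dst (x \<omega>) (v \<omega> j)) \<in> borel_measurable M"
  shows "(\<lambda>\<omega>. pmf (farthest_label dst (v \<omega>) (x \<omega>)) i) \<in> borel_measurable M"
proof -
  define top where "top \<omega> k \<longleftrightarrow> (\<forall>j\<in>{1..3}. dst (x \<omega>) (v \<omega> j) \<le> dst (x \<omega>) (v \<omega> k))" for \<omega> k
  have top: "Measurable.pred M (\<lambda>\<omega>. top \<omega> k)" if "k \<in> {1..3}" for k
    unfolding top_def using D that by (intro pred_intros_finite borel_measurable_le) auto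
  have A: "{k. is_arg_max (\<lambda>j. dst (x \<omega>) (v \<omega> j)) (\<lambda>i. i \<in> {1..3}) k} = {k \<in> {1..3}. top \<omega> k}" for \<omega>
    by (auto simp: is_arg_max_def top_def not_less)
  have "pmf (farthest_label dst (v \<omega>) (x \<omega>)) i = of_bool (top \<omega> i) / (\<Sum>k\<in>{1..3}. of_bool (top \<omega> k))" for \<omega>
    using pmf_of_set[OF arg_max_set_nonempty finite_arg_max_set, of "\<lambda>j. dst (x \<omega>) (v \<omega> j)"] i
    unfolding farthest_label_def A by (simp add: indicator_def of_bool_def Int_def flip: sum.inter_filter)
  moreover have "(\<lambda>\<omega>. of_bool (top \<omega> i) / (\<Sum>k\<in>{1..3}. of_bool (top \<omega> k)) :: real) \<in> borel_measurable M"
    unfolding of_bool_def using top i by (intro borel_measurable_divide borel_measurable_sum measurable_If) auto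
  ultimately show ?thesis by simp
qed

text \<open>
  If all scores move by at most \<open>\<eta>\<close> and label \<open>i\<close> is not within \<open>2\<eta>\<close> of a competitor, then \<open>i\<close> strictly
  wins or strictly loses under both families of scores, and the two weights agree.
\<close>

lemma (in prob_space) argmax_stability:
  fixes S T :: "nat \<Rightarrow> 'a \<Rightarrow> real"
  assumes [measurable]: "a \<in> borel_measurable M" "b \<in> borel_measurable M"
    and S[measurable]: "\<And>j. j \<in> {1..3} \<Longrightarrow> S j \<in> borel_measurable M"
    and T[measurable]: "\<And>j. j \<in> {1..3} \<Longrightarrow> T j \<in> borel_measurable M"
    and i: "i \<in> {1..3}"
    and a: "\<And>x. x \<in> space M \<Longrightarrow> argmax_weight (\<lambda>j. T j x) i (a x)"
    and b: "\<And>x. x \<in> space M \<Longrightarrow> argmax_weight (\<lambda>j. S j x) i (b x)"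
  shows "\<bar>expectation a - expectation b\<bar> \<le> \<P>(x in M. \<exists>j\<in>{1..3}. \<bar>T j x - S j x\<bar> > \<eta>) +
    (\<Sum>j\<in>{1..3}-{i}. \<P>(x in M. \<bar>S i x - S j x\<bar> \<le> 2 * \<eta>))"
proof -
  define B where "B = {x \<in> space M. \<exists>j\<in>{1..3}. \<bar>T j x - S j x\<bar> > \<eta>}"
  define C where "C j = {x \<in> space M. \<bar>S i x - S j x\<bar> \<le> 2 * \<eta>}" for j
  have [measurable]: "B \<in> events" unfolding B_def by measurable
  have [measurable]: "C j \<in> events" if "j \<in> {1..3}" for j
    unfolding C_def using i that by measurable
  have range: "0 \<le> a x" "a x \<le> 1" "0 \<le> b x" "b x \<le> 1" if "x \<in> space M" for x
    using a[OF that] b[OF that] by (auto simp: argmax_weight_def)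
  have int: "integrable M a" "integrable M b"
    by (intro integrable_const_bound[of _ 1] AE_I2; use range in force)+
  have ptw: "\<bar>a x - b x\<bar> \<le> indicator B x + (\<Sum>j\<in>{1..3}-{i}. indicator (C j) x)" if x: "x \<in> space M" for x
  proof (cases "x \<in> B \<or> (\<exists>j\<in>{1..3}-{i}. x \<in> C j)")
    case True
    have "1 \<le> indicator B x + (\<Sum>j\<in>{1..3}-{i}. indicator (C j) x :: real)"
    proof (cases "x \<in> B")
      case True
      then show ?thesis by (simp add: sum_nonneg)
    next
      case False
      then obtain j where "j \<in> {1..3}-{i}" "x \<in> C j" using True by blast
      then have "1 \<le> (\<Sum>j\<in>{1..3}-{i}. indicator (C j) x :: real)"
        using member_le_sum[of j "{1..3}-{i}" "\<lambda>j. indicator (C j) x :: real"] by auto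
      moreover have "0 \<le> (indicator B x :: real)" by simp
      ultimately show ?thesis by linarith
    qed
    then show ?thesis using range[OF x] by linarith
  next
    case False
    have near: "\<bar>T j x - S j x\<bar> \<le> \<eta>" if "j \<in> {1..3}" for j
      using False x that by (force simp: B_def)
    have apart: "\<bar>S i x - S j x\<bar> > 2 * \<eta>" if "j \<in> {1..3}-{i}" for j
      using False x that by (force simp: C_def)
    have "a x = b x"
    proof (cases "\<exists>j\<in>{1..3}. S i x < S j x")
      case True
      then obtain j where j: "j \<in> {1..3}" "S i x < S j x" by auto
      then have "2 * \<eta> < S j x - S i x" using apart[of j] by force
      then have "T i x < T j x" using near[OF i] near[OF j(1)] by linarith
      then show ?thesis using a[OF x] b[OF x] j by (auto simp: argmax_weight_def)
    next
      case False
      have "S j x < S i x \<and> T j x < T i x" if "j \<in> {1..3}-{i}" for j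
      proof -
        have j: "j \<in> {1..3}" using that by simp
        have "S j x \<le> S i x" using False j by (force simp: not_less)
        then show ?thesis using near[OF i] near[OF j] apart[OF that] by linarith
      qed
      then show ?thesis using a[OF x] b[OF x] by (auto simp: argmax_weight_def)
    qed
    then show ?thesis by (simp add: sum_nonneg)
  qed
  have "\<bar>expectation a - expectation b\<bar> = \<bar>expectation (\<lambda>x. a x - b x)\<bar>"
    using int by simp
  also have "\<dots> \<le> expectation (\<lambda>x. \<bar>a x - b x\<bar>)" by (rule integral_abs_bound)
  also have "\<dots> \<le> expectation (\<lambda>x. indicator B x + (\<Sum>j\<in>{1..3}-{i}. indicator (C j) x))"
    using int ptw by (intro integral_mono) (auto intro!: Bochner_Integration.integrable_add Bochner_Integration.integrable_sum integrable_real_indicator simp: emeasure_eq_measure)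
  also have "\<dots> = prob B + (\<Sum>j\<in>{1..3}-{i}. prob (C j))"
    by (subst Bochner_Integration.integral_add, auto simp: emeasure_eq_measure intro!: Bochner_Integration.integrable_sum integrable_real_indicator)
  finally show ?thesis unfolding B_def C_def .
qed

section \<open>The master probabilities\<close>

abbreviation normal3 :: "(nat \<Rightarrow> real) measure" where
  "normal3 \<equiv> gauss {1..3}"

interpretation normal3: prob_space normal3
  by (rule prob_space_std_normal_PiM)

lemma atLeastAtMost_1_3: "{1..3::nat} = {1, 2, 3}"
  by auto

lemma measurable_of_bool_Max:
  assumes "i \<in> {1..3::nat}" and f: "\<And>j. j \<in> {1..3::nat} \<Longrightarrow> f j \<in> borel_measurable M"
  shows "(\<lambda>x. of_bool (f i x = (MAX j\<in>{1..3}. f j x :: real)) :: real) \<in> borel_measurable M"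
proof -
  have [measurable]: "f 1 \<in> borel_measurable M" "f 2 \<in> borel_measurable M" "f 3 \<in> borel_measurable M"
    "f i \<in> borel_measurable M"
    using assms by auto
  have "(MAX j\<in>{1..3}. f j x) = max (f 1 x) (max (f 2 x) (f 3 x))" for x
    unfolding atLeastAtMost_1_3 by simp
  then show ?thesis by simp
qed

lemma normal3_coordinate_measurable:
  "j \<in> {1..3} \<Longrightarrow> (\<lambda>z. z j) \<in> borel_measurable normal3"
  using measurable_component_singleton[of j "{1..3}" "\<lambda>_. std_normal"] by simp

lemma normal3_affine_measurable:
  "j \<in> {1..3} \<Longrightarrow> (\<lambda>z. c - z j) \<in> borel_measurable normal3"
  by (intro borel_measurable_diff normal3_coordinate_measurable) auto

lemma master_prob_eq_integral:
  assumes i: "i \<in> {1..3}"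
  shows "master_prob l w i = (\<integral>z. of_bool (l * w i - z i = (MAX j\<in>{1..3}. l * w j - z j)) \<partial>normal3)"
proof -
  let ?A = "{z \<in> space normal3. l * w i - z i = (MAX j\<in>{1..3}. l * w j - z j)}"
  have "(\<integral>z. of_bool (l * w i - z i = (MAX j\<in>{1..3}. l * w j - z j)) \<partial>normal3) = (\<integral>z. indicator ?A z \<partial>normal3)"
    by (intro Bochner_Integration.integral_cong) (auto split: split_indicator)
  also have "\<dots> = normal3.prob ?A"
    by (simp add: Int_def conj_commute)
  finally show ?thesis by (simp add: master_prob_def)
qed

lemma normal3_coordinate_tail:
  assumes K: "K > 0"
  shows "\<P>(z in normal3. \<exists>j\<in>{1..3}. \<bar>z j\<bar> > K) \<le> 3 / K\<^sup>2"
proof -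
  have 1: "\<P>(z in normal3. \<bar>z j\<bar> > K) \<le> 1 / K\<^sup>2" if "j \<in> {1..3}" for j
  proof -
    have "(\<Sum>i\<in>{1..3}. z i * of_bool (i = j)) = z j" for z :: "nat \<Rightarrow> real"
      using that by (simp add: sum.delta)
    moreover have "(\<Sum>i\<in>{1..3}. (of_bool (i = j))\<^sup>2) = (1::real)"
      using that by (simp add: power2_eq_square flip: of_bool_conj)
    ultimately show ?thesis
      using std_normal_tail[of "{1..3}" K "\<lambda>i. of_bool (i = j)"] K by simp
  qed
  have "{z \<in> space normal3. \<exists>j\<in>{1..3}. \<bar>z j\<bar> > K} = (\<Union>j\<in>{1..3}. {z \<in> space normal3. \<bar>z j\<bar> > K})"
    by auto
  then have "\<P>(z in normal3. \<exists>j\<in>{1..3}. \<bar>z j\<bar> > K) \<le>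
      (\<Sum>j\<in>{1..3}. \<P>(z in normal3. \<bar>z j\<bar> > K))"
    by (simp only:) (rule normal3.finite_measure_subadditive_finite; auto)
  also have "\<dots> \<le> (\<Sum>j\<in>{1..3::nat}. 1 / K\<^sup>2)" by (intro sum_mono 1)
  finally show ?thesis by simp
qed

lemma normal3_difference_anti_concentration:
  assumes ij: "i \<in> {1..3}" "j \<in> {1..3}" "i \<noteq> j" and t: "t \<ge> 0"
  shows "\<P>(z in normal3. \<bar>(x - z i) - (y - z j)\<bar> \<le> t) \<le> t"
proof -
  let ?u = "\<lambda>k. of_bool (k = i) - of_bool (k = j) :: real"
  have form: "(\<Sum>k\<in>{1..3}. z k * ?u k) = z i - z j" for z :: "nat \<Rightarrow> real"
    using ij by (simp add: right_diff_distrib sum_subtractf)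
  have "(?u k)\<^sup>2 = of_bool (k = i) + of_bool (k = j)" for k using ij by auto
  then have norm: "(\<Sum>k\<in>{1..3}. (?u k)\<^sup>2) = 2"
    using ij by (simp add: sum.distrib)
  have "\<P>(z in normal3. \<bar>(x - y) - (\<Sum>k\<in>{1..3}. z k * ?u k)\<bar> \<le> t) \<le> t"
    using t norm by (intro std_normal_anti_concentration) auto
  then show ?thesis unfolding form by (simp add: algebra_simps)
qed

text \<open>
  A union bound over the two competitors of label \<open>i\<close>; the scores have independent unit normal noise, so
  each difference has variance 2.
\<close>

lemma normal3_near_ties:
  assumes i: "i \<in> {1..3}" and t: "t \<ge> 0"
  shows "(\<Sum>j\<in>{1..3}-{i}. \<P>(z in normal3. \<bar>(c i - z i) - (c j - z j)\<bar> \<le> t)) \<le> 2 * t"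
proof -
  have "(\<Sum>j\<in>{1..3}-{i}. \<P>(z in normal3. \<bar>(c i - z i) - (c j - z j)\<bar> \<le> t)) \<le>
      (\<Sum>j\<in>{1..3}-{i}. t)"
    using i t by (intro sum_mono normal3_difference_anti_concentration) auto
  also have "\<dots> = 2 * t" using i by (simp add: card_Diff_singleton)
  finally show ?thesis .
qed

text \<open>
  The noise is the same on both sides, so the scores differ by at most \<open>\<eta>\<close> everywhere and only near
  ties contribute.
\<close>

lemma master_prob_lipschitz:
  assumes i: "i \<in> {1..3}" and \<eta>: "\<And>j. j \<in> {1..3} \<Longrightarrow> \<bar>l * w j - l' * w' j\<bar> \<le> \<eta>"
  shows "\<bar>master_prob l w i - master_prob l' w' i\<bar> \<le> 4 * \<eta>"
proof -
  have \<eta>0: "\<eta> \<ge> 0" using \<eta>[OF i] by linarith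
  have "\<bar>master_prob l w i - master_prob l' w' i\<bar> \<le>
      \<P>(z in normal3. \<exists>j\<in>{1..3}. \<bar>(l * w j - z j) - (l' * w' j - z j)\<bar> > \<eta>) +
      (\<Sum>j\<in>{1..3}-{i}. \<P>(z in normal3. \<bar>(l' * w' i - z i) - (l' * w' j - z j)\<bar> \<le> 2 * \<eta>))"
    unfolding master_prob_eq_integral[OF i]
  proof (rule normal3.argmax_stability[OF _ _ _ _ i])
    show "argmax_weight (\<lambda>j. l * w j - z j) i (of_bool (l * w i - z i = (MAX j\<in>{1..3}. l * w j - z j)))" for z
      by (rule argmax_weight_Max[OF i])
    show "argmax_weight (\<lambda>j. l' * w' j - z j) i (of_bool (l' * w' i - z i = (MAX j\<in>{1..3}. l' * w' j - z j)))" for z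
      by (rule argmax_weight_Max[OF i])
  qed (intro measurable_of_bool_Max[OF i] normal3_affine_measurable; assumption)+
  also have "{z \<in> space normal3. \<exists>j\<in>{1..3}. \<bar>(l * w j - z j) - (l' * w' j - z j)\<bar> > \<eta>} = {}"
    using \<eta> by (auto simp: not_less)
  also have "(\<Sum>j\<in>{1..3}-{i}. \<P>(z in normal3. \<bar>(l' * w' i - z i) - (l' * w' j - z j)\<bar> \<le> 2 * \<eta>))
      \<le> 2 * (2 * \<eta>)"
    using normal3_near_ties[OF i, of "2 * \<eta>" "\<lambda>j. l' * w' j"] \<eta>0 by simp
  finally show ?thesis by simp
qed

lemma master_prob_bounds: "0 \<le> master_prob l w i" "master_prob l w i \<le> 1"
  unfolding master_prob_def by (rule measure_nonneg normal3.prob_le_1)+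

lemma tendsto_master_prob:
  assumes i: "i \<in> {1..3}" and conv: "\<And>j. j \<in> {1..3} \<Longrightarrow> (\<lambda>n. l n * w n j) \<longlonglongrightarrow> l0 * w0 j"
  shows "(\<lambda>n. master_prob (l n) (w n) i) \<longlonglongrightarrow> master_prob l0 w0 i"
proof (rule LIM_zero_cancel, rule Lim_null_comparison)
  show "\<forall>\<^sub>F n in sequentially. norm (master_prob (l n) (w n) i - master_prob l0 w0 i) \<le>
      4 * (\<Sum>j\<in>{1..3}. \<bar>l n * w n j - l0 * w0 j\<bar>)"
    unfolding real_norm_def
    by (intro always_eventually allI master_prob_lipschitz[OF i] member_le_sum) auto
  have "(\<lambda>n. 4 * (\<Sum>j\<in>{1..3}. \<bar>l n * w n j - l0 * w0 j\<bar>)) \<longlonglongrightarrow> 4 * (\<Sum>j\<in>{1..3::nat}. 0)"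
    by (intro tendsto_intros tendsto_rabs_zero LIM_zero conv) auto
  then show "(\<lambda>n. 4 * (\<Sum>j\<in>{1..3}. \<bar>l n * w n j - l0 * w0 j\<bar>)) \<longlonglongrightarrow> 0" by simp
qed

lemma measurable_master_prob:
  assumes i: "i \<in> {1..3}" and F: "sets F = sets borel"
  shows "(\<lambda>w. master_prob l w i) \<in> borel_measurable (PiM {1..3} (\<lambda>_. F))"
proof -
  note [measurable_cong] = F
  show ?thesis
    unfolding master_prob_eq_integral[OF i]
  proof (rule normal3.borel_measurable_lebesgue_integral)
    have "(\<lambda>x. of_bool (l * fst x i - snd x i = (MAX j\<in>{1..3}. l * fst x j - snd x j)) :: real)
      \<in> borel_measurable (PiM {1..3} (\<lambda>_. F) \<Otimes>\<^sub>M normal3)"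
      by (intro measurable_of_bool_Max[OF i]) measurable
    then show "(\<lambda>(w, z). of_bool (l * w i - z i = (MAX j\<in>{1..3}. l * w j - z j)) :: real)
      \<in> borel_measurable (PiM {1..3} (\<lambda>_. F) \<Otimes>\<^sub>M normal3)"
      by (simp add: case_prod_beta)
  qed
qed

text \<open>
  The scores are compared with their deterministic parts \<open>l w\<^sub>j\<close>. These are eventually farther apart than
  any constant \<open>2K\<close>, while the noise exceeds \<open>K\<close> with probability at most \<open>3 / K\<^sup>2\<close>.
\<close>

lemma tendsto_master_prob_at_top:
  assumes i: "i \<in> {1..3}" and l: "filterlim l at_top sequentially"
    and w: "\<And>j. j \<in> {1..3} \<Longrightarrow> (\<lambda>n. w n j) \<longlonglongrightarrow> w0 j"
    and distinct: "\<And>j. j \<in> {1..3} \<Longrightarrow> j \<noteq> i \<Longrightarrow> w0 i \<noteq> w0 j"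
  shows "(\<lambda>n. master_prob (l n) (w n) i) \<longlonglongrightarrow> of_bool (\<forall>j\<in>{1..3}. w0 j \<le> w0 i)"
proof (rule tendstoI)
  fix e :: real assume e: "e > 0"
  \<comment> \<open>Then \<open>3 / K\<^sup>2 = 3e/4\<close>.\<close>
  define K where "K = 2 / sqrt e"
  have K: "K > 0" "3 / K\<^sup>2 < e" using e by (auto simp: K_def power_divide)
  have gap: "\<forall>\<^sub>F n in sequentially. l n * \<bar>w n i - w n j\<bar> > 2 * K" if j: "j \<in> {1..3}" "j \<noteq> i" for j
  proof -
    have "(\<lambda>n. \<bar>w n i - w n j\<bar>) \<longlonglongrightarrow> \<bar>w0 i - w0 j\<bar>" by (intro tendsto_intros w i j)
    moreover have "\<bar>w0 i - w0 j\<bar> > 0" using distinct[OF j] by simp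
    ultimately have "filterlim (\<lambda>n. \<bar>w n i - w n j\<bar> * l n) at_top sequentially"
      using l by (rule filterlim_tendsto_pos_mult_at_top)
    then show ?thesis by (simp add: filterlim_at_top_dense mult.commute)
  qed
  have sgn: "\<forall>\<^sub>F n in sequentially. w n i < w n j \<longleftrightarrow> w0 i < w0 j" if j: "j \<in> {1..3}" "j \<noteq> i" for j
  proof (cases "w0 i < w0 j")
    case True
    have "\<forall>\<^sub>F n in sequentially. w n j - w n i > 0"
      using True by (intro order_tendstoD(1)[OF tendsto_diff[OF w[OF j(1)] w[OF i]]]) simp
    then show ?thesis by eventually_elim (use True in auto)
  next
    case False
    then have "w0 j < w0 i" using distinct[OF j] by simp
    then have "\<forall>\<^sub>F n in sequentially. w n i - w n j > 0"
      by (intro order_tendstoD(1)[OF tendsto_diff[OF w[OF i] w[OF j(1)]]]) simp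
    then show ?thesis by eventually_elim (use False in auto)
  qed
  have "\<forall>\<^sub>F n in sequentially. l n > 0 \<and> (\<forall>j\<in>{1..3}-{i}. l n * \<bar>w n i - w n j\<bar> > 2 * K \<and>
      (w n i < w n j \<longleftrightarrow> w0 i < w0 j))"
    using l gap sgn by (intro eventually_conj eventually_ball_finite ballI) (simp_all add: filterlim_at_top_dense)
  then show "\<forall>\<^sub>F n in sequentially. dist (master_prob (l n) (w n) i) (of_bool (\<forall>j\<in>{1..3}. w0 j \<le> w0 i)) < e"
  proof eventually_elim
    case (elim n)
    define T where "T = (\<lambda>j z. l n * w n j - z j :: real)"
    define S where "S = (\<lambda>j (z :: nat \<Rightarrow> real). l n * w n j)"
    have "argmax_weight (\<lambda>j. w n j) i (of_bool (\<forall>j\<in>{1..3}. w0 j \<le> w0 i))"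
      unfolding argmax_weight_def
    proof (intro conjI impI)
      assume *: "\<forall>j\<in>{1..3}-{i}. w n j < w n i"
      have "w0 j \<le> w0 i" if "j \<in> {1..3}" for j
      proof (cases "j = i")
        case False
        then have "w n j < w n i" "w n i < w n j \<longleftrightarrow> w0 i < w0 j" using * elim that by auto
        then show ?thesis by linarith
      qed simp
      then show "of_bool (\<forall>j\<in>{1..3}. w0 j \<le> w0 i) = (1::real)" by auto
    next
      assume "\<exists>j\<in>{1..3}. w n i < w n j"
      then obtain j where j: "j \<in> {1..3}" "w n i < w n j" by auto
      then have "w0 i < w0 j" using elim by (cases "j = i") auto
      then show "of_bool (\<forall>j\<in>{1..3}. w0 j \<le> w0 i) = (0::real)" using j by (auto simp: not_le)
    qed auto
    then have S: "argmax_weight (\<lambda>j. S j z) i (of_bool (\<forall>j\<in>{1..3}. w0 j \<le> w0 i))" for z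
      by (rule argmax_weight_transform[OF _ i]) (use elim in \<open>auto simp: S_def\<close>)
    have "\<bar>master_prob (l n) (w n) i - (\<integral>z. of_bool (\<forall>j\<in>{1..3}. w0 j \<le> w0 i) \<partial>normal3)\<bar> \<le>
        \<P>(z in normal3. \<exists>j\<in>{1..3}. \<bar>T j z - S j z\<bar> > K) +
        (\<Sum>j\<in>{1..3}-{i}. \<P>(z in normal3. \<bar>S i z - S j z\<bar> \<le> 2 * K))"
      unfolding master_prob_eq_integral[OF i]
    proof (rule normal3.argmax_stability[OF _ _ _ _ i _ S])
      show "argmax_weight (\<lambda>j. T j z) i (of_bool (l n * w n i - z i = (MAX j\<in>{1..3}. l n * w n j - z j)))" for z
        unfolding T_def by (rule argmax_weight_Max[OF i])
    qed (auto simp: T_def S_def intro: measurable_of_bool_Max[OF i] normal3_affine_measurable)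
    also have "(\<Sum>j\<in>{1..3}-{i}. \<P>(z in normal3. \<bar>S i z - S j z\<bar> \<le> 2 * K)) = 0"
    proof (rule sum.neutral, rule ballI)
      fix j assume j: "j \<in> {1..3}-{i}"
      have "\<bar>l n * w n i - l n * w n j\<bar> = l n * \<bar>w n i - w n j\<bar>"
        using elim by (simp add: abs_mult flip: right_diff_distrib)
      then have "2 * K < \<bar>l n * w n i - l n * w n j\<bar>" using elim j by simp
      then show "\<P>(z in normal3. \<bar>S i z - S j z\<bar> \<le> 2 * K) = 0"
        by (simp add: S_def not_le)
    qed
    also have "\<P>(z in normal3. \<exists>j\<in>{1..3}. \<bar>T j z - S j z\<bar> > K) \<le> 3 / K\<^sup>2"
      using normal3_coordinate_tail[OF K(1)] by (simp add: T_def S_def)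
    finally show ?case using K(2) by (simp add: dist_real_def normal3.prob_space)
  qed
qed

text \<open>
  The noise coordinates are exchangeable, so the three probabilities are equal. They add up to 1: ties
  have probability 0, so the probabilities do not change if ties are broken at random, and
  then exactly one label is chosen.
\<close>

lemma master_prob_zero:
  assumes i: "i \<in> {1..3}"
  shows "master_prob 0 w i = 1 / 3"
proof -
  have swap: "master_prob 0 w i = master_prob 0 w j" if ij: "i \<in> {1..3}" "j \<in> {1..3}" for i j
  proof -
    define t where "t = Transposition.transpose i j"
    have t: "t ` {1..3} = {1..3}" "t i = j" "inj_on t {1..3}"
      using ij by (auto simp: t_def transpose_image_eq)
    have dist: "distr normal3 normal3 (\<lambda>z. \<lambda>k\<in>{1..3}. z (t k)) = normal3"
      using distr_PiM_reindex[of "{1..3}" "\<lambda>_. std_normal" t "{1..3}"] t(1,3) prob_space_std_normal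
      by (auto simp: image_subset_iff_funcset)
    have mx: "(MAX k\<in>{1..3}. - (\<lambda>k\<in>{1..3}. z (t k)) k) = (MAX k\<in>{1..3}. - z k)" for z :: "nat \<Rightarrow> real"
    proof -
      have "(\<lambda>k. - (\<lambda>k\<in>{1..3}. z (t k)) k) ` {1..3} = (\<lambda>k. - z k) ` t ` {1..3}"
        unfolding image_image by (intro image_cong) auto
      then show ?thesis by (simp only: t(1))
    qed
    have "master_prob 0 w i =
        (\<integral>z. of_bool (- z i = (MAX k\<in>{1..3}. - z k)) \<partial>distr normal3 normal3 (\<lambda>z. \<lambda>k\<in>{1..3}. z (t k)))"
      unfolding dist master_prob_eq_integral[OF ij(1)] by simp
    also have "\<dots> = (\<integral>z. of_bool (- (\<lambda>k\<in>{1..3}. z (t k)) i = (MAX k\<in>{1..3}. - (\<lambda>k\<in>{1..3}. z (t k)) k)) \<partial>normal3)"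
    proof (rule integral_distr)
      have "(\<lambda>z. z (t k)) \<in> measurable normal3 std_normal" if "k \<in> {1..3}" for k
        using that t(1) by (intro measurable_component_singleton) blast
      then show "(\<lambda>z. \<lambda>k\<in>{1..3}. z (t k)) \<in> measurable normal3 normal3"
        by (intro measurable_restrict)
      show "(\<lambda>z. of_bool (- z i = (MAX k\<in>{1..3}. - z k)) :: real) \<in> borel_measurable normal3"
        using normal3_affine_measurable[of _ 0] by (intro measurable_of_bool_Max[OF ij(1)]) simp
    qed
    also have "\<dots> = master_prob 0 w j"
      unfolding mx master_prob_eq_integral[OF ij(2)] using ij t(2) by simp
    finally show ?thesis .
  qed
  define p where "p i z = pmf (farthest_label (\<lambda>_ x. x) (\<lambda>j. - z j) (0::real)) i" for i and z :: "nat \<Rightarrow> real"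
  have p: "argmax_weight (\<lambda>j. 0 * w j - z j) i (p i z)" if "i \<in> {1..3}" for i z
    using argmax_weight_farthest_label[OF that, of "\<lambda>_ x. x" 0 "\<lambda>j. - z j"] by (simp add: p_def)
  have pm: "p i \<in> borel_measurable normal3" if "i \<in> {1..3}" for i
    unfolding p_def
    using normal3_affine_measurable[of _ 0] that by (intro measurable_pmf_farthest_label) auto
  have "master_prob 0 w i = (\<integral>z. p i z \<partial>normal3)" if i: "i \<in> {1..3}" for i
  proof -
    have "\<bar>master_prob 0 w i - (\<integral>z. p i z \<partial>normal3)\<bar> \<le>
      \<P>(z in normal3. \<exists>j\<in>{1..3}. \<bar>(0 * w j - z j) - (0 * w j - z j)\<bar> > 0) +
      (\<Sum>j\<in>{1..3}-{i}. \<P>(z in normal3. \<bar>(0 * w i - z i) - (0 * w j - z j)\<bar> \<le> 2 * 0))"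
      unfolding master_prob_eq_integral[OF i]
    proof (rule normal3.argmax_stability[OF _ _ _ _ i _ p[OF i]])
      show "argmax_weight (\<lambda>j. 0 * w j - z j) i (of_bool (0 * w i - z i = (MAX j\<in>{1..3}. 0 * w j - z j)))" for z
        by (rule argmax_weight_Max[OF i])
    qed (use i in \<open>auto intro!: measurable_of_bool_Max[OF i] normal3_affine_measurable pm\<close>)
    then show ?thesis
      using normal3_near_ties[OF i, of 0 "\<lambda>j. 0 * w j"] by simp
  qed
  then have "(\<Sum>i\<in>{1..3}. master_prob 0 w i) = (\<Sum>i\<in>{1..3}. \<integral>z. p i z \<partial>normal3)"
    by (intro sum.cong) auto
  also have "\<dots> = (\<integral>z. (\<Sum>i\<in>{1..3}. p i z) \<partial>normal3)"
    by (intro Bochner_Integration.integral_sum[symmetric] normal3.integrable_const_bound[of _ 1] AE_I2 pm)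
      (simp_all add: p_def pmf_le_1)
  also have "\<dots> = (\<integral>z. 1 \<partial>normal3)"
    unfolding p_def by (intro Bochner_Integration.integral_cong refl sum_pmf_eq_1 set_pmf_farthest_label) simp
  finally have "(\<Sum>i\<in>{1..3}. master_prob 0 w i) = 1"
    by (simp add: normal3.prob_space)
  moreover have "(\<Sum>j\<in>{1..3}. master_prob 0 w j) = (\<Sum>j\<in>{1..3::nat}. master_prob 0 w i)"
    by (intro sum.cong refl swap i)
  ultimately show ?thesis by simp
qed

section \<open>Labels of a Gaussian query\<close>

text \<open>
  The Cholesky factor of the standard basis is the identity matrix.
\<close>

lemma normal3_iterated:
  assumes f: "triple_measurable f"
  shows "(\<integral>\<^sup>+z. f (z 1) (z 2) (z 3) \<partial>normal3) =
    (\<E> x. \<E> y. \<E> z. f x y z)"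
proof -
  let ?e = "\<lambda>k j::nat. of_bool (j = k) :: real"
  obtain l11 l21 l22 l31 l32 l33 where ch: "cholesky3 {1..3} (?e 1) (?e 2) (?e 3) l11 l21 l22 l31 l32 l33"
    and law: "linear_forms_law {1..3} (?e 1) (?e 2) (?e 3) l11 l21 l22 l31 l32 l33"
    by (rule std_normal_three_linear_forms[of "{1..3::nat}" "?e 1" "?e 2" "?e 3"]) auto
  note nn = cholesky3D(1-3)[OF ch] and gram = cholesky3D(4-9)[OF ch]
  have "l11 = 1" using nn(1) gram(1) by (simp add: atLeastAtMost_1_3 power2_eq_1_iff)
  moreover have "l21 = 0" "l31 = 0" using \<open>l11 = 1\<close> gram(2,3) by (simp_all add: atLeastAtMost_1_3)
  moreover have "l22 = 1" using \<open>l21 = 0\<close> nn(2) gram(4) by (simp add: atLeastAtMost_1_3 power2_eq_1_iff)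
  moreover have "l32 = 0" using \<open>l21 = 0\<close> \<open>l22 = 1\<close> gram(5) by (simp add: atLeastAtMost_1_3)
  moreover have "l33 = 1" using \<open>l31 = 0\<close> \<open>l32 = 0\<close> nn(3) gram(6) by (simp add: atLeastAtMost_1_3 power2_eq_1_iff)
  ultimately show ?thesis
    using law[rule_format, OF f] by (simp add: atLeastAtMost_1_3)
qed

lemma cholesky_near_identity:
  fixes l11 l21 l22 l31 l32 l33 \<delta> :: real
  assumes nn: "l11 \<ge> 0" "l22 \<ge> 0" "l33 \<ge> 0"
    and unit: "l11\<^sup>2 = 1" "l21\<^sup>2 + l22\<^sup>2 = 1" "l31\<^sup>2 + l32\<^sup>2 + l33\<^sup>2 = 1"
    and off: "\<bar>l11 * l21\<bar> \<le> \<delta>" "\<bar>l11 * l31\<bar> \<le> \<delta>" "\<bar>l21 * l31 + l22 * l32\<bar> \<le> \<delta>"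
    and \<delta>: "\<delta> \<le> 1/4"
  shows "l11 = 1" "\<bar>l21\<bar> \<le> \<delta>" "\<bar>l22 - 1\<bar> \<le> \<delta>" "\<bar>l31\<bar> \<le> \<delta>" "\<bar>l32\<bar> \<le> 2 * \<delta>" "\<bar>l33 - 1\<bar> \<le> 2 * \<delta>"
proof -
  have near1: "\<bar>l - 1\<bar> \<le> \<bar>l\<^sup>2 - 1\<bar>" if "l \<ge> 0" for l :: real
  proof -
    have "\<bar>l - 1\<bar> * 1 \<le> \<bar>l - 1\<bar> * (l + 1)" using that by (intro mult_left_mono) auto
    also have "\<dots> = \<bar>(l - 1) * (l + 1)\<bar>" using that by (simp add: abs_mult)
    also have "(l - 1) * (l + 1) = l\<^sup>2 - 1" by (simp add: power2_eq_square algebra_simps)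
    finally show ?thesis by simp
  qed
  show 1: "l11 = 1" using nn(1) unit(1) by (simp add: power2_eq_1_iff)
  show 21: "\<bar>l21\<bar> \<le> \<delta>" and 31: "\<bar>l31\<bar> \<le> \<delta>" using off 1 by simp_all
  have \<delta>0: "\<delta> \<ge> 0" using 21 by linarith
  have sq: "t\<^sup>2 \<le> \<delta> / 4" if "\<bar>t\<bar> \<le> \<delta>" for t
  proof -
    have "t\<^sup>2 = \<bar>t\<bar> * \<bar>t\<bar>" by (simp add: power2_eq_square)
    also have "\<dots> \<le> \<delta> * (1/4)" using that \<delta> \<delta>0 by (intro mult_mono) auto
    finally show ?thesis by simp
  qed
  have "\<bar>l22 - 1\<bar> \<le> \<bar>l22\<^sup>2 - 1\<bar>" by (rule near1[OF nn(2)])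
  also have "\<dots> = l21\<^sup>2" using unit(2) zero_le_power2[of l21] by linarith
  finally have 22: "\<bar>l22 - 1\<bar> \<le> \<delta> / 4" using sq[OF 21] by linarith
  then show "\<bar>l22 - 1\<bar> \<le> \<delta>" using \<delta>0 by linarith
  have l22: "l22 \<ge> 3/4" using 22 \<delta> by linarith
  have "\<bar>l21 * l31\<bar> \<le> \<delta> * (1/4)" unfolding abs_mult using 21 31 \<delta> \<delta>0 by (intro mult_mono) auto
  then have "\<bar>l22 * l32\<bar> \<le> \<delta> * (5/4)" using off(3) by linarith
  moreover have "3/4 * \<bar>l32\<bar> \<le> \<bar>l22 * l32\<bar>" unfolding abs_mult using l22 by (intro mult_right_mono) auto
  ultimately show 32: "\<bar>l32\<bar> \<le> 2 * \<delta>" using \<delta>0 by linarith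
  have "l32\<^sup>2 = \<bar>l32\<bar> * \<bar>l32\<bar>" by (simp add: power2_eq_square)
  also have "\<dots> \<le> (2 * \<delta>) * (2 * (1/4))" using 32 \<delta> \<delta>0 by (intro mult_mono) auto
  finally have "l32\<^sup>2 \<le> \<delta>" by simp
  have "\<bar>l33 - 1\<bar> \<le> \<bar>l33\<^sup>2 - 1\<bar>" by (rule near1[OF nn(3)])
  also have "\<dots> = l31\<^sup>2 + l32\<^sup>2" using unit(3) zero_le_power2[of l31] zero_le_power2[of l32] by linarith
  also have "\<dots> \<le> \<delta> / 4 + \<delta>" using sq[OF 31] \<open>l32\<^sup>2 \<le> \<delta>\<close> by linarith
  finally show "\<bar>l33 - 1\<bar> \<le> 2 * \<delta>" using \<delta>0 by linarith
qed

text \<open>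
  The scores depend on \<open>g\<close> only through \<open>Lz\<close>, and the entries of \<open>L\<close> are within \<open>2 s\<^sup>2\<close> of those of the identity.
  Outside an event of probability at most \<open>3 s\<^sup>2\<close> the coordinates of \<open>z\<close> are at most \<open>1/s\<close>, and then \<open>Lz\<close> and \<open>z\<close> differ by at most \<open>5s\<close>.
\<close>

lemma gaussian_label_near_master:
  fixes u :: "nat \<Rightarrow> 'i \<Rightarrow> real" and s :: real
  assumes I: "finite I" and i: "i \<in> {1..3}" and s: "0 < s" "s \<le> 1/2"
    and unit: "\<And>j. j \<in> {1..3} \<Longrightarrow> (\<Sum>k\<in>I. (u j k)\<^sup>2) = 1"
    and orth: "\<And>j j'. j \<in> {1..3} \<Longrightarrow> j' \<in> {1..3} \<Longrightarrow> j \<noteq> j' \<Longrightarrow> \<bar>\<Sum>k\<in>I. u j k * u j' k\<bar> \<le> s\<^sup>2"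
  shows "\<bar>(\<integral>g. of_bool (l * w i - (\<Sum>k\<in>I. g k * u i k) =
      (MAX j\<in>{1..3}. l * w j - (\<Sum>k\<in>I. g k * u j k))) \<partial>gauss I) - master_prob l w i\<bar> \<le> 23 * s"
proof -
  let ?G = "gauss I"
  obtain l11 l21 l22 l31 l32 l33 where ch: "cholesky3 I (u 1) (u 2) (u 3) l11 l21 l22 l31 l32 l33"
    and law: "linear_forms_law I (u 1) (u 2) (u 3) l11 l21 l22 l31 l32 l33"
    by (rule std_normal_three_linear_forms[OF I])
  note nn = cholesky3D(1-3)[OF ch] and gram = cholesky3D(4-9)[OF ch]
  have \<delta>: "s\<^sup>2 \<le> 1/4" using s power_mono[of s "1/2" 2] by (simp add: power2_eq_square)
  have uL: "l11\<^sup>2 = 1" "l21\<^sup>2 + l22\<^sup>2 = 1" "l31\<^sup>2 + l32\<^sup>2 + l33\<^sup>2 = 1"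
    by (simp_all add: gram unit)
  have oL: "\<bar>l11 * l21\<bar> \<le> s\<^sup>2" "\<bar>l11 * l31\<bar> \<le> s\<^sup>2" "\<bar>l21 * l31 + l22 * l32\<bar> \<le> s\<^sup>2"
    by (simp_all add: gram orth)
  note L = cholesky_near_identity[OF nn uL oL \<delta>]
  define Lz where "Lz j z = (if j = 1 then l11 * z 1 else if j = 2 then l21 * z 1 + l22 * z 2
    else l31 * z 1 + l32 * z 2 + l33 * z 3)" for j :: nat and z :: "nat \<Rightarrow> real"
  define lab where "lab x y z = (of_bool (let t = (\<lambda>j::nat. l * w j - (if j = 1 then x else if j = 2 then y else z))
      in t i = (MAX j\<in>{1..3}. t j)) :: real)" for x y z
  have lab_meas: "(\<lambda>(x, y, z). lab x y z) \<in> borel_measurable (borel \<Otimes>\<^sub>M borel \<Otimes>\<^sub>M borel)"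
    unfolding lab_def Let_def case_prod_beta by (intro measurable_of_bool_Max[OF i]) auto
  have lab_eq: "(of_bool (l * w i - q i = (MAX j\<in>{1..3}. l * w j - q j)) :: real) = lab (q 1) (q 2) (q 3)" for q
  proof -
    have "(MAX j\<in>{1..3}. l * w j - q j) = (MAX j\<in>{1..3}. l * w j - (if j = 1 then q 1 else if j = 2 then q 2 else q 3))"
      by (intro arg_cong[where f = Max] image_cong) (auto simp: atLeastAtMost_1_3)
    then show ?thesis using i by (auto simp: lab_def Let_def atLeastAtMost_1_3)
  qed
  have eqG: "(of_bool (l * w i - (\<Sum>k\<in>I. g k * u i k) = (MAX j\<in>{1..3}. l * w j - (\<Sum>k\<in>I. g k * u j k))) :: real) =
      lab (\<Sum>k\<in>I. g k * u 1 k) (\<Sum>k\<in>I. g k * u 2 k) (\<Sum>k\<in>I. g k * u 3 k)" for g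
    by (rule lab_eq)
  have eqZ: "(of_bool (l * w i - Lz i z = (MAX j\<in>{1..3}. l * w j - Lz j z)) :: real) =
      lab (Lz 1 z) (Lz 2 z) (Lz 3 z)" for z
    by (rule lab_eq)
  have lab_nn: "lab x y z \<ge> 0" for x y z by (simp add: lab_def)
  have Lz_meas: "Lz j \<in> borel_measurable normal3" if "j \<in> {1..3}" for j
    unfolding Lz_def by (auto intro!: borel_measurable_add borel_measurable_times normal3_coordinate_measurable)
  have lab_G: "(\<lambda>g. lab (\<Sum>k\<in>I. g k * u 1 k) (\<Sum>k\<in>I. g k * u 2 k) (\<Sum>k\<in>I. g k * u 3 k)) \<in> borel_measurable ?G"
    by (intro measurable_triple_app[OF lab_meas]) measurable
  have lab_3: "(\<lambda>z. lab (Lz 1 z) (Lz 2 z) (Lz 3 z)) \<in> borel_measurable normal3"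
    by (intro measurable_triple_app[OF lab_meas] Lz_meas) auto
  have f_meas: "(\<lambda>(x, y, z). ennreal (lab x y z)) \<in> borel_measurable (borel \<Otimes>\<^sub>M borel \<Otimes>\<^sub>M borel)"
    using measurable_compose[OF lab_meas measurable_ennreal] by (simp add: case_prod_beta)
  have "(\<integral>\<^sup>+g. ennreal (lab (\<Sum>k\<in>I. g k * u 1 k) (\<Sum>k\<in>I. g k * u 2 k) (\<Sum>k\<in>I. g k * u 3 k)) \<partial>?G) =
      (\<E> x. \<E> y. \<E> z. ennreal (lab (l11 * x) (l21 * x + l22 * y) (l31 * x + l32 * y + l33 * z)))"
    using f_meas by (rule law[rule_format])
  also have "\<dots> = (\<integral>\<^sup>+z. ennreal (lab (l11 * z 1) (l21 * z 1 + l22 * z 2) (l31 * z 1 + l32 * z 2 + l33 * z 3)) \<partial>normal3)"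
    unfolding case_prod_beta
    by (rule normal3_iterated[symmetric], unfold case_prod_beta)
      (intro measurable_triple_app[OF f_meas]; measurable)
  finally have "(\<integral>g. lab (\<Sum>k\<in>I. g k * u 1 k) (\<Sum>k\<in>I. g k * u 2 k) (\<Sum>k\<in>I. g k * u 3 k) \<partial>?G) =
      (\<integral>z. lab (Lz 1 z) (Lz 2 z) (Lz 3 z) \<partial>normal3)"
    using lab_G lab_3 lab_nn by (simp add: integral_eq_nn_integral Lz_def)
  then have "\<bar>(\<integral>g. of_bool (l * w i - (\<Sum>k\<in>I. g k * u i k) =
      (MAX j\<in>{1..3}. l * w j - (\<Sum>k\<in>I. g k * u j k))) \<partial>?G) - master_prob l w i\<bar> =
      \<bar>(\<integral>z. of_bool (l * w i - Lz i z = (MAX j\<in>{1..3}. l * w j - Lz j z)) \<partial>normal3) - master_prob l w i\<bar>"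
    by (simp only: eqG eqZ)
  also have "\<dots> \<le>
      \<P>(z in normal3. \<exists>j\<in>{1..3}. \<bar>(l * w j - Lz j z) - (l * w j - z j)\<bar> > 5 * s) +
      (\<Sum>j\<in>{1..3}-{i}. \<P>(z in normal3. \<bar>(l * w i - z i) - (l * w j - z j)\<bar> \<le> 2 * (5 * s)))"
    unfolding master_prob_eq_integral[OF i]
    by (rule normal3.argmax_stability[OF _ _ _ _ i])
      (intro measurable_of_bool_Max[OF i] normal3_affine_measurable argmax_weight_Max[OF i]
        borel_measurable_diff borel_measurable_const Lz_meas; assumption)+
  also have "(\<Sum>j\<in>{1..3}-{i}. \<P>(z in normal3. \<bar>(l * w i - z i) - (l * w j - z j)\<bar> \<le> 2 * (5 * s)))
      \<le> 2 * (2 * (5 * s))"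
    using normal3_near_ties[OF i, of "2 * (5 * s)" "\<lambda>j. l * w j"] s by simp
  also have "\<P>(z in normal3. \<exists>j\<in>{1..3}. \<bar>(l * w j - Lz j z) - (l * w j - z j)\<bar> > 5 * s) \<le>
      \<P>(z in normal3. \<exists>j\<in>{1..3}. \<bar>z j\<bar> > 1 / s)"
  proof (intro normal3.finite_measure_mono subsetI)
    fix z assume z: "z \<in> {z \<in> space normal3. \<exists>j\<in>{1..3}. \<bar>(l * w j - Lz j z) - (l * w j - z j)\<bar> > 5 * s}"
    show "z \<in> {z \<in> space normal3. \<exists>j\<in>{1..3}. \<bar>z j\<bar> > 1 / s}"
    proof (rule ccontr)
      assume "z \<notin> {z \<in> space normal3. \<exists>j\<in>{1..3}. \<bar>z j\<bar> > 1 / s}"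
      then have zs: "\<bar>z j\<bar> \<le> 1 / s" if "j \<in> {1..3}" for j using z that by (auto simp: not_less)
      have m: "\<bar>a * z j\<bar> \<le> c * s" if "\<bar>a\<bar> \<le> c * s\<^sup>2" "j \<in> {1..3}" for a c j
      proof -
        have "\<bar>a * z j\<bar> \<le> (c * s\<^sup>2) * (1 / s)"
          unfolding abs_mult using that zs by (intro mult_mono) auto
        also have "\<dots> = c * s" using s by (simp add: power2_eq_square)
        finally show ?thesis .
      qed
      have "\<bar>Lz j z - z j\<bar> \<le> 5 * s" if "j \<in> {1..3}" for j
      proof -
        have "j = 1 \<or> j = 2 \<or> j = 3" using that by (auto simp: atLeastAtMost_1_3)
        moreover have "\<bar>Lz 1 z - z 1\<bar> \<le> 5 * s" using L(1) s by (simp add: Lz_def)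
        moreover have "Lz 2 z - z 2 = l21 * z 1 + (l22 - 1) * z 2" by (simp add: Lz_def algebra_simps)
        then have "\<bar>Lz 2 z - z 2\<bar> \<le> 5 * s" using m[of l21 1 1] m[of "l22 - 1" 1 2] L s by simp
        moreover have "Lz 3 z - z 3 = l31 * z 1 + l32 * z 2 + (l33 - 1) * z 3" by (simp add: Lz_def algebra_simps)
        then have "\<bar>Lz 3 z - z 3\<bar> \<le> 5 * s" using m[of l31 1 1] m[of l32 2 2] m[of "l33 - 1" 2 3] L s by simp
        ultimately show ?thesis by auto
      qed
      then show False using z by (auto simp: abs_minus_commute not_le[symmetric])
    qed
  qed (auto simp: normal3_coordinate_measurable)
  also have "\<dots> \<le> 3 / (1 / s)\<^sup>2" by (rule normal3_coordinate_tail) (use s in simp)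
  also have "\<dots> = 3 * s\<^sup>2" by (simp add: power_divide)
  also have "3 * s\<^sup>2 \<le> 3 * s" using s by (simp add: power2_eq_square)
  finally show ?thesis by simp
qed


text \<open>
  Here \<open>b\<close> stands for the factor \<open>(R/\<rho>) \<surd>d / \<parallel>G\<parallel>\<close> of the query, which depends on \<open>g\<close>. Since
  nothing is known about their joint law, \<open>b\<close> is replaced by 1 pathwise, at the price of the
  probability that it is far from 1; only then is the law of \<open>g\<close> used.
\<close>

lemma (in prob_space) gaussian_query_label:
  fixes u :: "nat \<Rightarrow> 'i \<Rightarrow> real" and s :: real and g :: "'a \<Rightarrow> 'i \<Rightarrow> real"
  assumes I: "finite I" and i: "i \<in> {1..3}" and s: "0 < s" "s \<le> 1/2"
    and unit: "\<And>j. j \<in> {1..3} \<Longrightarrow> (\<Sum>k\<in>I. (u j k)\<^sup>2) = 1"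
    and orth: "\<And>j j'. j \<in> {1..3} \<Longrightarrow> j' \<in> {1..3} \<Longrightarrow> j \<noteq> j' \<Longrightarrow> \<bar>\<Sum>k\<in>I. u j k * u j' k\<bar> \<le> s\<^sup>2"
    and a: "\<And>j. j \<in> {1..3} \<Longrightarrow> \<bar>a j - 1\<bar> \<le> s\<^sup>2"
    and g[measurable]: "g \<in> measurable M (gauss I)"
    and law: "distr M (gauss I) g = gauss I"
    and b[measurable]: "b \<in> borel_measurable M"
    and p[measurable]: "p \<in> borel_measurable M"
    and label: "\<And>x. x \<in> space M \<Longrightarrow> argmax_weight (\<lambda>j. l * w j - a j * b x * (\<Sum>k\<in>I. g x k * u j k)) i (p x)"
  shows "\<bar>expectation p - master_prob l w i\<bar> \<le> \<P>(x in M. \<bar>b x - 1\<bar> > s\<^sup>2) + 38 * s"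
proof -
  let ?G = "gauss I"
  define f where "f j h = (\<Sum>k\<in>I. h k * u j k)" for j and h :: "'i \<Rightarrow> real"
  have f[measurable]: "f j \<in> borel_measurable ?G" for j unfolding f_def by measurable
  have fg[measurable]: "(\<lambda>x. f j (g x)) \<in> borel_measurable M" for j by measurable
  have prob_g: "\<P>(x in M. Q (g x)) = \<P>(h in ?G. Q h)" if [measurable]: "Measurable.pred ?G Q" for Q
  proof -
    have "\<P>(h in ?G. Q h) = measure (distr M ?G g) {h \<in> space ?G. Q h}" by (simp only: law)
    also have "\<dots> = \<P>(x in M. Q (g x))"
      using measurable_space[OF g] by (subst measure_distr) (auto intro!: arg_cong[where f = prob])
    finally show ?thesis ..
  qed
  define ind where "ind h = (of_bool (l * w i - f i h = (MAX j\<in>{1..3}. l * w j - f j h)) :: real)" for h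
  have ind[measurable]: "ind \<in> borel_measurable ?G"
    unfolding ind_def by (intro measurable_of_bool_Max[OF i]) measurable
  have s2: "s\<^sup>2 \<le> 1/4" "s\<^sup>2 \<le> s" using s power_mono[of s "1/2" 2] by (auto simp: power2_eq_square)
  have "\<bar>expectation p - expectation (\<lambda>x. ind (g x))\<bar> \<le>
      \<P>(x in M. \<exists>j\<in>{1..3}. \<bar>(l * w j - a j * b x * f j (g x)) - (l * w j - f j (g x))\<bar> > 3 * s) +
      (\<Sum>j\<in>{1..3}-{i}. \<P>(x in M. \<bar>(l * w i - f i (g x)) - (l * w j - f j (g x))\<bar> \<le> 2 * (3 * s)))"
  proof (rule argmax_stability[OF _ _ _ _ i])
    show "argmax_weight (\<lambda>j. l * w j - f j (g x)) i (ind (g x))" for x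
      unfolding ind_def by (rule argmax_weight_Max[OF i])
    show "argmax_weight (\<lambda>j. l * w j - a j * b x * f j (g x)) i (p x)" if "x \<in> space M" for x
      using label[OF that] by (simp add: f_def)
  qed measurable
  also have "(\<Sum>j\<in>{1..3}-{i}. \<P>(x in M. \<bar>(l * w i - f i (g x)) - (l * w j - f j (g x))\<bar> \<le> 2 * (3 * s))) \<le>
      (\<Sum>j\<in>{1..3}-{i}. 2 * (3 * s))"
  proof (intro sum_mono)
    fix j assume j: "j \<in> {1..3} - {i}"
    have diff: "f i h - f j h = (\<Sum>k\<in>I. h k * (u i k - u j k))" for h
      by (simp add: f_def right_diff_distrib sum_subtractf)
    have "(\<Sum>k\<in>I. (u i k - u j k)\<^sup>2) = (\<Sum>k\<in>I. (u i k)\<^sup>2) + (\<Sum>k\<in>I. (u j k)\<^sup>2) - 2 * (\<Sum>k\<in>I. u i k * u j k)"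
      by (simp add: power2_diff sum.distrib sum_subtractf sum_distrib_left mult.assoc)
    also have "\<dots> \<ge> 1" using unit[OF i] unit[of j] orth[OF i, of j] j s2 by force
    finally have A: "\<P>(h in ?G. \<bar>(l * w i - l * w j) - (\<Sum>k\<in>I. h k * (u i k - u j k))\<bar> \<le> 2 * (3 * s)) \<le> 2 * (3 * s)"
      using s by (intro std_normal_anti_concentration I) auto
    have B: "\<P>(x in M. \<bar>(l * w i - l * w j) - (f i (g x) - f j (g x))\<bar> \<le> 2 * (3 * s)) =
      \<P>(h in ?G. \<bar>(l * w i - l * w j) - (f i h - f j h)\<bar> \<le> 2 * (3 * s))"
      by (rule prob_g) measurable
    have regroup: "(l * w i - f i (g x)) - (l * w j - f j (g x)) = (l * w i - l * w j) - (f i (g x) - f j (g x))" for x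
      by simp
    show "\<P>(x in M. \<bar>(l * w i - f i (g x)) - (l * w j - f j (g x))\<bar> \<le> 2 * (3 * s)) \<le> 2 * (3 * s)"
      unfolding regroup B unfolding diff by (rule A)
  qed
  also have "(\<Sum>j\<in>{1..3}-{i}. 2 * (3 * s)) = 12 * s" using i by (simp add: card_Diff_singleton)
  also have "\<P>(x in M. \<exists>j\<in>{1..3}. \<bar>(l * w j - a j * b x * f j (g x)) - (l * w j - f j (g x))\<bar> > 3 * s) \<le>
      prob ({x \<in> space M. \<bar>b x - 1\<bar> > s\<^sup>2} \<union> (\<Union>j\<in>{1..3}. {x \<in> space M. \<bar>f j (g x)\<bar> > 1 / s}))"
  proof (intro finite_measure_mono subsetI)
    fix x assume x: "x \<in> {x \<in> space M. \<exists>j\<in>{1..3}. \<bar>(l * w j - a j * b x * f j (g x)) - (l * w j - f j (g x))\<bar> > 3 * s}"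
    show "x \<in> {x \<in> space M. \<bar>b x - 1\<bar> > s\<^sup>2} \<union> (\<Union>j\<in>{1..3}. {x \<in> space M. \<bar>f j (g x)\<bar> > 1 / s})"
    proof (rule ccontr)
      assume "\<not> ?thesis"
      then have bx: "\<bar>b x - 1\<bar> \<le> s\<^sup>2" and fx: "\<And>j. j \<in> {1..3} \<Longrightarrow> \<bar>f j (g x)\<bar> \<le> 1 / s"
        using x by (auto simp: not_less)
      have "\<bar>(l * w j - a j * b x * f j (g x)) - (l * w j - f j (g x))\<bar> \<le> 3 * s" if j: "j \<in> {1..3}" for j
      proof -
        have "\<bar>a j * b x - 1\<bar> = \<bar>(a j - 1) * b x + (b x - 1)\<bar>" by (simp add: algebra_simps)
        also have "\<dots> \<le> \<bar>a j - 1\<bar> * \<bar>b x\<bar> + \<bar>b x - 1\<bar>"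
          using abs_triangle_ineq[of "(a j - 1) * b x" "b x - 1"] by (simp add: abs_mult)
        also have "\<dots> \<le> s\<^sup>2 * 2 + s\<^sup>2" using a[OF j] bx s2 by (intro add_mono mult_mono) auto
        finally have "\<bar>a j * b x - 1\<bar> * \<bar>f j (g x)\<bar> \<le> (3 * s\<^sup>2) * (1 / s)"
          using fx[OF j] by (intro mult_mono) auto
        also have "\<dots> = 3 * s" using s by (simp add: power2_eq_square)
        finally have "\<bar>(a j * b x - 1) * f j (g x)\<bar> \<le> 3 * s" by (simp add: abs_mult)
        moreover have "(l * w j - a j * b x * f j (g x)) - (l * w j - f j (g x)) = - ((a j * b x - 1) * f j (g x))"
          by (simp add: algebra_simps)
        ultimately show ?thesis by simp
      qed
      then show False using x by (auto simp: not_le[symmetric])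
    qed
  qed measurable
  also have "\<dots> \<le> \<P>(x in M. \<bar>b x - 1\<bar> > s\<^sup>2) + prob (\<Union>j\<in>{1..3}. {x \<in> space M. \<bar>f j (g x)\<bar> > 1 / s})"
    by (intro measure_Un_le) measurable
  also have "prob (\<Union>j\<in>{1..3}. {x \<in> space M. \<bar>f j (g x)\<bar> > 1 / s}) \<le>
      (\<Sum>j\<in>{1..3}. \<P>(x in M. \<bar>f j (g x)\<bar> > 1 / s))"
    by (intro finite_measure_subadditive_finite) auto
  also have "\<dots> \<le> (\<Sum>j\<in>{1..3::nat}. s\<^sup>2)"
  proof (intro sum_mono)
    fix j :: nat assume j: "j \<in> {1..3}"
    have "\<P>(x in M. \<bar>f j (g x)\<bar> > 1 / s) = \<P>(h in ?G. \<bar>f j h\<bar> > 1 / s)"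
      by (rule prob_g) measurable
    also have "\<dots> \<le> (\<Sum>k\<in>I. (u j k)\<^sup>2) / (1 / s)\<^sup>2"
      unfolding f_def using s by (intro std_normal_tail I) auto
    finally show "\<P>(x in M. \<bar>f j (g x)\<bar> > 1 / s) \<le> s\<^sup>2"
      using unit[OF j] by (simp add: power_divide)
  qed
  also have "(\<Sum>j\<in>{1..3::nat}. s\<^sup>2) = 3 * s\<^sup>2" by simp
  finally have 1: "\<bar>expectation p - expectation (\<lambda>x. ind (g x))\<bar> \<le>
      \<P>(x in M. \<bar>b x - 1\<bar> > s\<^sup>2) + 3 * s\<^sup>2 + 12 * s"
    by simp
  have "expectation (\<lambda>x. ind (g x)) = (\<integral>h. ind h \<partial>distr M ?G g)"
    by (rule integral_distr[symmetric]) measurable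
  then have "\<bar>expectation (\<lambda>x. ind (g x)) - master_prob l w i\<bar> \<le> 23 * s"
    using gaussian_label_near_master[OF I i s unit orth, where l = l and w = w] by (simp add: law ind_def f_def)
  then show ?thesis using 1 s2 by linarith
qed

section \<open>The uniform direction as a normalized Gaussian vector\<close>

abbreviation euclid_norm :: "nat \<Rightarrow> (nat \<Rightarrow> real) \<Rightarrow> real" where
  "euclid_norm d x \<equiv> L2_set x {..<d}"

definition euclid_dir :: "nat \<Rightarrow> (nat \<Rightarrow> real) \<Rightarrow> nat \<Rightarrow> real" where
  "euclid_dir d x = euclid_scale d (1 / euclid_norm d x) x"

lemma sets_euclid_lebesgue [measurable_cong]: "sets (euclid_lebesgue d) = sets (euclid_borel d)"
  unfolding euclid_lebesgue_def euclid_borel_def by (intro sets_PiM_cong) auto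

lemma sets_normal_PiM_euclid_borel: "sets (gauss {..<d}) = sets (euclid_borel d)"
  unfolding euclid_borel_def by (intro sets_PiM_cong) auto

lemma space_euclid_borel: "space (euclid_borel d) = extensional {..<d}"
  by (simp add: euclid_borel_def space_PiM PiE_def)

lemma space_euclid_lebesgue: "space (euclid_lebesgue d) = extensional {..<d}"
  by (simp add: euclid_lebesgue_def space_PiM PiE_def)

lemma measurable_euclid_component:
  "i < d \<Longrightarrow> (\<lambda>x. x i) \<in> borel_measurable (euclid_borel d)"
  unfolding euclid_borel_def by (rule measurable_component_singleton) simp

lemma measurable_euclid_norm [measurable]: "euclid_norm d \<in> borel_measurable (euclid_borel d)"
  unfolding L2_set_def
  using measurable_euclid_component[of _ d]
  by (intro measurable_compose[OF _ borel_measurable_sqrt] borel_measurable_sum borel_measurable_power) auto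

lemma measurable_euclid_scale [measurable (raw)]:
  assumes [measurable]: "r \<in> borel_measurable M" "x \<in> measurable M (euclid_borel d)"
  shows "(\<lambda>\<omega>. euclid_scale d (r \<omega>) (x \<omega>)) \<in> measurable M (euclid_borel d)"
proof -
  have "(\<lambda>\<omega>. x \<omega> i) \<in> borel_measurable M" if "i < d" for i
    using measurable_compose[OF assms(2) measurable_euclid_component[OF that]] .
  then show ?thesis
    unfolding euclid_scale_def euclid_borel_def by (intro measurable_restrict) auto
qed

lemma measurable_euclid_dir [measurable]: "euclid_dir d \<in> measurable (euclid_borel d) (euclid_borel d)"
  unfolding euclid_dir_def by measurable

lemma euclid_norm_scale: "euclid_norm d (euclid_scale d t x) = \<bar>t\<bar> * euclid_norm d x"
proof -
  have "euclid_norm d (euclid_scale d t x) = sqrt (t\<^sup>2 * (\<Sum>i<d. (x i)\<^sup>2))"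
    unfolding L2_set_def by (simp add: euclid_scale_def power_mult_distrib sum_distrib_left)
  then show ?thesis by (simp add: L2_set_def real_sqrt_mult)
qed

lemma euclid_dir_scale:
  assumes "t > 0"
  shows "euclid_dir d (euclid_scale d t x) = euclid_dir d x"
  unfolding euclid_dir_def euclid_norm_scale using assms by (auto simp: euclid_scale_def restrict_def)

interpretation lborel_PiM: product_sigma_finite "\<lambda>_. lborel :: real measure"
  by standard

lemma sigma_finite_euclid_lebesgue: "sigma_finite_measure (euclid_lebesgue d)"
  unfolding euclid_lebesgue_def by (rule lborel_PiM.sigma_finite) simp

lemma nn_integral_euclid_scale:
  assumes t: "t > 0" and f: "f \<in> borel_measurable (euclid_borel d)"
  shows "(\<integral>\<^sup>+x. f x \<partial>euclid_lebesgue d) = ennreal (t ^ d) * (\<integral>\<^sup>+x. f (euclid_scale d t x) \<partial>euclid_lebesgue d)"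
proof -
  have m: "euclid_scale d t \<in> measurable (euclid_lebesgue d) (euclid_lebesgue d)" by measurable
  define P where "P = scale_measure (ennreal (t ^ d)) (distr (euclid_lebesgue d) (euclid_lebesgue d) (euclid_scale d t))"
  have "P = PiM {..<d} (\<lambda>_. lborel)"
  proof (rule lborel_PiM.PiM_eqI)
    show "sets P = sets (PiM {..<d} (\<lambda>_. lborel :: real measure))" by (simp add: P_def euclid_lebesgue_def)
    fix A :: "nat \<Rightarrow> real set" assume "\<And>i. i \<in> {..<d} \<Longrightarrow> A i \<in> sets lborel"
    then have A: "\<And>i. i < d \<Longrightarrow> A i \<in> sets borel" by simp
    have 1: "emeasure lborel (A i) = ennreal t * emeasure lborel ((\<lambda>y. t * y) -` A i)" if "i < d" for i
    proof -
      have [measurable]: "A i \<in> sets borel" using A that .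
      have "emeasure lborel (A i) = (\<integral>\<^sup>+y. indicator (A i) y \<partial>lborel)" by simp
      also have "\<dots> = ennreal \<bar>t\<bar> * (\<integral>\<^sup>+y. indicator (A i) (0 + t * y) \<partial>lborel)"
        using t by (intro nn_integral_real_affine) auto
      also have "(\<integral>\<^sup>+y. indicator (A i) (0 + t * y) \<partial>lborel) = (\<integral>\<^sup>+y. indicator ((\<lambda>y. t * y) -` A i) y \<partial>lborel)"
        by (intro nn_integral_cong) (auto split: split_indicator)
      also have "\<dots> = emeasure lborel ((\<lambda>y. t * y) -` A i)"
        using measurable_sets_borel[of "\<lambda>y. t * y" borel "A i"] by (intro nn_integral_indicator) auto
      finally show ?thesis using t by simp
    qed
    have "emeasure P (Pi\<^sub>E {..<d} A) = ennreal (t ^ d) * emeasure (euclid_lebesgue d)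
        (euclid_scale d t -` Pi\<^sub>E {..<d} A \<inter> space (euclid_lebesgue d))"
      unfolding P_def using A
      by (subst emeasure_scale_measure, subst emeasure_distr[OF m]) (auto simp: euclid_lebesgue_def)
    also have "euclid_scale d t -` Pi\<^sub>E {..<d} A \<inter> space (euclid_lebesgue d) = Pi\<^sub>E {..<d} (\<lambda>i. (\<lambda>y. t * y) -` A i)"
      by (auto simp: space_euclid_lebesgue euclid_scale_def PiE_def Pi_def)
    also have "emeasure (euclid_lebesgue d) \<dots> = (\<Prod>i<d. emeasure lborel ((\<lambda>y. t * y) -` A i))"
      unfolding euclid_lebesgue_def
      using A measurable_sets_borel[of "\<lambda>y. t * y" borel] by (intro lborel_PiM.emeasure_PiM) auto
    also have "ennreal (t ^ d) * \<dots> = (\<Prod>i<d. ennreal t * emeasure lborel ((\<lambda>y. t * y) -` A i))"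
      using t by (simp add: prod.distrib ennreal_power)
    also have "\<dots> = (\<Prod>i<d. emeasure lborel (A i))" by (intro prod.cong) (auto simp: 1)
    finally show "emeasure P (Pi\<^sub>E {..<d} A) = (\<Prod>i<d. emeasure lborel (A i))" .
  qed simp
  then have P: "P = euclid_lebesgue d" by (simp add: euclid_lebesgue_def)
  have "(\<integral>\<^sup>+x. f x \<partial>euclid_lebesgue d) = (\<integral>\<^sup>+x. f x \<partial>P)" by (simp add: P)
  also have "\<dots> = ennreal (t ^ d) * (\<integral>\<^sup>+x. f x \<partial>distr (euclid_lebesgue d) (euclid_lebesgue d) (euclid_scale d t))"
    unfolding P_def by (rule nn_integral_scale_measure) (use f in measurable)
  also have "(\<integral>\<^sup>+x. f x \<partial>distr (euclid_lebesgue d) (euclid_lebesgue d) (euclid_scale d t)) =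
      (\<integral>\<^sup>+x. f (euclid_scale d t x) \<partial>euclid_lebesgue d)"
    using f by (intro nn_integral_distr m) measurable
  finally show ?thesis .
qed

lemma std_normal_PiM_density:
  "gauss {..<d} =
    density (euclid_lebesgue d) (\<lambda>x. ennreal ((1 / sqrt (2 * pi)) ^ d * exp (- (euclid_norm d x)\<^sup>2 / 2)))"
proof (rule std_normal_PiM.PiM_eqI[symmetric])
  let ?D = "density (euclid_lebesgue d) (\<lambda>x. ennreal ((1 / sqrt (2 * pi)) ^ d * exp (- (euclid_norm d x)\<^sup>2 / 2)))"
  show "sets ?D = sets (gauss {..<d})"
    by (simp add: sets_euclid_lebesgue sets_normal_PiM_euclid_borel)
  fix A :: "nat \<Rightarrow> real set" assume "\<And>i. i \<in> {..<d} \<Longrightarrow> A i \<in> sets std_normal"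
  then have A[measurable]: "\<And>i. i < d \<Longrightarrow> A i \<in> sets borel" by simp
  have dens: "(1 / sqrt (2 * pi)) ^ d * exp (- (euclid_norm d x)\<^sup>2 / 2) = (\<Prod>i<d. std_normal_density (x i))" for x
  proof -
    have "(euclid_norm d x)\<^sup>2 = (\<Sum>i<d. (x i)\<^sup>2)" by (simp add: L2_set_def sum_nonneg)
    then have "- (euclid_norm d x)\<^sup>2 / 2 = (\<Sum>i<d. - (x i)\<^sup>2 / 2)" by (simp add: sum_divide_distrib sum_negf)
    then show ?thesis by (simp add: std_normal_density_def prod.distrib exp_sum prod_dividef power_divide)
  qed
  have "emeasure ?D (Pi\<^sub>E {..<d} A) = (\<integral>\<^sup>+x. ennreal (\<Prod>i<d. std_normal_density (x i)) * indicator (Pi\<^sub>E {..<d} A) x \<partial>euclid_lebesgue d)"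
    unfolding dens[symmetric]
  proof (rule emeasure_density)
    show "Pi\<^sub>E {..<d} A \<in> sets (euclid_lebesgue d)"
      unfolding euclid_lebesgue_def using A by (intro sets_PiM_I_finite) auto
  qed measurable
  also have "\<dots> = (\<integral>\<^sup>+x. (\<Prod>i<d. ennreal (std_normal_density (x i)) * indicator (A i) (x i)) \<partial>euclid_lebesgue d)"
  proof (intro nn_integral_cong)
    fix x assume "x \<in> space (euclid_lebesgue d)"
    then have "indicator (Pi\<^sub>E {..<d} A) x = (\<Prod>i<d. indicator (A i) (x i) :: ennreal)"
      by (auto simp: space_euclid_lebesgue PiE_def Pi_def indicator_def prod_zero_iff)
    then show "ennreal (\<Prod>i<d. std_normal_density (x i)) * indicator (Pi\<^sub>E {..<d} A) x =
      (\<Prod>i<d. ennreal (std_normal_density (x i)) * indicator (A i) (x i))"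
      by (simp add: prod.distrib prod_ennreal)
  qed
  also have "\<dots> = (\<Prod>i<d. \<integral>\<^sup>+y. ennreal (std_normal_density y) * indicator (A i) y \<partial>lborel)"
    unfolding euclid_lebesgue_def by (intro lborel_PiM.product_nn_integral_prod) auto
  also have "\<dots> = (\<Prod>i<d. emeasure std_normal (A i))"
    unfolding std_normal_def by (intro prod.cong refl emeasure_density[symmetric]) auto
  finally show "emeasure ?D (Pi\<^sub>E {..<d} A) = (\<Prod>i<d. emeasure std_normal (A i))" .
qed simp

text \<open>
  Read with \<open>s = \<parallel>x\<parallel>\<close>, this writes the Gaussian density as a mixture of indicators of centred balls.
\<close>

lemma exp_layer_cake:
  fixes s :: real
  assumes "s \<ge> 0"
  shows "ennreal (exp (- s\<^sup>2 / 2)) = (\<integral>\<^sup>+t. ennreal (t * exp (- t\<^sup>2 / 2)) * indicator {s..} t \<partial>lborel)"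
proof -
  have "(\<integral>\<^sup>+t. ennreal (t * exp (- t\<^sup>2 / 2)) * indicator {s..} t \<partial>lborel) = ennreal (0 - (- exp (- s\<^sup>2 / 2)))"
  proof (rule nn_integral_FTC_atLeast)
    show "((\<lambda>t. - exp (- t\<^sup>2 / 2)) has_real_derivative t * exp (- t\<^sup>2 / 2)) (at t)" for t :: real
      by (auto intro!: derivative_eq_intros simp: power2_eq_square)
    have "LIM t at_top. (t::real)\<^sup>2 / 2 :> at_top"
      by (intro filterlim_tendsto_pos_mult_at_top[OF tendsto_const, of "1/2", simplified]
          filterlim_pow_at_top filterlim_ident) auto
    then have "((\<lambda>t. exp (- ((t::real)\<^sup>2 / 2))) \<longlongrightarrow> 0) at_top"
      by (intro filterlim_compose[OF exp_at_bot] filterlim_compose[OF filterlim_uminus_at_bot_at_top])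
    then show "((\<lambda>t. - exp (- (t::real)\<^sup>2 / 2)) \<longlongrightarrow> 0) at_top"
      by (auto dest: tendsto_minus)
  qed (use assms in auto)
  then show ?thesis by simp
qed

text \<open>
  The Gaussian law is a mixture of uniform laws on centred balls, and by scaling all these balls
  induce the same law of the direction. The constant \<open>K\<close> need not be computed: both sides have
  total mass 1.
\<close>

lemma unif_sphere_eq_normal_direction:
  "unif_sphere d = distr (gauss {..<d}) (euclid_borel d) (euclid_dir d)"
proof (rule measure_eqI)
  let ?L = "euclid_lebesgue d" and ?G = "gauss {..<d}"
  define B where "B = euclid_unit_ball d"
  have B: "B \<in> sets ?L" unfolding B_def euclid_unit_ball_def by measurable
  define cone where "cone A = (\<integral>\<^sup>+x. indicator {..1} (euclid_norm d x) * indicator A (euclid_dir d x) \<partial>?L)" for A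
  define C where "C = (1 / sqrt (2 * pi)) ^ d"
  define K where "K = ennreal C * (\<integral>\<^sup>+t. ennreal (t * exp (- t\<^sup>2 / 2)) * indicator {0..} t * ennreal (t ^ d) \<partial>lborel)"
  note [measurable_cong] = sets_normal_PiM_euclid_borel
  interpret L: sigma_finite_measure ?L by (rule sigma_finite_euclid_lebesgue)
  interpret pair_sigma_finite ?L "lborel :: real measure" ..
  have G: "emeasure (distr ?G (euclid_borel d) (euclid_dir d)) A = K * cone A" if A[measurable]: "A \<in> sets (euclid_borel d)" for A
  proof -
    have ball: "(\<integral>\<^sup>+x. indicator {euclid_norm d x..} t * indicator A (euclid_dir d x) \<partial>?L) = ennreal (t ^ d) * cone A"
      if t: "t > 0" for t
    proof -
      have "(\<integral>\<^sup>+x. indicator {euclid_norm d x..} t * indicator A (euclid_dir d x) \<partial>?L) =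
        (\<integral>\<^sup>+x. indicator {..t} (euclid_norm d x) * indicator A (euclid_dir d x) \<partial>?L)"
        by (intro nn_integral_cong) (auto split: split_indicator)
      also have "\<dots> = ennreal (t ^ d) * (\<integral>\<^sup>+x. indicator {..t} (euclid_norm d (euclid_scale d t x)) *
          indicator A (euclid_dir d (euclid_scale d t x)) \<partial>?L)"
        by (rule nn_integral_euclid_scale[OF t]) measurable
      also have "(\<integral>\<^sup>+x. indicator {..t} (euclid_norm d (euclid_scale d t x)) *
          indicator A (euclid_dir d (euclid_scale d t x)) \<partial>?L) = cone A"
        unfolding cone_def euclid_dir_scale[OF t] euclid_norm_scale
        using t by (intro nn_integral_cong) (auto split: split_indicator)
      finally show ?thesis .
    qed
    have "emeasure (distr ?G (euclid_borel d) (euclid_dir d)) A = emeasure ?G (euclid_dir d -` A \<inter> space ?G)"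
      by (rule emeasure_distr) measurable
    also have "\<dots> = (\<integral>\<^sup>+x. indicator A (euclid_dir d x) \<partial>?G)"
    proof -
      have "(\<integral>\<^sup>+x. indicator A (euclid_dir d x) \<partial>?G) = (\<integral>\<^sup>+x. indicator (euclid_dir d -` A \<inter> space ?G) x \<partial>?G)"
        by (intro nn_integral_cong) (auto split: split_indicator)
      then show ?thesis by simp
    qed
    also have "\<dots> = (\<integral>\<^sup>+x. ennreal (C * exp (- (euclid_norm d x)\<^sup>2 / 2)) * indicator A (euclid_dir d x) \<partial>?L)"
      unfolding std_normal_PiM_density C_def by (rule nn_integral_density) measurable
    also have "\<dots> = (\<integral>\<^sup>+x. \<integral>\<^sup>+t. ennreal C * (ennreal (t * exp (- t\<^sup>2 / 2)) * indicator {euclid_norm d x..} t *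
        indicator A (euclid_dir d x)) \<partial>lborel \<partial>?L)"
    proof (intro nn_integral_cong)
      fix x
      have "ennreal (C * exp (- (euclid_norm d x)\<^sup>2 / 2)) =
          ennreal C * (\<integral>\<^sup>+t. ennreal (t * exp (- t\<^sup>2 / 2)) * indicator {euclid_norm d x..} t \<partial>lborel)"
        by (subst exp_layer_cake[symmetric]) (auto simp: C_def ennreal_mult L2_set_nonneg)
      then show "ennreal (C * exp (- (euclid_norm d x)\<^sup>2 / 2)) * indicator A (euclid_dir d x) =
          (\<integral>\<^sup>+t. ennreal C * (ennreal (t * exp (- t\<^sup>2 / 2)) * indicator {euclid_norm d x..} t *
        indicator A (euclid_dir d x)) \<partial>lborel)"
        by (subst nn_integral_cmult, simp, subst nn_integral_multc, simp_all add: mult.assoc)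
    qed
    also have "\<dots> = (\<integral>\<^sup>+t. \<integral>\<^sup>+x. ennreal C * (ennreal (t * exp (- t\<^sup>2 / 2)) * indicator {euclid_norm d x..} t *
        indicator A (euclid_dir d x)) \<partial>?L \<partial>lborel)"
    proof (rule Fubini'[symmetric])
      have "(\<lambda>x. indicator {euclid_norm d (fst x)..} (snd x) :: ennreal) = (\<lambda>x. if euclid_norm d (fst x) \<le> snd x then 1 else 0)"
        by (auto simp: fun_eq_iff indicator_def)
      moreover have "(\<lambda>x. if euclid_norm d (fst x) \<le> snd x then 1 else 0 :: ennreal) \<in> borel_measurable (?L \<Otimes>\<^sub>M lborel)"
        by measurable
      ultimately have [measurable]: "(\<lambda>x. indicator {euclid_norm d (fst x)..} (snd x) :: ennreal) \<in> borel_measurable (?L \<Otimes>\<^sub>M lborel)"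
        by simp
      show "(\<lambda>(x, t). ennreal C * (ennreal (t * exp (- t\<^sup>2 / 2)) * indicator {euclid_norm d x..} t *
        indicator A (euclid_dir d x))) \<in> borel_measurable (?L \<Otimes>\<^sub>M lborel)"
        unfolding case_prod_beta by measurable
    qed
    also have "\<dots> = (\<integral>\<^sup>+t. ennreal C * (ennreal (t * exp (- t\<^sup>2 / 2)) * indicator {0..} t * ennreal (t ^ d)) * cone A \<partial>lborel)"
    proof (intro nn_integral_cong)
      fix t :: real
      have m: "(\<lambda>x. indicator {euclid_norm d x..} t * indicator A (euclid_dir d x) :: ennreal) \<in> borel_measurable ?L"
      proof -
        have "(\<lambda>x. indicator {..t} (euclid_norm d x) * indicator A (euclid_dir d x) :: ennreal) \<in> borel_measurable ?L"
          by measurable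
        then show ?thesis by (simp add: indicator_def)
      qed
      have "(\<integral>\<^sup>+x. ennreal C * (ennreal (t * exp (- t\<^sup>2 / 2)) * indicator {euclid_norm d x..} t *
        indicator A (euclid_dir d x)) \<partial>?L) = ennreal C * ennreal (t * exp (- t\<^sup>2 / 2)) *
        (\<integral>\<^sup>+x. indicator {euclid_norm d x..} t * indicator A (euclid_dir d x) \<partial>?L)"
        by (subst nn_integral_cmult[OF m, symmetric]) (simp add: mult.assoc)
      also have "\<dots> = ennreal C * (ennreal (t * exp (- t\<^sup>2 / 2)) * indicator {0..} t * ennreal (t ^ d)) * cone A"
      proof (cases "t > 0")
        case True
        then show ?thesis by (simp add: ball mult.assoc)
      next
        case False
        then have "ennreal (t * exp (- t\<^sup>2 / 2)) = 0" by (intro ennreal_neg) (simp add: mult_nonpos_nonneg)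
        then show ?thesis by simp
      qed
      finally show "(\<integral>\<^sup>+x. ennreal C * (ennreal (t * exp (- t\<^sup>2 / 2)) * indicator {euclid_norm d x..} t *
        indicator A (euclid_dir d x)) \<partial>?L) =
        ennreal C * (ennreal (t * exp (- t\<^sup>2 / 2)) * indicator {0..} t * ennreal (t ^ d)) * cone A" .
    qed
    also have "\<dots> = K * cone A"
      unfolding K_def by (simp add: nn_integral_cmult nn_integral_multc)
    finally show ?thesis .
  qed
  have cone_space: "cone (space (euclid_borel d)) = emeasure ?L B"
  proof -
    have "cone (space (euclid_borel d)) = (\<integral>\<^sup>+x. indicator B x \<partial>?L)"
      unfolding cone_def using measurable_space[OF measurable_euclid_dir]
      by (intro nn_integral_cong) (auto simp: B_def euclid_unit_ball_def space_euclid_borel space_euclid_lebesgue indicator_def)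
    then show ?thesis using B by simp
  qed
  interpret D: prob_space "distr ?G (euclid_borel d) (euclid_dir d)"
    by (intro prob_space.prob_space_distr prob_space_std_normal_PiM) measurable
  have one: "K * emeasure ?L B = 1"
    using D.emeasure_space_1 G[of "space (euclid_borel d)"] by (simp add: cone_space)
  fix A assume "A \<in> sets (unif_sphere d)"
  then have A[measurable]: "A \<in> sets (euclid_borel d)" by (simp add: unif_sphere_def)
  have "emeasure (unif_sphere d) A = emeasure (uniform_measure ?L B) (euclid_dir d -` A \<inter> space ?L)"
    unfolding unif_sphere_def B_def[symmetric] using measurable_euclid_dir[of d]
    by (subst emeasure_distr) (auto simp: euclid_dir_def[abs_def])
  also have "\<dots> = emeasure ?L (B \<inter> (euclid_dir d -` A \<inter> space ?L)) / emeasure ?L B"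
    by (rule emeasure_uniform_measure[OF B]) measurable
  also have "emeasure ?L (B \<inter> (euclid_dir d -` A \<inter> space ?L)) = cone A"
  proof -
    have "cone A = (\<integral>\<^sup>+x. indicator (B \<inter> (euclid_dir d -` A \<inter> space ?L)) x \<partial>?L)"
      unfolding cone_def
      by (intro nn_integral_cong) (auto simp: B_def euclid_unit_ball_def indicator_def)
    then show ?thesis using B by simp
  qed
  also have "cone A / emeasure ?L B = K * cone A"
  proof -
    have "emeasure ?L B \<noteq> 0" "emeasure ?L B \<noteq> \<top>" using one by (auto simp: ennreal_mult_top split: if_splits)
    then have "cone A / emeasure ?L B = (K * emeasure ?L B) * cone A / emeasure ?L B" by (simp add: one)
    also have "\<dots> = K * cone A * (emeasure ?L B / emeasure ?L B)" by (simp add: ennreal_times_divide mult_ac)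
    also have "\<dots> = K * cone A"
      using \<open>emeasure ?L B \<noteq> 0\<close> \<open>emeasure ?L B \<noteq> \<top>\<close> by (simp add: ennreal_divide_self less_top)
    finally show ?thesis .
  qed
  finally show "emeasure (unif_sphere d) A = emeasure (distr ?G (euclid_borel d) (euclid_dir d)) A"
    using A by (simp add: G)
qed (simp add: unif_sphere_def)

section \<open>Concentration in high dimension\<close>

lemma std_normal_fourth_moment: "(\<E> x. ennreal (x ^ 4)) = 3"
proof -
  have "(\<E> x. ennreal (x ^ 4)) = (\<integral>\<^sup>+x. ennreal (std_normal_density x * x ^ (2 * 2)) \<partial>lborel)"
    by (subst nn_integral_std_normal) (auto simp: ennreal_mult)
  also have "\<dots> = ennreal (fact (2 * 2) / (2 ^ 2 * fact 2))"
    using std_normal_moment_even[of 2] unfolding has_bochner_integral_iff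
    by (subst nn_integral_eq_integral) auto
  also have "fact (2 * 2) / (2 ^ 2 * fact 2) = (3 :: real)" by (simp add: fact_numeral)
  finally show ?thesis by simp
qed

text \<open>
  All terms of \<open>(S + y\<^sup>2)\<^sup>2 = S\<^sup>2 + 2Sy\<^sup>2 + y\<^sup>4\<close> are nonnegative, so adding a coordinate needs no
  integrability. The resulting variance of the squared norm is \<open>2d\<close>.
\<close>

lemma chi_square_moments:
  assumes "finite I"
  shows "(\<integral>\<^sup>+g. ennreal (\<Sum>i\<in>I. (g i)\<^sup>2) \<partial>gauss I) = of_nat (card I)"
    and "(\<integral>\<^sup>+g. ennreal ((\<Sum>i\<in>I. (g i)\<^sup>2)\<^sup>2) \<partial>gauss I) = of_nat ((card I)\<^sup>2 + 2 * card I)"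
  using assms
proof (induction I)
  case empty
  { case 1 show ?case by simp }
  { case 2 show ?case by simp }
next
  case (insert j I)
  let ?S = "\<lambda>g. \<Sum>i\<in>I. (g i)\<^sup>2 :: real"
  interpret G: prob_space "gauss I" by (rule prob_space_std_normal_PiM)
  have S: "(\<Sum>i\<in>insert j I. ((g(j := y)) i)\<^sup>2) = ?S g + y\<^sup>2" for g :: "'a \<Rightarrow> real" and y
  proof -
    have "(\<Sum>i\<in>I. ((g(j := y)) i)\<^sup>2) = ?S g" using insert.hyps by (intro sum.cong) auto
    then show ?thesis using insert.hyps by simp
  qed
  have S0: "?S g \<ge> 0" for g by (simp add: sum_nonneg)
  { case 1
    have "(\<integral>\<^sup>+g. ennreal (\<Sum>i\<in>insert j I. (g i)\<^sup>2) \<partial>gauss (insert j I)) =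
      (\<E> y. \<integral>\<^sup>+g. ennreal (?S g) + ennreal (y\<^sup>2) \<partial>gauss I)"
      using insert.hyps S0
      by (subst std_normal_PiM.product_nn_integral_insert_rev) (simp_all only: S ennreal_plus[symmetric] zero_le_power2, measurable)
    also have "\<dots> = of_nat (card I) + 1"
      by (simp add: nn_integral_add insert.IH std_normal_second_moment G.emeasure_space_1 std_normal.emeasure_space_1[simplified])
    finally show ?case using insert.hyps by (simp add: add.commute) }
  { case 2
    have e: "ennreal ((?S g + y\<^sup>2)\<^sup>2) = ennreal ((?S g)\<^sup>2) + (2 * ennreal (y\<^sup>2) * ennreal (?S g) + ennreal (y ^ 4))" for g y
    proof -
      have "(?S g + y\<^sup>2)\<^sup>2 = (?S g)\<^sup>2 + (2 * y\<^sup>2 * ?S g + y ^ 4)"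
        by (simp add: power4_eq_xxxx power2_eq_square algebra_simps)
      moreover have "ennreal (2 * y\<^sup>2 * ?S g) = 2 * ennreal (y\<^sup>2) * ennreal (?S g)"
        using S0 by (simp add: ennreal_mult)
      ultimately show ?thesis using S0[of g] by (simp add: ennreal_plus)
    qed
    have "(\<integral>\<^sup>+g. ennreal ((\<Sum>i\<in>insert j I. (g i)\<^sup>2)\<^sup>2) \<partial>gauss (insert j I)) =
      (\<E> y. \<integral>\<^sup>+g. ennreal ((?S g)\<^sup>2) + (2 * ennreal (y\<^sup>2) * ennreal (?S g) + ennreal (y ^ 4)) \<partial>gauss I)"
      using insert.hyps by (subst std_normal_PiM.product_nn_integral_insert_rev) (simp_all only: S e, measurable)
    also have "\<dots> = (\<E> y. of_nat ((card I)\<^sup>2 + 2 * card I) + (2 * of_nat (card I) * ennreal (y\<^sup>2) + ennreal (y ^ 4)))"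
      by (simp add: nn_integral_add nn_integral_cmult insert.IH G.emeasure_space_1 mult_ac)
    also have "\<dots> = of_nat ((card I)\<^sup>2 + 2 * card I) + (2 * of_nat (card I) * 1 + 3)"
      by (simp add: nn_integral_add nn_integral_cmult std_normal_second_moment std_normal_fourth_moment
          std_normal.emeasure_space_1[simplified])
    also have "\<dots> = of_nat ((card I)\<^sup>2 + 2 * card I + (2 * card I + 3))"
      by (simp only: of_nat_add of_nat_mult of_nat_numeral of_nat_power mult_1_right)
    also have "(card I)\<^sup>2 + 2 * card I + (2 * card I + 3) = (card (insert j I))\<^sup>2 + 2 * card (insert j I)"
      using insert.hyps by (simp add: power2_eq_square)
    finally show ?case . }
qed

lemma normal_norm_concentration:
  assumes d: "d \<ge> 1" and e: "e > 0"
  shows "measure (gauss {..<d}) {g \<in> space (gauss {..<d}).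
    \<bar>(euclid_norm d g)\<^sup>2 / d - 1\<bar> > e} \<le> 2 / (d * e\<^sup>2)"
proof -
  let ?G = "gauss {..<d}" and ?S = "\<lambda>g. \<Sum>i<d. (g i)\<^sup>2 :: real"
  interpret G: prob_space ?G by (rule prob_space_std_normal_PiM)
  have S0: "?S g \<ge> 0" for g by (simp add: sum_nonneg)
  have 1: "has_bochner_integral ?G ?S (real d)"
    using chi_square_moments(1)[of "{..<d}"] S0
    by (intro has_bochner_integral_nn_integral AE_I2) (simp_all only: ennreal_of_nat_eq_real_of_nat card_lessThan finite_lessThan of_nat_0_le_iff, measurable)
  have 2: "has_bochner_integral ?G (\<lambda>g. (?S g)\<^sup>2) (real (d\<^sup>2 + 2 * d))"
    using chi_square_moments(2)[of "{..<d}"]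
    by (intro has_bochner_integral_nn_integral AE_I2) (simp_all only: ennreal_of_nat_eq_real_of_nat card_lessThan finite_lessThan of_nat_0_le_iff zero_le_power2, measurable)
  have "has_bochner_integral ?G (\<lambda>g. (?S g)\<^sup>2 - 2 * real d * ?S g + (real d)\<^sup>2 * 1)
      (real (d\<^sup>2 + 2 * d) - 2 * real d * real d + (real d)\<^sup>2 * measure ?G (space ?G))"
    using has_bochner_integral_indicator[of "space ?G" ?G "1::real"]
    by (intro has_bochner_integral_add has_bochner_integral_diff has_bochner_integral_mult_right 1 2)
      (auto simp: has_bochner_integral_iff G.emeasure_space_1)
  then have 3: "has_bochner_integral ?G (\<lambda>g. (?S g - real d)\<^sup>2) (2 * real d)"
    by (simp add: G.prob_space power2_diff algebra_simps power2_eq_square)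
  have "{g \<in> space ?G. \<bar>(euclid_norm d g)\<^sup>2 / d - 1\<bar> > e} \<subseteq> {g \<in> space ?G. (?S g - real d)\<^sup>2 \<ge> (d * e)\<^sup>2}"
  proof safe
    fix g assume *: "\<bar>(euclid_norm d g)\<^sup>2 / d - 1\<bar> > e"
    have "(euclid_norm d g)\<^sup>2 = ?S g" by (simp add: L2_set_def S0)
    moreover have "\<bar>?S g / d - 1\<bar> = \<bar>?S g - d\<bar> / d" proof -
      have "?S g / d - 1 = (?S g - d) / d" using d by (simp add: diff_divide_distrib)
      then show ?thesis by (simp add: abs_divide)
    qed
    ultimately have "d * e \<le> \<bar>?S g - d\<bar>" using * d by (simp add: field_simps)
    then show "(?S g - real d)\<^sup>2 \<ge> (d * e)\<^sup>2" using e power_mono[of "d * e" "\<bar>?S g - d\<bar>" 2] by simp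
  qed
  then have "\<P>(g in ?G. \<bar>(euclid_norm d g)\<^sup>2 / d - 1\<bar> > e) \<le> \<P>(g in ?G. (?S g - real d)\<^sup>2 \<ge> (d * e)\<^sup>2)"
    by (rule G.finite_measure_mono) measurable
  also have "\<dots> \<le> (\<integral>g. (?S g - real d)\<^sup>2 \<partial>?G) / (d * e)\<^sup>2"
    using 3 d e by (intro integral_Markov_inequality_measure[where A = "{}"]) (auto simp: has_bochner_integral_iff)
  also have "\<dots> = 2 / (d * e\<^sup>2)"
    using has_bochner_integral_integral_eq[OF 3] d by (simp add: power2_eq_square)
  finally show ?thesis .
qed

lemma euclid_norm_dir:
  assumes "euclid_norm d g \<noteq> 0"
  shows "(\<Sum>k<d. (euclid_dir d g k)\<^sup>2) = 1"
proof -
  have "(\<Sum>k<d. (euclid_dir d g k)\<^sup>2) = (euclid_norm d (euclid_dir d g))\<^sup>2"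
    by (simp add: L2_set_def sum_nonneg)
  also have "euclid_norm d (euclid_dir d g) = 1"
    unfolding euclid_dir_def euclid_norm_scale using assms by (simp add: L2_set_nonneg)
  finally show ?thesis by simp
qed

lemma euclid_dir_inner:
  "(\<Sum>k<d. euclid_dir d g k * e k) = (\<Sum>k<d. g k * e k) / euclid_norm d g"
  by (simp add: euclid_dir_def euclid_scale_def sum_divide_distrib)

text \<open>
  The inner product of \<open>g\<close> with \<open>e\<close> is of order 1, whereas \<open>\<parallel>g\<parallel>\<^sup>2\<close> is unlikely to be below \<open>d/2\<close>.
\<close>

lemma normal_direction_nearly_orthogonal:
  assumes d: "d \<ge> 1" and \<eta>: "\<eta> > 0" and e: "(\<Sum>k<d. (e k)\<^sup>2) \<le> 1"
  shows "measure (gauss {..<d}) {g \<in> space (gauss {..<d}).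
    \<bar>\<Sum>k<d. euclid_dir d g k * e k\<bar> > \<eta>} \<le> 8 / d + 2 / (d * \<eta>\<^sup>2)"
proof -
  let ?G = "gauss {..<d}"
  interpret G: prob_space ?G by (rule prob_space_std_normal_PiM)
  have [measurable]: "euclid_norm d \<in> borel_measurable ?G"
    using measurable_euclid_norm measurable_cong_sets[OF sets_normal_PiM_euclid_borel refl] by blast
  have m: "(\<lambda>g. \<Sum>k<d. euclid_dir d g k * e k) \<in> borel_measurable ?G"
    unfolding euclid_dir_inner by measurable
  define t where "t = \<eta> * sqrt (d / 2)"
  have t: "t > 0" "t\<^sup>2 = \<eta>\<^sup>2 * d / 2" using d \<eta> by (auto simp: t_def power_mult_distrib)
  have "{g \<in> space ?G. \<bar>\<Sum>k<d. euclid_dir d g k * e k\<bar> > \<eta>} \<subseteq>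
      {g \<in> space ?G. \<bar>(euclid_norm d g)\<^sup>2 / d - 1\<bar> > 1/2} \<union> {g \<in> space ?G. \<bar>\<Sum>k\<in>{..<d}. g k * e k\<bar> > t}"
  proof (safe, rule ccontr)
    fix g assume *: "\<bar>\<Sum>k<d. euclid_dir d g k * e k\<bar> > \<eta>"
      and a: "\<not> \<bar>(euclid_norm d g)\<^sup>2 / d - 1\<bar> > 1/2" and b: "\<not> \<bar>\<Sum>k\<in>{..<d}. g k * e k\<bar> > t"
    have "(euclid_norm d g)\<^sup>2 / d \<ge> 1/2" using a by linarith
    then have "d / 2 \<le> (euclid_norm d g)\<^sup>2" using d by (simp add: field_simps)
    then have n: "sqrt (d / 2) \<le> euclid_norm d g" by (intro real_le_lsqrt L2_set_nonneg) auto
    have n0: "euclid_norm d g > 0" using d by (intro less_le_trans[OF _ n]) simp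
    have "\<eta> * euclid_norm d g < \<bar>\<Sum>k<d. g k * e k\<bar>"
      using * n0 unfolding euclid_dir_inner by (simp add: abs_divide field_simps)
    moreover have "t \<le> \<eta> * euclid_norm d g" unfolding t_def using n \<eta> by simp
    ultimately show False using b by linarith
  qed
  then have "\<P>(g in ?G. \<bar>\<Sum>k<d. euclid_dir d g k * e k\<bar> > \<eta>) \<le>
      G.prob ({g \<in> space ?G. \<bar>(euclid_norm d g)\<^sup>2 / d - 1\<bar> > 1/2} \<union> {g \<in> space ?G. \<bar>\<Sum>k\<in>{..<d}. g k * e k\<bar> > t})"
    by (rule G.finite_measure_mono) measurable
  also have "\<dots> \<le> \<P>(g in ?G. \<bar>(euclid_norm d g)\<^sup>2 / d - 1\<bar> > 1/2) +
      \<P>(g in ?G. \<bar>\<Sum>k\<in>{..<d}. g k * e k\<bar> > t)"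
    by (intro measure_Un_le) measurable
  also have "\<P>(g in ?G. \<bar>(euclid_norm d g)\<^sup>2 / d - 1\<bar> > 1/2) \<le> 2 / (d * (1/2)\<^sup>2)"
    by (intro normal_norm_concentration d) simp
  also have "\<P>(g in ?G. \<bar>\<Sum>k\<in>{..<d}. g k * e k\<bar> > t) \<le> (\<Sum>k<d. (e k)\<^sup>2) / t\<^sup>2"
    by (intro std_normal_tail t) simp
  also have "\<dots> \<le> 1 / t\<^sup>2" using e by (intro divide_right_mono) auto
  finally have "\<P>(g in ?G. \<bar>\<Sum>k<d. euclid_dir d g k * e k\<bar> > \<eta>) \<le> 2 / (d * (1/2)\<^sup>2) + 1 / t\<^sup>2"
    by simp
  also have "\<dots> = 8 / d + 2 / (d * \<eta>\<^sup>2)"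
    unfolding t(2) by (simp add: power2_eq_square mult_ac)
  finally show ?thesis .
qed

lemma prob_PiM_component:
  assumes M: "prob_space M" and j: "j \<in> I" and [measurable]: "Measurable.pred M Q"
  shows "\<P>(v in PiM I (\<lambda>_. M). Q (v j)) = \<P>(x in M. Q x)"
proof -
  have "\<P>(x in M. Q x) = measure (distr (PiM I (\<lambda>_. M)) M (\<lambda>v. v j)) {x \<in> space M. Q x}"
    using M j by (subst distr_PiM_component) auto
  also have "\<dots> = \<P>(v in PiM I (\<lambda>_. M). Q (v j))"
    using j by (subst measure_distr) (auto intro!: arg_cong[where f = "measure _"] simp: space_PiM PiE_def Pi_def)
  finally show ?thesis ..
qed

text \<open>
  By Fubini it is enough to bound the probability for every fixed value of the component \<open>k\<close>.
\<close>

lemma prob_PiM_pair_le: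
  assumes M: "prob_space M" and I: "finite I" and jk: "j \<in> I" "k \<in> I" "j \<noteq> k"
    and Q[measurable]: "Measurable.pred (M \<Otimes>\<^sub>M M) (\<lambda>p. Q (fst p) (snd p))"
    and c: "\<And>y. y \<in> space M \<Longrightarrow> \<P>(x in M. Q x y) \<le> c"
  shows "\<P>(v in PiM I (\<lambda>_. M). Q (v j) (v k)) \<le> c"
proof -
  interpret M: prob_space M by fact
  interpret P: product_prob_space "\<lambda>_. M" UNIV ..
  interpret PI: prob_space "PiM I (\<lambda>_. M)" by (intro prob_space_PiM M)
  interpret PJ: prob_space "PiM (I - {j}) (\<lambda>_. M)" by (intro prob_space_PiM M)
  have ins: "insert j (I - {j}) = I" using jk by auto
  have c0: "c \<ge> 0" using M.not_empty c measure_nonneg order_trans by blast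
  have [measurable]: "(\<lambda>v. v j) \<in> measurable (PiM I (\<lambda>_. M)) M" "(\<lambda>v. v k) \<in> measurable (PiM I (\<lambda>_. M)) M"
    using jk by auto
  have pm: "Measurable.pred (PiM I (\<lambda>_. M)) (\<lambda>v. Q (v j) (v k))"
    using measurable_compose[of "\<lambda>v. (v j, v k)" "PiM I (\<lambda>_. M)" "M \<Otimes>\<^sub>M M", OF _ Q] by simp
  have "emeasure (PiM I (\<lambda>_. M)) {v \<in> space (PiM I (\<lambda>_. M)). Q (v j) (v k)} =
      (\<integral>\<^sup>+v. of_bool (Q (v j) (v k)) \<partial>PiM I (\<lambda>_. M))"
  proof -
    have "(\<integral>\<^sup>+v. of_bool (Q (v j) (v k)) \<partial>PiM I (\<lambda>_. M)) =
        (\<integral>\<^sup>+v. indicator {v \<in> space (PiM I (\<lambda>_. M)). Q (v j) (v k)} v \<partial>PiM I (\<lambda>_. M))"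
      by (intro nn_integral_cong) (auto split: split_indicator)
    then show ?thesis using pm by simp
  qed
  also have "\<dots> = (\<integral>\<^sup>+v. \<integral>\<^sup>+x. of_bool (Q ((v(j := x)) j) ((v(j := x)) k)) \<partial>M \<partial>PiM (I - {j}) (\<lambda>_. M))"
    using P.product_nn_integral_insert[of "I - {j}" j "\<lambda>v. of_bool (Q (v j) (v k))"] I pm
    unfolding ins by (simp add: of_bool_def)
  also have "\<dots> \<le> (\<integral>\<^sup>+v. ennreal c \<partial>PiM (I - {j}) (\<lambda>_. M))"
  proof (rule nn_integral_mono)
    fix v assume v: "v \<in> space (PiM (I - {j}) (\<lambda>_. M))"
    then have vk: "v k \<in> space M" using jk by (auto simp: space_PiM PiE_def)
    have pk: "Measurable.pred M (\<lambda>x. Q x (v k))"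
      using measurable_compose[of "\<lambda>x. (x, v k)" M "M \<Otimes>\<^sub>M M", OF _ Q] vk by simp
    have "(\<integral>\<^sup>+x. of_bool (Q ((v(j := x)) j) ((v(j := x)) k)) \<partial>M) = (\<integral>\<^sup>+x. indicator {x \<in> space M. Q x (v k)} x \<partial>M)"
      using jk by (intro nn_integral_cong) (auto split: split_indicator)
    also have "\<dots> = ennreal (\<P>(x in M. Q x (v k)))" using pk by (simp add: M.emeasure_eq_measure)
    also have "\<dots> \<le> ennreal c" using c[OF vk] by (rule ennreal_leI)
    finally show "(\<integral>\<^sup>+x. of_bool (Q ((v(j := x)) j) ((v(j := x)) k)) \<partial>M) \<le> ennreal c" .
  qed
  also have "\<dots> = ennreal c" by (simp add: PJ.emeasure_space_1)
  finally show ?thesis using c0 by (simp add: PI.emeasure_eq_measure)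
qed

section \<open>Label probabilities under the polar law\<close>

definition polar :: "nat \<Rightarrow> real \<times> (nat \<Rightarrow> real) \<Rightarrow> nat \<Rightarrow> real" where
  "polar d p = euclid_scale d (fst p) (euclid_dir d (snd p))"

text \<open>
  The joint law of a radius with law \<open>\<mu>\<close> and an independent Gaussian vector, whose direction is the
  direction of the point.
\<close>

definition polar_law :: "nat \<Rightarrow> real measure \<Rightarrow> (real \<times> (nat \<Rightarrow> real)) measure" where
  "polar_law d \<mu> = \<mu> \<Otimes>\<^sub>M gauss {..<d}"

lemma measurable_normal_PiM_euclid:
  "f \<in> measurable (euclid_borel d) L \<Longrightarrow> f \<in> measurable (gauss {..<d}) L"
  using measurable_cong_sets[OF sets_normal_PiM_euclid_borel refl] by blast

lemma measurable_polar:
  assumes "sets \<mu> = sets borel"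
  shows "polar d \<in> measurable (polar_law d \<mu>) (euclid_borel d)"
proof -
  have "fst \<in> borel_measurable (polar_law d \<mu>)"
    unfolding polar_law_def using measurable_fst measurable_cong_sets[OF refl assms] by blast
  moreover have "(\<lambda>p. euclid_dir d (snd p)) \<in> measurable (polar_law d \<mu>) (euclid_borel d)"
    unfolding polar_law_def
    by (rule measurable_compose[OF measurable_snd measurable_normal_PiM_euclid[OF measurable_euclid_dir]])
  ultimately show ?thesis unfolding polar_def by (rule measurable_euclid_scale)
qed

lemma prob_space_polar_law: "prob_space \<mu> \<Longrightarrow> prob_space (polar_law d \<mu>)"
  unfolding polar_law_def by (intro prob_space_pair prob_space_std_normal_PiM)

lemma (in prob_space) law_radius_times_direction:
  fixes R :: "'a \<Rightarrow> real" and U :: "'a \<Rightarrow> nat \<Rightarrow> real"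
  assumes R[measurable]: "R \<in> borel_measurable M" and U[measurable]: "U \<in> measurable M (euclid_borel d)"
    and law_U: "distr M (euclid_borel d) U = unif_sphere d"
    and indep: "indep_set (sets (vimage_algebra (space M) R borel)) (sets (vimage_algebra (space M) U (euclid_borel d)))"
  shows "distr M (euclid_borel d) (\<lambda>\<omega>. euclid_scale d (R \<omega>) (U \<omega>)) =
    distr (polar_law d (distr M borel R)) (euclid_borel d) (polar d)"
proof -
  let ?G = "gauss {..<d}" and ?\<mu> = "distr M borel R"
  interpret R: prob_space ?\<mu> by (rule prob_space_distr[OF R])
  interpret U: prob_space "distr M (euclid_borel d) U" by (rule prob_space_distr[OF U])
  have "?\<mu> \<Otimes>\<^sub>M distr M (euclid_borel d) U = distr M (borel \<Otimes>\<^sub>M euclid_borel d) (\<lambda>\<omega>. (R \<omega>, U \<omega>))"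
  proof (rule pair_measure_eqI)
    fix A B assume "A \<in> sets ?\<mu>" "B \<in> sets (distr M (euclid_borel d) U)"
    then have A[measurable]: "A \<in> sets borel" and B[measurable]: "B \<in> sets (euclid_borel d)" by auto
    have "prob ((R -` A \<inter> space M) \<inter> (U -` B \<inter> space M)) = prob (R -` A \<inter> space M) * prob (U -` B \<inter> space M)"
      using A B indep by (intro indep_setD[OF indep]) (auto intro: in_vimage_algebra)
    moreover have "(R -` A \<inter> space M) \<inter> (U -` B \<inter> space M) = (\<lambda>\<omega>. (R \<omega>, U \<omega>)) -` (A \<times> B) \<inter> space M"
      by auto
    ultimately show "emeasure ?\<mu> A * emeasure (distr M (euclid_borel d) U) B =
        emeasure (distr M (borel \<Otimes>\<^sub>M euclid_borel d) (\<lambda>\<omega>. (R \<omega>, U \<omega>))) (A \<times> B)"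
      by (simp add: emeasure_distr emeasure_eq_measure ennreal_mult'')
  qed (simp_all add: R.sigma_finite_measure_axioms U.sigma_finite_measure_axioms)
  then have joint: "distr M (borel \<Otimes>\<^sub>M euclid_borel d) (\<lambda>\<omega>. (R \<omega>, U \<omega>)) = ?\<mu> \<Otimes>\<^sub>M unif_sphere d"
    by (simp add: law_U)
  have dir: "euclid_dir d \<in> measurable ?G (euclid_borel d)"
    by (rule measurable_normal_PiM_euclid[OF measurable_euclid_dir])
  interpret D: prob_space "distr ?G (euclid_borel d) (euclid_dir d)"
    by (intro prob_space.prob_space_distr prob_space_std_normal_PiM dir)
  have "?\<mu> \<Otimes>\<^sub>M unif_sphere d = distr ?\<mu> borel (\<lambda>r. r) \<Otimes>\<^sub>M distr ?G (euclid_borel d) (euclid_dir d)"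
    by (simp add: unif_sphere_eq_normal_direction distr_distr comp_def)
  also have "\<dots> = distr (polar_law d ?\<mu>) (borel \<Otimes>\<^sub>M euclid_borel d) (\<lambda>(r, g). (r, euclid_dir d g))"
    unfolding polar_law_def by (intro pair_measure_distr dir D.sigma_finite_measure_axioms) simp
  finally have joint2: "distr M (borel \<Otimes>\<^sub>M euclid_borel d) (\<lambda>\<omega>. (R \<omega>, U \<omega>)) =
    distr (polar_law d ?\<mu>) (borel \<Otimes>\<^sub>M euclid_borel d) (\<lambda>(r, g). (r, euclid_dir d g))"
    using joint by simp
  have m2: "(\<lambda>(r, g). (r, euclid_dir d g)) \<in> measurable (polar_law d ?\<mu>) (borel \<Otimes>\<^sub>M euclid_borel d)"
    unfolding polar_law_def case_prod_beta
    by (intro measurable_Pair measurable_compose[OF measurable_snd dir]) simp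
  have sc: "(\<lambda>p. euclid_scale d (fst p) (snd p)) \<in> measurable (borel \<Otimes>\<^sub>M euclid_borel d) (euclid_borel d)"
    by measurable
  have "distr M (euclid_borel d) (\<lambda>\<omega>. euclid_scale d (R \<omega>) (U \<omega>)) =
      distr (distr M (borel \<Otimes>\<^sub>M euclid_borel d) (\<lambda>\<omega>. (R \<omega>, U \<omega>))) (euclid_borel d) (\<lambda>p. euclid_scale d (fst p) (snd p))"
    by (subst distr_distr[OF sc]) (auto simp: comp_def)
  also have "\<dots> = distr (polar_law d ?\<mu>) (euclid_borel d) (polar d)"
    unfolding joint2 by (subst distr_distr[OF sc m2]) (simp add: comp_def polar_def[abs_def] case_prod_beta)
  finally show ?thesis .
qed

lemma measurable_euclid_dist:
  assumes "x \<in> measurable M (euclid_borel d)" "y \<in> measurable M (euclid_borel d)"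
  shows "(\<lambda>\<omega>. euclid_dist d (x \<omega>) (y \<omega>)) \<in> borel_measurable M"
proof -
  have "(\<lambda>\<omega>. x \<omega> i) \<in> borel_measurable M" "(\<lambda>\<omega>. y \<omega> i) \<in> borel_measurable M" if "i < d" for i
    using assms measurable_compose[OF _ measurable_euclid_component[OF that]] by blast+
  then show ?thesis unfolding euclid_dist_def L2_set_def
    by (intro measurable_compose[OF _ borel_measurable_sqrt] borel_measurable_sum borel_measurable_power
        borel_measurable_diff) auto
qed

lemma euclid_dist_polar:
  assumes "(\<Sum>k<d. (u k)\<^sup>2) = 1"
  shows "(euclid_dist d (polar d (r, g)) (euclid_scale d r' u))\<^sup>2 =
    r\<^sup>2 * (\<Sum>k<d. (euclid_dir d g k)\<^sup>2) + r'\<^sup>2 - 2 * (r * r') * ((\<Sum>k<d. g k * u k) / euclid_norm d g)"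
proof -
  let ?e = "euclid_dir d g"
  have "(euclid_dist d (polar d (r, g)) (euclid_scale d r' u))\<^sup>2 = (\<Sum>k<d. (r * ?e k - r' * u k)\<^sup>2)"
    unfolding euclid_dist_def L2_set_def by (simp add: sum_nonneg polar_def euclid_scale_def)
  also have "\<dots> = (\<Sum>k<d. r\<^sup>2 * (?e k)\<^sup>2 + r'\<^sup>2 * (u k)\<^sup>2 - 2 * (r * r') * (?e k * u k))"
    by (intro sum.cong refl) (simp add: power2_diff power_mult_distrib mult_ac)
  also have "\<dots> = r\<^sup>2 * (\<Sum>k<d. (?e k)\<^sup>2) + r'\<^sup>2 * (\<Sum>k<d. (u k)\<^sup>2) - 2 * (r * r') * (\<Sum>k<d. ?e k * u k)"
    by (simp add: sum.distrib sum_subtractf sum_distrib_left)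
  finally show ?thesis by (simp add: assms euclid_dir_inner)
qed

text \<open>
  Here the prototypes are fixed, with radii close to \<open>\<rho>\<close> and nearly orthogonal directions. The bound
  does not involve \<open>\<lambda> = \<surd>d \<tau>\<close>.
\<close>

lemma label_prob_near_master:
  fixes \<mu> :: "real measure"
  assumes \<mu>: "prob_space \<mu>" "sets \<mu> = sets borel" and d: "d \<ge> 1" and \<rho>: "\<rho> > 0" and \<tau>: "\<tau> > 0"
    and i: "i \<in> {1..3}" and s: "0 < s" "s \<le> 1/2"
    and V: "\<And>j. j \<in> {1..3} \<Longrightarrow> V j = polar d (v j)"
    and radius: "\<And>j. j \<in> {1..3} \<Longrightarrow> \<bar>fst (v j) / \<rho> - 1\<bar> \<le> s\<^sup>2"
    and nonzero: "\<And>j. j \<in> {1..3} \<Longrightarrow> euclid_norm d (snd (v j)) \<noteq> 0"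
    and orth: "\<And>j k. j \<in> {1..3} \<Longrightarrow> k \<in> {1..3} \<Longrightarrow> j \<noteq> k \<Longrightarrow>
      \<bar>\<Sum>m<d. euclid_dir d (snd (v j)) m * euclid_dir d (snd (v k)) m\<bar> \<le> s\<^sup>2"
  shows "\<bar>label_prob (distr (polar_law d \<mu>) (euclid_borel d) (polar d)) (euclid_dist d) V i -
      master_prob (sqrt d * \<tau>) (\<lambda>j. ((fst (v j) / \<rho>)\<^sup>2 - 1) / (2 * \<tau>)) i\<bar> \<le>
    \<P>(p in polar_law d \<mu>. \<bar>fst p / \<rho> * (sqrt d / euclid_norm d (snd p)) - 1\<bar> > s\<^sup>2) + 38 * s"
proof -
  let ?Q = "polar_law d \<mu>" and ?G = "gauss {..<d}"
  interpret Q: prob_space ?Q by (rule prob_space_polar_law[OF \<mu>(1)])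
  interpret \<mu>: prob_space \<mu> by fact
  interpret G: prob_space ?G by (rule prob_space_std_normal_PiM)
  define u where "u j = euclid_dir d (snd (v j))" for j
  define a where "a j = fst (v j) / \<rho>" for j
  define b where "b p = fst p / \<rho> * (sqrt d / euclid_norm d (snd p))" for p :: "real \<times> (nat \<Rightarrow> real)"
  define D where "D p j = euclid_dist d (polar d p) (V j)" for p j
  have unit: "(\<Sum>k<d. (u j k)\<^sup>2) = 1" if "j \<in> {1..3}" for j
    unfolding u_def by (rule euclid_norm_dir[OF nonzero[OF that]])
  have V_scale: "V j = euclid_scale d (fst (v j)) (u j)" if "j \<in> {1..3}" for j
    using V[OF that] by (simp add: polar_def u_def)
  have V_space: "V j \<in> space (euclid_borel d)" if "j \<in> {1..3}" for j
    unfolding V_scale[OF that] by (simp add: space_euclid_borel euclid_scale_def)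
  have fst_m: "fst \<in> borel_measurable ?Q"
    unfolding polar_law_def using measurable_fst measurable_cong_sets[OF refl \<mu>(2)] by blast
  have norm_m: "(\<lambda>p. euclid_norm d (snd p)) \<in> borel_measurable ?Q"
    unfolding polar_law_def
    by (rule measurable_compose[OF measurable_snd measurable_normal_PiM_euclid[OF measurable_euclid_norm]])
  have pmf_m: "(\<lambda>x. pmf (farthest_label (euclid_dist d) V x) i) \<in> borel_measurable (euclid_borel d)"
    using V_space by (intro measurable_pmf_farthest_label[OF i] measurable_euclid_dist) auto
  \<comment> \<open>The score is an increasing affine function of the squared distance whose
    coefficients are the same for all labels, so both have the same maximizers.\<close>
  have T_eq: "sqrt d * \<tau> * (((fst (v j) / \<rho>)\<^sup>2 - 1) / (2 * \<tau>)) - a j * b p * (\<Sum>k<d. snd p k * u j k) =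
      sqrt d / (2 * \<rho>\<^sup>2) * ((D p j)\<^sup>2 - (fst p)\<^sup>2 * (\<Sum>k<d. (euclid_dir d (snd p) k)\<^sup>2) - \<rho>\<^sup>2)"
    if j: "j \<in> {1..3}" for j p
  proof -
    define m where "m = (\<Sum>k<d. snd p k * u j k)"
    define n where "n = m / euclid_norm d (snd p)"
    have "(D p j)\<^sup>2 = (fst p)\<^sup>2 * (\<Sum>k<d. (euclid_dir d (snd p) k)\<^sup>2) + (fst (v j))\<^sup>2 - 2 * (fst p * fst (v j)) * n"
      using euclid_dist_polar[OF unit[OF j], of "fst p" "snd p" "fst (v j)"]
      unfolding D_def V_scale[OF j] m_def n_def by simp
    then have "sqrt d / (2 * \<rho>\<^sup>2) * ((D p j)\<^sup>2 - (fst p)\<^sup>2 * (\<Sum>k<d. (euclid_dir d (snd p) k)\<^sup>2) - \<rho>\<^sup>2) =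
      sqrt d / (2 * \<rho>\<^sup>2) * ((fst (v j))\<^sup>2 - \<rho>\<^sup>2 - 2 * (fst p * fst (v j)) * n)" by simp
    also have "\<dots> = sqrt d * (((fst (v j) / \<rho>)\<^sup>2 - 1) / 2) - (fst (v j) / \<rho>) * (fst p / \<rho>) * sqrt d * n"
      using \<rho> by (simp add: field_simps power2_eq_square)
    also have "sqrt d * (((fst (v j) / \<rho>)\<^sup>2 - 1) / 2) = sqrt d * \<tau> * (((fst (v j) / \<rho>)\<^sup>2 - 1) / (2 * \<tau>))"
      using \<tau> by simp
    also have "(fst (v j) / \<rho>) * (fst p / \<rho>) * sqrt d * n = a j * b p * m"
      by (simp add: a_def b_def n_def)
    finally show ?thesis by (simp add: m_def)
  qed
  have "label_prob (distr ?Q (euclid_borel d) (polar d)) (euclid_dist d) V i =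
      Q.expectation (\<lambda>p. pmf (farthest_label (euclid_dist d) V (polar d p)) i)"
    unfolding label_prob_def by (rule integral_distr[OF measurable_polar[OF \<mu>(2)] pmf_m])
  moreover have "\<bar>Q.expectation (\<lambda>p. pmf (farthest_label (euclid_dist d) V (polar d p)) i) -
      master_prob (sqrt d * \<tau>) (\<lambda>j. ((fst (v j) / \<rho>)\<^sup>2 - 1) / (2 * \<tau>)) i\<bar> \<le>
      \<P>(p in ?Q. \<bar>b p - 1\<bar> > s\<^sup>2) + 38 * s"
  proof (rule Q.gaussian_query_label[where I = "{..<d}" and u = u and a = a and g = snd])
    show "\<bar>\<Sum>k<d. u j k * u j' k\<bar> \<le> s\<^sup>2" if "j \<in> {1..3}" "j' \<in> {1..3}" "j \<noteq> j'" for j j'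
      unfolding u_def by (rule orth[OF that])
    show "\<bar>a j - 1\<bar> \<le> s\<^sup>2" if "j \<in> {1..3}" for j unfolding a_def by (rule radius[OF that])
    show "snd \<in> measurable ?Q ?G" unfolding polar_law_def by (rule measurable_snd)
    show "distr ?Q ?G snd = ?G"
    proof (rule measure_eqI)
      fix A assume A: "A \<in> sets (distr ?Q ?G snd)"
      then have "emeasure (distr ?Q ?G snd) A = emeasure ?Q (space \<mu> \<times> A)"
        using sets.sets_into_space[of A ?G] unfolding polar_law_def
        by (subst emeasure_distr) (auto simp: space_pair_measure intro!: arg_cong[where f = "emeasure _"])
      also have "\<dots> = emeasure ?G A"
        unfolding polar_law_def using A G.emeasure_pair_measure_Times[of "space \<mu>" \<mu> A]
        by (simp add: \<mu>.emeasure_space_1)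
      finally show "emeasure (distr ?Q ?G snd) A = emeasure ?G A" .
    qed simp
    show "b \<in> borel_measurable ?Q" unfolding b_def
      by (intro borel_measurable_times borel_measurable_divide fst_m norm_m borel_measurable_const)
    show "(\<lambda>p. pmf (farthest_label (euclid_dist d) V (polar d p)) i) \<in> borel_measurable ?Q"
      by (rule measurable_compose[OF measurable_polar[OF \<mu>(2)] pmf_m])
    fix p
    show "argmax_weight (\<lambda>j. sqrt d * \<tau> * (((fst (v j) / \<rho>)\<^sup>2 - 1) / (2 * \<tau>)) - a j * b p * (\<Sum>k<d. snd p k * u j k)) i
      (pmf (farthest_label (euclid_dist d) V (polar d p)) i)"
    proof (rule argmax_weight_transform[OF _ i])
      show "argmax_weight (D p) i (pmf (farthest_label (euclid_dist d) V (polar d p)) i)"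
        unfolding D_def[abs_def] by (rule argmax_weight_farthest_label[OF i])
      fix j k :: nat assume jk: "j \<in> {1..3}" "k \<in> {1..3}"
      have D0: "D p j \<ge> 0" for j by (simp add: D_def euclid_dist_def L2_set_nonneg)
      have "D p j < D p k \<longleftrightarrow> (D p j)\<^sup>2 < (D p k)\<^sup>2"
        using D0 by (meson power2_less_imp_less power_strict_mono pos2)
      moreover have "sqrt d / (2 * \<rho>\<^sup>2) > 0" using d \<rho> by simp
      ultimately show "(sqrt d * \<tau> * (((fst (v j) / \<rho>)\<^sup>2 - 1) / (2 * \<tau>)) - a j * b p * (\<Sum>k<d. snd p k * u j k) <
         sqrt d * \<tau> * (((fst (v k) / \<rho>)\<^sup>2 - 1) / (2 * \<tau>)) - a k * b p * (\<Sum>m<d. snd p m * u k m)) =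
         (D p j < D p k)"
        unfolding T_eq[OF jk(1)] T_eq[OF jk(2)] by (subst mult_less_cancel_left_pos) auto
    qed
  qed (use i s unit in auto)
  ultimately show ?thesis by (simp add: b_def)
qed


lemma ratio_near_one:
  fixes x y t :: real
  assumes t: "0 < t" "t \<le> 1" and x: "\<bar>x - 1\<bar> \<le> t / 4" and y: "y \<ge> 0" "\<bar>y\<^sup>2 - 1\<bar> \<le> t / 4"
  shows "\<bar>x / y - 1\<bar> \<le> t"
proof -
  have "\<bar>y - 1\<bar> * 1 \<le> \<bar>y - 1\<bar> * (y + 1)" using y by (intro mult_left_mono) auto
  also have "\<dots> = \<bar>(y - 1) * (y + 1)\<bar>" using y by (simp add: abs_mult)
  also have "(y - 1) * (y + 1) = y\<^sup>2 - 1" by (simp add: power2_eq_square algebra_simps)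
  finally have y1: "\<bar>y - 1\<bar> \<le> t / 4" using y by simp
  then have y0: "y \<ge> 3/4" using t by linarith
  have "x / y - 1 = (x - y) / y" using y0 by (simp add: diff_divide_distrib)
  then have "\<bar>x / y - 1\<bar> = \<bar>x - y\<bar> / y" using y0 by (simp add: abs_divide)
  also have "\<bar>x - y\<bar> \<le> t / 2" using x y1 by linarith
  then have "\<bar>x - y\<bar> / y \<le> (t / 2) / (3/4)" using y0 t by (intro frac_le) auto
  also have "\<dots> \<le> t" using t by simp
  finally show ?thesis .
qed

lemma polar_law_marginals:
  assumes \<mu>: "prob_space \<mu>" "sets \<mu> = sets borel"
    and Q: "Measurable.pred \<mu> Q" and Q': "Measurable.pred (gauss {..<d}) Q'"
  shows "\<P>(p in polar_law d \<mu>. Q (fst p)) = \<P>(r in \<mu>. Q r)"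
    and "\<P>(p in polar_law d \<mu>. Q' (snd p)) =
      measure (gauss {..<d}) {g \<in> space (gauss {..<d}). Q' g}"
proof -
  let ?G = "gauss {..<d}"
  interpret \<mu>: prob_space \<mu> by fact
  interpret G: prob_space ?G by (rule prob_space_std_normal_PiM)
  have "{p \<in> space (polar_law d \<mu>). Q (fst p)} = {r \<in> space \<mu>. Q r} \<times> space ?G"
    by (auto simp: polar_law_def space_pair_measure)
  then show "\<P>(p in polar_law d \<mu>. Q (fst p)) = \<P>(r in \<mu>. Q r)"
    unfolding polar_law_def measure_def using Q by (simp add: G.emeasure_pair_measure_Times G.emeasure_space_1)
  have "{p \<in> space (polar_law d \<mu>). Q' (snd p)} = space \<mu> \<times> {g \<in> space ?G. Q' g}"
    by (auto simp: polar_law_def space_pair_measure)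
  then show "\<P>(p in polar_law d \<mu>. Q' (snd p)) = \<P>(g in ?G. Q' g)"
    unfolding polar_law_def measure_def using Q' by (simp add: G.emeasure_pair_measure_Times \<mu>.emeasure_space_1)
qed

lemma measurable_label_prob:
  assumes P: "prob_space P" "sets P = sets (euclid_borel d)" and i: "i \<in> {1..3}"
  shows "(\<lambda>V. label_prob P (euclid_dist d) V i) \<in> borel_measurable (PiM {1..3} (\<lambda>_. euclid_borel d))"
proof -
  interpret P: prob_space P by fact
  have "(\<lambda>p. pmf (farthest_label (euclid_dist d) (fst p) (snd p)) i) \<in>
      borel_measurable (PiM {1..3} (\<lambda>_. euclid_borel d) \<Otimes>\<^sub>M P)"
  proof (intro measurable_pmf_farthest_label[OF i] measurable_euclid_dist)
    show "snd \<in> measurable (PiM {1..3} (\<lambda>_. euclid_borel d) \<Otimes>\<^sub>M P) (euclid_borel d)"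
      using measurable_snd measurable_cong_sets[OF refl P(2)] by blast
    show "(\<lambda>p. fst p j) \<in> measurable (PiM {1..3} (\<lambda>_. euclid_borel d) \<Otimes>\<^sub>M P) (euclid_borel d)" if "j \<in> {1..3}" for j
      using that by (intro measurable_compose[OF measurable_fst measurable_component_singleton])
  qed
  then show ?thesis
    unfolding label_prob_def by (intro P.borel_measurable_lebesgue_integral) (simp add: case_prod_beta)
qed

lemma label_prob_bounds:
  assumes "prob_space P"
  shows "0 \<le> label_prob P dst V i" "label_prob P dst V i \<le> 1"
proof -
  interpret prob_space P by fact
  show "0 \<le> label_prob P dst V i" unfolding label_prob_def by (rule Bochner_Integration.integral_nonneg) (rule pmf_nonneg)
  show "label_prob P dst V i \<le> 1"
  proof (cases "integrable P (\<lambda>x. pmf (farthest_label dst V x) i)")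
    case True
    then have "label_prob P dst V i \<le> (\<integral>x. 1 \<partial>P)"
      unfolding label_prob_def by (intro integral_mono) (auto simp: pmf_le_1)
    then show ?thesis by (simp add: prob_space)
  qed (simp add: label_prob_def not_integrable_integral_eq)
qed

text \<open>
  The number \<open>w\<close> of a prototype of radius \<open>r\<close>; for \<open>r = \<rho>(1 + \<tau>y)\<close> it is \<open>y + \<tau>y\<^sup>2/2\<close>.
\<close>

definition scaled_radius :: "real \<Rightarrow> real \<Rightarrow> real \<Rightarrow> real" where
  "scaled_radius \<rho> \<tau> r = ((r / \<rho>)\<^sup>2 - 1) / (2 * \<tau>)"

text \<open>
  The bound for fixed prototypes is integrated. Prototypes for which it fails lie in \<open>Bad\<close>; there the
  gap is at most 1, and \<open>Bad\<close> has small probability by the concentration of the radius, of the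
  Gaussian norm and of the inner products of independent directions. For fixed \<open>s\<close> everything
  but \<open>38 s\<close> vanishes as \<open>d \<rightarrow> \<infinity>\<close> and \<open>\<tau> \<rightarrow> 0\<close>.
\<close>

lemma expected_label_gap:
  fixes \<mu> :: "real measure"
  assumes \<mu>: "prob_space \<mu>" "sets \<mu> = sets borel" and d: "d \<ge> 1" and \<rho>: "\<rho> > 0" and \<tau>: "\<tau> > 0"
    and radius: "\<And>t. t > 0 \<Longrightarrow> \<P>(r in \<mu>. \<bar>r / \<rho> - 1\<bar> > t) \<le> \<tau>\<^sup>2 / t\<^sup>2"
    and i: "i \<in> {1..3}" and s: "0 < s" "s \<le> 1/2"
  defines "Q \<equiv> polar_law d \<mu>"
  shows "(\<integral>v. \<bar>label_prob (distr Q (euclid_borel d) (polar d)) (euclid_dist d) (compose {1..3} (polar d) v) i -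
      master_prob (sqrt d * \<tau>) (\<lambda>j. scaled_radius \<rho> \<tau> (fst (v j))) i\<bar> \<partial>PiM {1..3} (\<lambda>_. Q)) \<le>
    38 * s + 19 * (\<tau>\<^sup>2 / s ^ 4) + 116 * (1 / (d * s ^ 4))"
    (is "(\<integral>v. ?gap v \<partial>?PV) \<le> _")
proof -
  let ?G = "gauss {..<d}"
  interpret \<mu>: prob_space \<mu> by fact
  interpret G: prob_space ?G by (rule prob_space_std_normal_PiM)
  interpret Q: prob_space Q unfolding Q_def by (rule prob_space_polar_law[OF \<mu>(1)])
  interpret PV: prob_space ?PV by (intro prob_space_PiM Q.prob_space_axioms)
  have polar_m: "polar d \<in> measurable Q (euclid_borel d)" unfolding Q_def by (rule measurable_polar[OF \<mu>(2)])
  let ?P = "distr Q (euclid_borel d) (polar d)"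
  have P: "prob_space ?P" by (rule Q.prob_space_distr[OF polar_m])
  have fst_m: "fst \<in> borel_measurable Q"
    unfolding Q_def polar_law_def using measurable_fst measurable_cong_sets[OF refl \<mu>(2)] by blast
  have snd_m: "snd \<in> measurable Q ?G" unfolding Q_def polar_law_def by (rule measurable_snd)
  have normG: "euclid_norm d \<in> borel_measurable ?G" by (rule measurable_normal_PiM_euclid[OF measurable_euclid_norm])
  have dirG: "euclid_dir d \<in> measurable ?G (euclid_borel d)" by (rule measurable_normal_PiM_euclid[OF measurable_euclid_dir])
  have norm_m: "(\<lambda>p. euclid_norm d (snd p)) \<in> borel_measurable Q" by (rule measurable_compose[OF snd_m normG])
  note [measurable] = fst_m norm_m normG
  have proj: "(\<lambda>v. v j) \<in> measurable ?PV Q" if "j \<in> {1..3}" for j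
    using that by (rule measurable_component_singleton)
  define far where "far t p \<longleftrightarrow> \<bar>fst p / \<rho> - 1\<bar> > t" for t and p :: "real \<times> (nat \<Rightarrow> real)"
  define off where "off e p \<longleftrightarrow> \<bar>(euclid_norm d (snd p))\<^sup>2 / d - 1\<bar> > e" for e and p :: "real \<times> (nat \<Rightarrow> real)"
  define corr where "corr p q \<longleftrightarrow> \<bar>\<Sum>m<d. euclid_dir d (snd p) m * euclid_dir d (snd q) m\<bar> > s\<^sup>2"
    for p q :: "real \<times> (nat \<Rightarrow> real)"
  have far_m[measurable]: "Measurable.pred Q (far t)" for t unfolding far_def by measurable
  have off_m[measurable]: "Measurable.pred Q (off e)" for e unfolding off_def by measurable
  have corr_m: "Measurable.pred (Q \<Otimes>\<^sub>M Q) (\<lambda>p. corr (fst p) (snd p))"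
  proof -
    have "(\<lambda>p. euclid_dir d (snd (fst p)) m) \<in> borel_measurable (Q \<Otimes>\<^sub>M Q)"
      "(\<lambda>p. euclid_dir d (snd (snd p)) m) \<in> borel_measurable (Q \<Otimes>\<^sub>M Q)" if "m < d" for m
      using measurable_compose[OF measurable_compose[OF _ measurable_compose[OF snd_m dirG]] measurable_euclid_component[OF that]]
      by auto
    then have "(\<lambda>p. \<bar>\<Sum>m<d. euclid_dir d (snd (fst p)) m * euclid_dir d (snd (snd p)) m\<bar>) \<in> borel_measurable (Q \<Otimes>\<^sub>M Q)"
      by (intro borel_measurable_abs borel_measurable_sum borel_measurable_times) auto
    then show ?thesis unfolding corr_def by measurable
  qed
  have Pfar: "\<P>(p in Q. far t p) \<le> \<tau>\<^sup>2 / t\<^sup>2" if "t > 0" for t :: real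
  proof -
    note [measurable_cong] = \<mu>(2)
    have "Measurable.pred \<mu> (\<lambda>r. \<bar>r / \<rho> - 1\<bar> > t)" by measurable
    then show ?thesis
      using polar_law_marginals(1)[OF \<mu>, where Q = "\<lambda>r. \<bar>r / \<rho> - 1\<bar> > t" and Q' = "\<lambda>_. True" and d = d] radius[OF that]
      unfolding far_def Q_def by simp
  qed
  have Poff: "\<P>(p in Q. off e p) \<le> 2 / (d * e\<^sup>2)" if "e > 0" for e :: real
  proof -
    have "Measurable.pred ?G (\<lambda>g. \<bar>(euclid_norm d g)\<^sup>2 / d - 1\<bar> > e)" by measurable
    then show ?thesis
      using polar_law_marginals(2)[OF \<mu>, where Q = "\<lambda>_. True" and d = d and Q' = "\<lambda>g. \<bar>(euclid_norm d g)\<^sup>2 / d - 1\<bar> > e"]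
        normal_norm_concentration[OF d that]
      unfolding off_def Q_def by simp
  qed
  have Pcorr: "\<P>(p in Q. corr p q) \<le> 8 / d + 2 / (d * (s\<^sup>2)\<^sup>2)" for q
  proof -
    let ?e = "euclid_dir d (snd q)"
    have "(\<Sum>k<d. (?e k)\<^sup>2) \<le> 1"
    proof (cases "euclid_norm d (snd q) = 0")
      case True
      then show ?thesis by (simp add: euclid_dir_def euclid_scale_def)
    qed (simp add: euclid_norm_dir)
    then have "\<P>(g in ?G. \<bar>\<Sum>k<d. euclid_dir d g k * ?e k\<bar> > s\<^sup>2) \<le> 8 / d + 2 / (d * (s\<^sup>2)\<^sup>2)"
      using s by (intro normal_direction_nearly_orthogonal d) auto
    moreover have "Measurable.pred ?G (\<lambda>g. \<bar>\<Sum>k<d. euclid_dir d g k * ?e k\<bar> > s\<^sup>2)"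
    proof -
      have "(\<lambda>g. euclid_dir d g k) \<in> borel_measurable ?G" if "k < d" for k
        by (rule measurable_compose[OF dirG measurable_euclid_component[OF that]])
      then have "(\<lambda>g. \<bar>\<Sum>k<d. euclid_dir d g k * ?e k\<bar>) \<in> borel_measurable ?G"
        by (intro borel_measurable_abs borel_measurable_sum borel_measurable_times) auto
      then show ?thesis by measurable
    qed
    ultimately show ?thesis
      using polar_law_marginals(2)[OF \<mu>, where Q = "\<lambda>_. True" and d = d and Q' = "\<lambda>g. \<bar>\<Sum>k<d. euclid_dir d g k * ?e k\<bar> > s\<^sup>2"]
      unfolding corr_def Q_def by simp
  qed
  have s4: "(s\<^sup>2)\<^sup>2 = s ^ 4" by simp
  have s2: "0 < s\<^sup>2" "s\<^sup>2 \<le> 1" using s power_mono[of s 1 2] by auto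
  have d0: "real d > 0" using d by simp
  define \<beta> where "\<beta> = \<P>(p in Q. \<bar>fst p / \<rho> * (sqrt d / euclid_norm d (snd p)) - 1\<bar> > s\<^sup>2)"
  have "\<beta> \<le> Q.prob ({p \<in> space Q. far (s\<^sup>2 / 4) p} \<union> {p \<in> space Q. off (s\<^sup>2 / 4) p})"
    unfolding \<beta>_def
  proof (rule Q.finite_measure_mono)
    show "{p \<in> space Q. \<bar>fst p / \<rho> * (sqrt d / euclid_norm d (snd p)) - 1\<bar> > s\<^sup>2} \<subseteq>
      {p \<in> space Q. far (s\<^sup>2 / 4) p} \<union> {p \<in> space Q. off (s\<^sup>2 / 4) p}"
    proof (safe, rule ccontr)
      fix r g assume big: "\<bar>fst (r, g) / \<rho> * (sqrt d / euclid_norm d (snd (r, g))) - 1\<bar> > s\<^sup>2"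
        and a: "\<not> far (s\<^sup>2 / 4) (r, g)" and b: "\<not> off (s\<^sup>2 / 4) (r, g)"
      have "\<bar>(r / \<rho>) / (euclid_norm d g / sqrt d) - 1\<bar> \<le> s\<^sup>2"
        by (rule ratio_near_one) (use a b s2 in \<open>auto simp: far_def off_def power_divide L2_set_nonneg\<close>)
      then show False using big by simp
    qed
  qed measurable
  also have "\<dots> \<le> \<P>(p in Q. far (s\<^sup>2 / 4) p) + \<P>(p in Q. off (s\<^sup>2 / 4) p)"
    by (intro measure_Un_le) measurable
  also have "\<dots> \<le> \<tau>\<^sup>2 / (s\<^sup>2 / 4)\<^sup>2 + 2 / (d * (s\<^sup>2 / 4)\<^sup>2)"
    using s2 by (intro add_mono Pfar Poff) auto
  also have "\<dots> = 16 * (\<tau>\<^sup>2 / s ^ 4) + 32 * (1 / (d * s ^ 4))"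
    by (simp add: power_divide s4)
  finally have \<beta>: "\<beta> \<le> 16 * (\<tau>\<^sup>2 / s ^ 4) + 32 * (1 / (d * s ^ 4))" .
  define pairs where "pairs = {(j, k) \<in> {1..3::nat} \<times> {1..3}. j \<noteq> k}"
  have pairs: "pairs = {(1,2), (1,3), (2,1), (2,3), (3,1), (3,2)}"
    unfolding pairs_def by (auto simp: atLeastAtMost_1_3)
  have fin: "finite pairs" unfolding pairs by simp
  have mem: "fst x \<in> {1..3}" "snd x \<in> {1..3}" "fst x \<noteq> snd x" if "x \<in> pairs" for x
    using that by (auto simp: pairs_def)
  let ?far = "\<lambda>j. {v \<in> space ?PV. far (s\<^sup>2) (v j)}" and ?off = "\<lambda>j. {v \<in> space ?PV. off (1/2) (v j)}"
    and ?corr = "\<lambda>j k. {v \<in> space ?PV. corr (v j) (v k)}"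
  define Bad where "Bad = (\<Union>j\<in>{1..3}. ?far j) \<union>
    ((\<Union>j\<in>{1..3}. ?off j) \<union> (\<Union>(j,k)\<in>pairs. ?corr j k))"
  have far_s: "{v \<in> space ?PV. far t (v j)} \<in> PV.events" if "j \<in> {1..3}" for j t
    by (rule predE[OF measurable_compose[OF proj[OF that] far_m]])
  have off_s: "{v \<in> space ?PV. off t (v j)} \<in> PV.events" if "j \<in> {1..3}" for j t
    by (rule predE[OF measurable_compose[OF proj[OF that] off_m]])
  have corr_s: "?corr j k \<in> PV.events" if "j \<in> {1..3}" "k \<in> {1..3}" for j k
    using predE[OF measurable_compose[OF measurable_Pair[OF proj[OF that(1)] proj[OF that(2)]] corr_m]] by simp
  have Bad_s: "Bad \<in> PV.events"
    unfolding Bad_def case_prod_beta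
    by (intro sets.Un sets.finite_UN far_s off_s corr_s mem fin finite_atLeastAtMost)
  have compF: "\<P>(v in ?PV. far t (v j)) = \<P>(p in Q. far t p)" if "j \<in> {1..3}" for j t
    by (rule prob_PiM_component[OF Q.prob_space_axioms that far_m])
  have compO: "\<P>(v in ?PV. off e (v j)) = \<P>(p in Q. off e p)" if "j \<in> {1..3}" for j e
    by (rule prob_PiM_component[OF Q.prob_space_axioms that off_m])
  have Phalf: "\<P>(p in Q. off (1/2) p) \<le> 2 / (d * (1/2)\<^sup>2)" by (rule Poff) simp
  have "PV.prob Bad \<le> (\<Sum>j\<in>{1..3}. PV.prob (?far j)) +
      ((\<Sum>j\<in>{1..3}. PV.prob (?off j)) +
      (\<Sum>(j,k)\<in>pairs. PV.prob (?corr j k)))"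
  proof -
    have 1: "PV.prob (\<Union>j\<in>{1..3}. ?far j) \<le> (\<Sum>j\<in>{1..3}. PV.prob (?far j))"
      using far_s by (intro PV.finite_measure_subadditive_finite) auto
    have 2: "PV.prob (\<Union>j\<in>{1..3}. ?off j) \<le> (\<Sum>j\<in>{1..3}. PV.prob (?off j))"
      using off_s by (intro PV.finite_measure_subadditive_finite) auto
    have 3: "PV.prob (\<Union>(j,k)\<in>pairs. ?corr j k) \<le> (\<Sum>(j,k)\<in>pairs. PV.prob (?corr j k))"
      unfolding case_prod_beta
      by (intro PV.finite_measure_subadditive_finite fin image_subsetI corr_s mem)
    have s1: "(\<Union>j\<in>{1..3}. ?far j) \<in> PV.events"
      by (intro sets.finite_UN far_s finite_atLeastAtMost)
    have s2: "(\<Union>j\<in>{1..3}. ?off j) \<in> PV.events"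
      by (intro sets.finite_UN off_s finite_atLeastAtMost)
    have s3: "(\<Union>(j,k)\<in>pairs. ?corr j k) \<in> PV.events"
      unfolding case_prod_beta by (intro sets.finite_UN corr_s mem fin)
    show ?thesis unfolding Bad_def
      using measure_Un_le[OF s1 sets.Un[OF s2 s3]] measure_Un_le[OF s2 s3] 1 2 3 by linarith
  qed
  also have "(\<Sum>j\<in>{1..3}. PV.prob (?far j)) \<le> (\<Sum>j\<in>{1..3::nat}. \<tau>\<^sup>2 / (s\<^sup>2)\<^sup>2)"
    by (rule sum_mono) (simp only: compF Pfar[OF s2(1)])
  also have "(\<Sum>j\<in>{1..3}. PV.prob (?off j)) \<le> (\<Sum>j\<in>{1..3::nat}. 2 / (d * (1/2)\<^sup>2))"
    by (rule sum_mono) (simp only: compO Phalf)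
  also have "(\<Sum>(j,k)\<in>pairs. PV.prob (?corr j k)) \<le> (\<Sum>(j,k)\<in>pairs. 8 / d + 2 / (d * (s\<^sup>2)\<^sup>2))"
    unfolding case_prod_beta
    by (intro sum_mono prob_PiM_pair_le[where Q = corr] Q.prob_space_axioms corr_m Pcorr mem finite_atLeastAtMost)
  also have "(\<Sum>j\<in>{1..3::nat}. \<tau>\<^sup>2 / (s\<^sup>2)\<^sup>2) = 3 * (\<tau>\<^sup>2 / s ^ 4)" by simp
  also have "(\<Sum>j\<in>{1..3::nat}. 2 / (d * (1/2)\<^sup>2)) = 24 * (1 / real d)" by (simp add: power2_eq_square)
  also have "(\<Sum>(j,k)\<in>pairs. 8 / d + 2 / (d * (s\<^sup>2)\<^sup>2)) = 48 * (1 / real d) + 12 * (1 / (d * s ^ 4))"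
    by (simp add: pairs s4)
  finally have bad1: "PV.prob Bad \<le> 3 * (\<tau>\<^sup>2 / s ^ 4) + 72 * (1 / real d) + 12 * (1 / (d * s ^ 4))" by simp
  have d_le: "1 / real d \<le> 1 / (d * s ^ 4)"
  proof (rule divide_left_mono)
    have "s ^ 4 \<le> 1" using s by (intro power_le_one) auto
    then show "d * s ^ 4 \<le> real d" using d0 by (simp add: mult_left_le)
  qed (use d0 s in auto)
  then have bad: "PV.prob Bad \<le> 3 * (\<tau>\<^sup>2 / s ^ 4) + 84 * (1 / (d * s ^ 4))"
  proof -
    have "x \<le> 3 * a + 84 * c" if "x \<le> 3 * a + 72 * b + 12 * c" "b \<le> c" for x a b c :: real
      using that by linarith
    from this[OF bad1 d_le] show ?thesis .
  qed
  have gap1: "?gap v \<le> 1" for v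
    using label_prob_bounds[OF P, of "euclid_dist d" "compose {1..3} (polar d) v" i]
      master_prob_bounds[of "sqrt d * \<tau>" "\<lambda>j. scaled_radius \<rho> \<tau> (fst (v j))" i] by linarith
  have gap: "?gap v \<le> \<beta> + 38 * s + indicator Bad v" if v: "v \<in> space ?PV" for v
  proof (cases "v \<in> Bad")
    case True
    have "\<beta> \<ge> 0" by (simp add: \<beta>_def)
    then show ?thesis using gap1[of v] True s by simp
  next
    case False
    have nf: "\<not> far (s\<^sup>2) (v j)" and no: "\<not> off (1/2) (v j)" if "j \<in> {1..3}" for j
      using False v that unfolding Bad_def by blast+
    have nc: "\<not> corr (v j) (v k)" if "j \<in> {1..3}" "k \<in> {1..3}" "j \<noteq> k" for j k
      using False v that unfolding Bad_def pairs_def by blast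
    have "?gap v \<le> \<beta> + 38 * s"
      unfolding \<beta>_def Q_def scaled_radius_def
    proof (rule label_prob_near_master[OF \<mu> d \<rho> \<tau> i s])
      show "compose {1..3} (polar d) v j = polar d (v j)" if "j \<in> {1..3}" for j using that by (simp add: compose_def)
      show "\<bar>fst (v j) / \<rho> - 1\<bar> \<le> s\<^sup>2" if "j \<in> {1..3}" for j using nf[OF that] by (simp add: far_def)
      show "euclid_norm d (snd (v j)) \<noteq> 0" if "j \<in> {1..3}" for j using no[OF that] by (auto simp: off_def)
      show "\<bar>\<Sum>m<d. euclid_dir d (snd (v j)) m * euclid_dir d (snd (v k)) m\<bar> \<le> s\<^sup>2"
        if "j \<in> {1..3}" "k \<in> {1..3}" "j \<noteq> k" for j k using nc[OF that] by (simp add: corr_def)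
    qed
    then show ?thesis using False by simp
  qed
  have "(\<integral>v. ?gap v \<partial>?PV) \<le> (\<integral>v. \<beta> + 38 * s + indicator Bad v \<partial>?PV)"
  proof (rule integral_mono')
    show "integrable ?PV (\<lambda>v. \<beta> + 38 * s + indicator Bad v :: real)"
      using Bad_s by (auto simp: PV.emeasure_eq_measure)
    show "0 \<le> \<beta> + 38 * s + indicator Bad v" if "v \<in> space ?PV" for v
      by (rule order_trans[OF abs_ge_zero gap[OF that]])
  qed (rule gap)
  also have "\<dots> = \<beta> + 38 * s + PV.prob Bad"
    using Bad_s by (simp add: PV.emeasure_eq_measure PV.prob_space)
  also have "\<dots> \<le> 38 * s + 19 * (\<tau>\<^sup>2 / s ^ 4) + 116 * (1 / (d * s ^ 4))"
  proof -
    have "x + 38 * s + y \<le> 38 * s + 19 * a + 116 * c" if "x \<le> 16 * a + 32 * c" "y \<le> 3 * a + 84 * c" for x y a c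
      using that by linarith
    from this[OF \<beta> bad] show ?thesis .
  qed
  finally show ?thesis .
qed

section \<open>Entropy\<close>

text \<open>
  Both bounds are \<open>ln t \<le> t - 1\<close>, at \<open>t = 1/\<surd>x\<close> and at \<open>t = 1/x\<close>.
\<close>

lemma abs_x_ln_x_le:
  fixes x :: real
  assumes "0 \<le> x" "x \<le> 1"
  shows "\<bar>x * ln x\<bar> \<le> 2 * sqrt x" "\<bar>x * ln x\<bar> \<le> 1"
proof -
  have main: "\<bar>x * ln x\<bar> \<le> 2 * sqrt x \<and> \<bar>x * ln x\<bar> \<le> 1"
  proof (cases "x = 0")
    case False
    then have x: "x > 0" using assms by simp
    have neg: "\<bar>x * ln x\<bar> = x * - ln x" using x assms(2) by (simp add: abs_mult ln_le_zero_iff abs_of_nonpos)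
    have "- ln x \<le> 1 / x - 1" using ln_le_minus_one[of "1 / x"] x by (simp add: ln_div)
    then have 1: "x * - ln x \<le> x * (1 / x - 1)" using x by (intro mult_left_mono) auto
    have "- ln (sqrt x) \<le> 1 / sqrt x - 1" using ln_le_minus_one[of "1 / sqrt x"] x by (simp add: ln_div)
    then have "- ln x \<le> 2 * (1 / sqrt x)" using x by (simp add: ln_sqrt)
    then have 2: "x * - ln x \<le> x * (2 * (1 / sqrt x))" using x by (intro mult_left_mono) auto
    have "x * (2 * (1 / sqrt x)) = 2 * sqrt x" using x by (simp add: field_simps)
    moreover have "x * (1 / x - 1) \<le> 1" using x by (simp add: field_simps)
    ultimately show ?thesis using 1 2 neg by simp
  qed simp
  then show "\<bar>x * ln x\<bar> \<le> 2 * sqrt x" "\<bar>x * ln x\<bar> \<le> 1" by auto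
qed

lemma continuous_on_x_ln_x: "continuous_on {0..1} (\<lambda>x::real. x * ln x)"
  unfolding continuous_on_def
proof
  fix x :: real assume x: "x \<in> {0..1}"
  show "((\<lambda>x. x * ln x) \<longlongrightarrow> x * ln x) (at x within {0..1})"
  proof (cases "x = 0")
    case True
    have "((\<lambda>x. x * ln x) \<longlongrightarrow> 0) (at 0 within {0..1::real})"
    proof (rule Lim_null_comparison)
      show "\<forall>\<^sub>F x in at 0 within {0..1::real}. norm (x * ln x) \<le> 2 * sqrt x"
        using abs_x_ln_x_le(1) by (auto simp: eventually_at_filter intro!: always_eventually)
      have "((\<lambda>x. 2 * sqrt x) \<longlongrightarrow> 2 * sqrt 0) (at 0 within {0..1::real})"
        by (intro tendsto_intros)
      then show "((\<lambda>x. 2 * sqrt x) \<longlongrightarrow> 0) (at 0 within {0..1::real})" by simp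
    qed
    then show ?thesis using True by simp
  next
    case False
    then show ?thesis by (intro tendsto_intros) auto
  qed
qed

text \<open>
  The slope at 0 is infinite, so there is no Lipschitz bound. Uniform continuity gives this substitute,
  which can be integrated against an \<open>L\<^sup>1\<close> bound on \<open>\<bar>x - y\<bar>\<close>.
\<close>

lemma x_ln_x_modulus:
  fixes e :: real
  assumes e: "e > 0"
  obtains C where "C \<ge> 0" "\<And>x y :: real. x \<in> {0..1} \<Longrightarrow> y \<in> {0..1} \<Longrightarrow> \<bar>x * ln x - y * ln y\<bar> \<le> e + C * \<bar>x - y\<bar>"
proof -
  have uc: "uniformly_continuous_on {0..1} (\<lambda>x::real. x * ln x)"
    by (intro compact_uniformly_continuous continuous_on_x_ln_x) auto
  obtain \<delta> where \<delta>: "\<delta> > 0"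
    "\<forall>x\<in>{0..1}. \<forall>y\<in>{0..1::real}. dist y x < \<delta> \<longrightarrow> dist (y * ln y) (x * ln x) < e"
    using uc[unfolded uniformly_continuous_on_def, THEN spec, THEN mp, OF e]
    by (elim exE conjE) (rule that; assumption)
  show ?thesis
  proof (rule that[of "2 / \<delta>"])
    fix x y :: real assume xy: "x \<in> {0..1}" "y \<in> {0..1}"
    show "\<bar>x * ln x - y * ln y\<bar> \<le> e + 2 / \<delta> * \<bar>x - y\<bar>"
    proof (cases "\<bar>x - y\<bar> < \<delta>")
      case True
      then have "\<bar>x * ln x - y * ln y\<bar> < e" using \<delta>(2)[rule_format, OF xy(2,1)] by (simp add: dist_real_def)
      moreover have "2 / \<delta> * \<bar>x - y\<bar> \<ge> 0" using \<delta> by simp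
      ultimately show ?thesis by linarith
    next
      case False
      then have "2 / \<delta> * \<bar>x - y\<bar> \<ge> 2 / \<delta> * \<delta>" using \<delta> by (intro mult_left_mono) auto
      then have "2 / \<delta> * \<bar>x - y\<bar> \<ge> 2" using \<delta> by simp
      moreover have "\<bar>x * ln x - y * ln y\<bar> \<le> 2"
        using abs_x_ln_x_le(2)[of x] abs_x_ln_x_le(2)[of y] xy by auto
      ultimately show ?thesis using e by linarith
    qed
  qed (use \<delta> in auto)
qed

lemma entropy3_modulus:
  fixes e :: real
  assumes e: "e > 0"
  obtains C where "C \<ge> 0" "\<And>p q. (\<And>i. i \<in> {1..3} \<Longrightarrow> p i \<in> {0..1}) \<Longrightarrow> (\<And>i. i \<in> {1..3} \<Longrightarrow> q i \<in> {0..1}) \<Longrightarrow>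
    \<bar>entropy3 p - entropy3 q\<bar> \<le> e + C * (\<Sum>i\<in>{1..3}. \<bar>p i - q i\<bar>)"
proof -
  obtain C where C: "C \<ge> 0" "\<And>x y :: real. x \<in> {0..1} \<Longrightarrow> y \<in> {0..1} \<Longrightarrow> \<bar>x * ln x - y * ln y\<bar> \<le> e / 3 + C * \<bar>x - y\<bar>"
    using x_ln_x_modulus[of "e / 3"] e by auto
  show ?thesis
  proof (rule that[OF C(1)])
    fix p q :: "nat \<Rightarrow> real" assume pq: "\<And>i. i \<in> {1..3} \<Longrightarrow> p i \<in> {0..1}" "\<And>i. i \<in> {1..3} \<Longrightarrow> q i \<in> {0..1}"
    have "\<bar>entropy3 p - entropy3 q\<bar> = \<bar>\<Sum>i\<in>{1..3}. p i * ln (p i) - q i * ln (q i)\<bar>"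
      by (simp add: entropy3_def sum_subtractf abs_minus_commute)
    also have "\<dots> \<le> (\<Sum>i\<in>{1..3}. \<bar>p i * ln (p i) - q i * ln (q i)\<bar>)" by (rule sum_abs)
    also have "\<dots> \<le> (\<Sum>i\<in>{1..3}. e / 3 + C * \<bar>p i - q i\<bar>)" by (intro sum_mono C(2) pq)
    also have "\<dots> = e + C * (\<Sum>i\<in>{1..3}. \<bar>p i - q i\<bar>)" by (simp add: sum.distrib sum_distrib_left)
    finally show "\<bar>entropy3 p - entropy3 q\<bar> \<le> e + C * (\<Sum>i\<in>{1..3}. \<bar>p i - q i\<bar>)" .
  qed
qed

lemma entropy3_bound:
  assumes "\<And>i. i \<in> {1..3} \<Longrightarrow> p i \<in> {0..1}"
  shows "\<bar>entropy3 p\<bar> \<le> 3"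
proof -
  have "\<bar>entropy3 p\<bar> \<le> (\<Sum>i\<in>{1..3}. \<bar>p i * ln (p i)\<bar>)" unfolding entropy3_def abs_minus_cancel by (rule sum_abs)
  also have "\<dots> \<le> (\<Sum>i\<in>{1..3::nat}. 1)" using assms by (intro sum_mono abs_x_ln_x_le(2)) auto
  finally show ?thesis by simp
qed

lemma tendsto_entropy3:
  assumes conv: "\<And>i. i \<in> {1..3} \<Longrightarrow> (\<lambda>n. p n i) \<longlonglongrightarrow> q i"
    and p: "\<And>n i. i \<in> {1..3} \<Longrightarrow> p n i \<in> {0..1}"
  shows "(\<lambda>n. entropy3 (p n)) \<longlonglongrightarrow> entropy3 q"
  unfolding entropy3_def
proof (intro tendsto_minus tendsto_sum)
  fix i :: nat assume i: "i \<in> {1..3}"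
  have "q i \<in> {0..1}"
    using closed_sequentially[OF _ _ conv[OF i], of "{0..1}"] p[OF i] by auto
  then show "(\<lambda>n. p n i * ln (p n i)) \<longlonglongrightarrow> q i * ln (q i)"
    using continuous_on_tendsto_compose[OF continuous_on_x_ln_x conv[OF i]] p[OF i] by auto
qed

lemma measurable_entropy3:
  assumes "\<And>i. i \<in> {1..3} \<Longrightarrow> (\<lambda>x. p x i) \<in> borel_measurable M"
  shows "(\<lambda>x. entropy3 (p x)) \<in> borel_measurable M"
  unfolding entropy3_def using assms
  by (intro borel_measurable_uminus borel_measurable_sum borel_measurable_times borel_measurable_ln) auto

lemma PiM_distr:
  assumes A: "prob_space A" and I: "finite I" and f: "f \<in> measurable A N"
  shows "PiM I (\<lambda>_. distr A N f) = distr (PiM I (\<lambda>_. A)) (PiM I (\<lambda>_. N)) (compose I f)"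
proof -
  interpret A: prob_space A by fact
  have D: "prob_space (distr A N f)" by (rule A.prob_space_distr[OF f])
  have f': "f \<in> measurable A (distr A N f)" using f by simp
  have eq: "distr A (distr A N f) f = distr A N f" by (intro distr_cong) auto
  have "PiM I (\<lambda>_. distr A N f) = distr (PiM I (\<lambda>_. A)) (PiM I (\<lambda>_. distr A N f)) (compose I f)"
    using distr_PiM_finite_prob_space'[OF I, of "\<lambda>_. A" "\<lambda>_. distr A N f" f] A D f' by (simp add: eq)
  also have "\<dots> = distr (PiM I (\<lambda>_. A)) (PiM I (\<lambda>_. N)) (compose I f)"
    by (intro distr_cong refl sets_PiM_cong) auto
  finally show ?thesis .
qed

lemma measurable_compose_PiM:
  assumes "f \<in> measurable A N"
  shows "compose I f \<in> measurable (PiM I (\<lambda>_. A)) (PiM I (\<lambda>_. N))"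
  unfolding compose_def[abs_def] using assms
  by (intro measurable_restrict measurable_compose[OF measurable_component_singleton])

lemma integral_PiM_distr:
  fixes F :: "_ \<Rightarrow> real"
  assumes A: "prob_space A" and I: "finite I" and f: "f \<in> measurable A N" and F: "F \<in> borel_measurable (PiM I (\<lambda>_. N))"
  shows "(\<integral>x. F x \<partial>PiM I (\<lambda>_. distr A N f)) = (\<integral>x. F (compose I f x) \<partial>PiM I (\<lambda>_. A))"
  unfolding PiM_distr[OF A I f] by (rule integral_distr[OF measurable_compose_PiM[OF f] F])

lemma master_prob_cong:
  assumes "\<And>j. j \<in> {1..3} \<Longrightarrow> w j = w' j" "i \<in> {1..3}"
  shows "master_prob l w i = master_prob l w' i"
proof -
  have "(MAX j\<in>{1..3}. l * w j - z j) = (MAX j\<in>{1..3}. l * w' j - z j)" for z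
    using assms by (intro arg_cong[where f = Max] image_cong) auto
  then show ?thesis unfolding master_prob_def using assms by simp
qed

lemma entropy3_cong: "(\<And>i. i \<in> {1..3} \<Longrightarrow> p i = q i) \<Longrightarrow> entropy3 p = entropy3 q"
  by (simp add: entropy3_def)

lemma measurable_entropy_master:
  "(\<lambda>w. entropy3 (master_prob l w)) \<in> borel_measurable (PiM {1..3} (\<lambda>_. borel))"
  by (intro measurable_entropy3 measurable_master_prob) auto

text \<open>
  Both sides are written as integrals over the polar coordinates of the prototypes; the master
  probabilities depend on the radii only, so the Gaussian vectors integrate out.
\<close>

lemma triplet_entropy_near_master:
  fixes \<mu> :: "real measure"
  assumes \<mu>: "prob_space \<mu>" "sets \<mu> = sets borel"
    and C: "C \<ge> 0" "\<And>p q. (\<And>i. i \<in> {1..3} \<Longrightarrow> p i \<in> {0..1}) \<Longrightarrow> (\<And>i. i \<in> {1..3} \<Longrightarrow> q i \<in> {0..1}) \<Longrightarrow>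
      \<bar>entropy3 p - entropy3 q\<bar> \<le> e + C * (\<Sum>i\<in>{1..3}. \<bar>p i - q i\<bar>)"
    and T: "T \<in> borel_measurable borel"
    and gap: "\<And>i. i \<in> {1..3} \<Longrightarrow> (\<integral>v. \<bar>label_prob (distr (polar_law d \<mu>) (euclid_borel d) (polar d)) (euclid_dist d)
      (compose {1..3} (polar d) v) i - master_prob l (\<lambda>j. T (fst (v j))) i\<bar> \<partial>PiM {1..3} (\<lambda>_. polar_law d \<mu>)) \<le> \<gamma>"
  shows "\<bar>triplet_entropy (distr (polar_law d \<mu>) (euclid_borel d) (polar d)) (euclid_dist d) -
    (\<integral>r. entropy3 (master_prob l (\<lambda>j. T (r j))) \<partial>PiM {1..3} (\<lambda>_. \<mu>))\<bar> \<le> e + C * (3 * \<gamma>)"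
proof -
  let ?Q = "polar_law d \<mu>" and ?P = "distr (polar_law d \<mu>) (euclid_borel d) (polar d)"
  let ?PV = "PiM {1..3} (\<lambda>_. ?Q)"
  let ?p = "\<lambda>v. label_prob ?P (euclid_dist d) (compose {1..3} (polar d) v)"
  let ?q = "\<lambda>v. master_prob l (\<lambda>j. T (fst (v j)))"
  interpret \<mu>: prob_space \<mu> by fact
  have Q: "prob_space ?Q" by (rule prob_space_polar_law[OF \<mu>(1)])
  interpret Q: prob_space ?Q by fact
  interpret PV: prob_space ?PV by (intro prob_space_PiM Q)
  interpret G: prob_space "gauss {..<d}" by (rule prob_space_std_normal_PiM)
  have polar: "polar d \<in> measurable ?Q (euclid_borel d)" by (rule measurable_polar[OF \<mu>(2)])
  have P: "prob_space ?P" by (rule Q.prob_space_distr[OF polar])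
  have fst_m: "fst \<in> borel_measurable ?Q"
    unfolding polar_law_def using measurable_fst measurable_cong_sets[OF refl \<mu>(2)] by blast
  have label_m: "(\<lambda>V. label_prob ?P (euclid_dist d) V i) \<in> borel_measurable (PiM {1..3} (\<lambda>_. euclid_borel d))"
    if "i \<in> {1..3}" for i by (rule measurable_label_prob[OF P _ that]) simp
  have pm: "(\<lambda>v. ?p v i) \<in> borel_measurable ?PV" if "i \<in> {1..3}" for i
    by (rule measurable_compose[OF measurable_compose_PiM[OF polar] label_m[OF that]])
  have "(\<lambda>v. T (fst v)) \<in> borel_measurable ?Q" by (rule measurable_compose[OF fst_m T])
  then have T_m: "compose {1..3} (\<lambda>v. T (fst v)) \<in> measurable ?PV (PiM {1..3} (\<lambda>_. borel))"
    by (rule measurable_compose_PiM)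
  have q_eq: "?q v i = master_prob l (compose {1..3} (\<lambda>v. T (fst v)) v) i" if "i \<in> {1..3}" for v i
    using that by (intro master_prob_cong) (auto simp: compose_def)
  have qm: "(\<lambda>v. ?q v i) \<in> borel_measurable ?PV" if "i \<in> {1..3}" for i
    unfolding q_eq[OF that] by (rule measurable_compose[OF T_m measurable_master_prob[OF that]]) simp
  have p01: "?p v i \<in> {0..1}" and q01: "?q v i \<in> {0..1}" for v i
    using label_prob_bounds[OF P] master_prob_bounds by auto
  have int_p: "integrable ?PV (\<lambda>v. entropy3 (?p v))" and int_q: "integrable ?PV (\<lambda>v. entropy3 (?q v))"
    using entropy3_bound[OF p01] entropy3_bound[OF q01]
    by (auto intro!: PV.integrable_const_bound[of _ 3] measurable_entropy3 pm qm)
  have int_l: "integrable ?PV (\<lambda>v. ?p v i)" "integrable ?PV (\<lambda>v. ?q v i)" if "i \<in> {1..3}" for i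
    using p01 q01 pm[OF that] qm[OF that] by (auto intro!: PV.integrable_const_bound[of _ 1])
  have 1: "triplet_entropy ?P (euclid_dist d) = (\<integral>v. entropy3 (?p v) \<partial>?PV)"
    unfolding triplet_entropy_def by (rule integral_PiM_distr[OF Q _ polar]) (auto intro: measurable_entropy3 label_m)
  have fst_mu: "fst \<in> measurable ?Q \<mu>" unfolding polar_law_def by (rule measurable_fst)
  have "distr ?Q \<mu> fst = \<mu>"
    unfolding polar_law_def by (rule G.distr_pair_fst)
  moreover have Tr: "(\<lambda>r. entropy3 (master_prob l (\<lambda>j. T (r j)))) \<in> borel_measurable (PiM {1..3} (\<lambda>_. \<mu>))"
  proof -
    have "T \<in> borel_measurable \<mu>" using T measurable_cong_sets[OF \<mu>(2) refl] by blast
    then have "(\<lambda>r. entropy3 (master_prob l (compose {1..3} T r))) \<in> borel_measurable (PiM {1..3} (\<lambda>_. \<mu>))"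
      by (rule measurable_compose[OF measurable_compose_PiM measurable_entropy_master])
    moreover have "entropy3 (master_prob l (compose {1..3} T r)) = entropy3 (master_prob l (\<lambda>j. T (r j)))" for r
      by (intro entropy3_cong master_prob_cong) (auto simp: compose_def)
    ultimately show ?thesis by simp
  qed
  ultimately have "(\<integral>r. entropy3 (master_prob l (\<lambda>j. T (r j))) \<partial>PiM {1..3} (\<lambda>_. \<mu>)) =
      (\<integral>v. entropy3 (master_prob l (\<lambda>j. T (compose {1..3} fst v j))) \<partial>?PV)"
    using integral_PiM_distr[OF Q _ fst_mu Tr] by simp
  also have "\<dots> = (\<integral>v. entropy3 (?q v) \<partial>?PV)"
    by (intro Bochner_Integration.integral_cong refl entropy3_cong master_prob_cong) (auto simp: compose_def)
  finally have 2: "(\<integral>r. entropy3 (master_prob l (\<lambda>j. T (r j))) \<partial>PiM {1..3} (\<lambda>_. \<mu>)) = (\<integral>v. entropy3 (?q v) \<partial>?PV)" .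
  have "\<bar>(\<integral>v. entropy3 (?p v) \<partial>?PV) - (\<integral>v. entropy3 (?q v) \<partial>?PV)\<bar> = \<bar>\<integral>v. entropy3 (?p v) - entropy3 (?q v) \<partial>?PV\<bar>"
    using int_p int_q by simp
  also have "\<dots> \<le> (\<integral>v. \<bar>entropy3 (?p v) - entropy3 (?q v)\<bar> \<partial>?PV)" by (rule integral_abs_bound)
  also have "\<dots> \<le> (\<integral>v. e + C * (\<Sum>i\<in>{1..3}. \<bar>?p v i - ?q v i\<bar>) \<partial>?PV)"
    using int_p int_q int_l
    by (intro integral_mono C(2) p01 q01 integrable_abs Bochner_Integration.integrable_diff
        Bochner_Integration.integrable_add integrable_mult_right Bochner_Integration.integrable_sum) auto
  also have "\<dots> = e + C * (\<Sum>i\<in>{1..3}. \<integral>v. \<bar>?p v i - ?q v i\<bar> \<partial>?PV)"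
  proof -
    have "integrable ?PV (\<lambda>v. \<bar>?p v i - ?q v i\<bar>)" if "i \<in> {1..3}" for i
      using int_l[OF that] by simp
    then have "integrable ?PV (\<lambda>v. \<Sum>i\<in>{1..3}. \<bar>?p v i - ?q v i\<bar>)"
      "(\<integral>v. (\<Sum>i\<in>{1..3}. \<bar>?p v i - ?q v i\<bar>) \<partial>?PV) = (\<Sum>i\<in>{1..3}. \<integral>v. \<bar>?p v i - ?q v i\<bar> \<partial>?PV)"
      by (auto intro!: Bochner_Integration.integral_sum Bochner_Integration.integrable_sum)
    then show ?thesis by (simp add: PV.prob_space del: integral_sum Bochner_Integration.integral_sum)
  qed
  also have "\<dots> \<le> e + C * (\<Sum>i\<in>{1..3::nat}. \<gamma>)"
    by (intro add_left_mono mult_left_mono sum_mono gap C(1))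
  finally show ?thesis unfolding 1 2 by simp
qed

section \<open>The three regimes\<close>

lemma measurable_entropy_master_of:
  assumes "W \<in> borel_measurable A"
  shows "(\<lambda>\<omega>. entropy3 (master_prob l (\<lambda>j. W (\<omega> j)))) \<in> borel_measurable (PiM {1..3} (\<lambda>_. A))"
proof -
  have "(\<lambda>\<omega>. entropy3 (master_prob l (compose {1..3} W \<omega>))) \<in> borel_measurable (PiM {1..3} (\<lambda>_. A))"
    by (rule measurable_compose[OF measurable_compose_PiM[OF assms] measurable_entropy_master])
  moreover have "entropy3 (master_prob l (compose {1..3} W \<omega>)) = entropy3 (master_prob l (\<lambda>j. W (\<omega> j)))" for \<omega>
    by (intro entropy3_cong master_prob_cong) (auto simp: compose_def)
  ultimately show ?thesis by simp
qed

lemma entropy_master_bound: "\<bar>entropy3 (master_prob l w)\<bar> \<le> 3"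
  using master_prob_bounds by (intro entropy3_bound) auto

lemma integral_entropy_master_distr:
  assumes A: "prob_space A" and f: "f \<in> measurable A N" and W: "W \<in> borel_measurable N"
  shows "(\<integral>r. entropy3 (master_prob l (\<lambda>j. W (r j))) \<partial>PiM {1..3} (\<lambda>_. distr A N f)) =
    (\<integral>\<omega>. entropy3 (master_prob l (\<lambda>j. W (f (\<omega> j)))) \<partial>PiM {1..3} (\<lambda>_. A))"
proof -
  have "(\<integral>r. entropy3 (master_prob l (\<lambda>j. W (r j))) \<partial>PiM {1..3} (\<lambda>_. distr A N f)) =
      (\<integral>\<omega>. entropy3 (master_prob l (\<lambda>j. W (compose {1..3} f \<omega> j))) \<partial>PiM {1..3} (\<lambda>_. A))"
    by (rule integral_PiM_distr[OF A _ f measurable_entropy_master_of[OF W]]) simp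
  also have "\<dots> = (\<integral>\<omega>. entropy3 (master_prob l (\<lambda>j. W (f (\<omega> j)))) \<partial>PiM {1..3} (\<lambda>_. A))"
    by (intro Bochner_Integration.integral_cong refl entropy3_cong master_prob_cong) (auto simp: compose_def)
  finally show ?thesis .
qed

lemma tendsto_integral_entropy_master:
  assumes A: "prob_space A" and W: "\<And>n. W n \<in> borel_measurable A" and L: "L \<in> borel_measurable (PiM {1..3} (\<lambda>_. A))"
    and lim: "AE \<omega> in PiM {1..3} (\<lambda>_. A). (\<lambda>n. entropy3 (master_prob (l n) (\<lambda>j. W n (\<omega> j)))) \<longlonglongrightarrow> L \<omega>"
  shows "(\<lambda>n. \<integral>\<omega>. entropy3 (master_prob (l n) (\<lambda>j. W n (\<omega> j))) \<partial>PiM {1..3} (\<lambda>_. A)) \<longlonglongrightarrow>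
    (\<integral>\<omega>. L \<omega> \<partial>PiM {1..3} (\<lambda>_. A))"
proof (rule integral_dominated_convergence[where w = "\<lambda>_. 3"])
  interpret prob_space "PiM {1..3} (\<lambda>_. A)" by (intro prob_space_PiM A)
  show "integrable (PiM {1..3} (\<lambda>_. A)) (\<lambda>_. 3 :: real)" by simp
qed (use entropy_master_bound in \<open>auto intro: measurable_entropy_master_of[OF W] L lim\<close>)

text \<open>
  Given the value of one component, the other one hits it with probability 0.
\<close>

lemma AE_PiM_distinct:
  assumes A: "prob_space A" and Y: "Y \<in> borel_measurable A"
    and atomless: "\<And>c. \<P>(x in A. Y x = (c::real)) = 0"
    and ij: "i \<in> {1..3}" "j \<in> {1..3}" "i \<noteq> j"
  shows "AE \<omega> in PiM {1..3::nat} (\<lambda>_. A). Y (\<omega> i) \<noteq> Y (\<omega> j)"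
proof -
  let ?PA = "PiM {1..3::nat} (\<lambda>_. A)"
  interpret PA: prob_space ?PA by (intro prob_space_PiM A)
  note [measurable] = Y
  have "Measurable.pred (A \<Otimes>\<^sub>M A) (\<lambda>p. Y (fst p) = Y (snd p))" by measurable
  then have "\<P>(\<omega> in ?PA. Y (\<omega> i) = Y (\<omega> j)) \<le> 0"
    using ij atomless by (intro prob_PiM_pair_le[where Q = "\<lambda>x y. Y x = Y y"] A) auto
  then have "\<P>(\<omega> in ?PA. Y (\<omega> i) = Y (\<omega> j)) = 0"
    using measure_nonneg order_antisym by blast
  moreover have "(\<lambda>\<omega>. Y (\<omega> k)) \<in> borel_measurable ?PA" if "k \<in> {1..3}" for k
    using that by (intro measurable_compose[OF _ Y] measurable_component_singleton)
  then have "{\<omega> \<in> space ?PA. Y (\<omega> i) = Y (\<omega> j)} \<in> PA.events"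
    using ij by (intro borel_measurable_eq) auto
  ultimately have "AE \<omega> in ?PA. \<omega> \<notin> {\<omega> \<in> space ?PA. Y (\<omega> i) = Y (\<omega> j)}"
    using PA.prob_eq_0 by blast
  then show ?thesis by (auto elim: AE_mp)
qed

lemma entropy3_vertex: "entropy3 (\<lambda>i. of_bool (B i)) = 0"
  unfolding entropy3_def by (simp add: of_bool_def sum.neutral)

lemma master_entropy_zero:
  assumes "prob_space F"
  shows "master_entropy 0 F = ln 3"
proof -
  interpret prob_space "PiM {1..3} (\<lambda>_. F)" by (intro prob_space_PiM assms)
  have "entropy3 (master_prob 0 w) = entropy3 (\<lambda>_. 1 / 3)" for w
    by (intro entropy3_cong master_prob_zero)
  moreover have "entropy3 (\<lambda>_. 1 / 3) = ln 3" by (simp add: entropy3_def ln_div)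
  ultimately show ?thesis unfolding master_entropy_def by (simp add: prob_space)
qed

lemma scaled_radius_affine:
  assumes "\<rho> > 0" "\<tau> \<noteq> 0"
  shows "scaled_radius \<rho> \<tau> (\<rho> + \<tau> * \<rho> * y) = y + \<tau> * y\<^sup>2 / 2"
proof -
  have "(\<rho> + \<tau> * \<rho> * y) / \<rho> = 1 + \<tau> * y" using assms by (simp add: add_divide_distrib)
  then show ?thesis using assms unfolding scaled_radius_def by (simp add: field_simps power2_eq_square)
qed

theorem theorem1:
  fixes M :: "nat \<Rightarrow> 'a measure"
    and R :: "nat \<Rightarrow> 'a \<Rightarrow> real"
    and U X :: "nat \<Rightarrow> 'a \<Rightarrow> (nat \<Rightarrow> real)"
    and P :: "nat \<Rightarrow> (nat \<Rightarrow> real) measure"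
    and \<rho> \<epsilon> \<tau> lam :: "nat \<Rightarrow> real"
    and \<xi> :: "nat \<Rightarrow> 'a \<Rightarrow> real"
    and N :: "'b measure" and \<Xi> :: "'b \<Rightarrow> real" and F :: "real measure"
  assumes prob_M: "\<And>d. d \<ge> 1 \<Longrightarrow> prob_space (M d)"
    and meas_R: "\<And>d. d \<ge> 1 \<Longrightarrow> R d \<in> borel_measurable (M d)"
    and meas_U: "\<And>d. d \<ge> 1 \<Longrightarrow> U d \<in> measurable (M d) (euclid_borel d)"
    and law_U: "\<And>d. d \<ge> 1 \<Longrightarrow> distr (M d) (euclid_borel d) (U d) = unif_sphere d"
    and indep: "\<And>d. d \<ge> 1 \<Longrightarrow> prob_space.indep_set (M d)
          (sets (vimage_algebra (space (M d)) (R d) borel))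
          (sets (vimage_algebra (space (M d)) (U d) (euclid_borel d)))"
    and pos_R: "\<And>d. d \<ge> 1 \<Longrightarrow> AE \<omega> in M d. R d \<omega> > 0"
    and square_integrable_R: "\<And>d. d \<ge> 1 \<Longrightarrow> integrable (M d) (\<lambda>\<omega>. (R d \<omega>)\<^sup>2)"
    and X_def: "\<And>d \<omega>. X d \<omega> = euclid_scale d (R d \<omega>) (U d \<omega>)"
    and P_def: "\<And>d. P d = distr (M d) (euclid_borel d) (X d)"
    and rho_def: "\<And>d. \<rho> d = (\<integral>\<omega>. R d \<omega> \<partial>M d)"
    and eps_def: "\<And>d. \<epsilon> d = sqrt (\<integral>\<omega>. (R d \<omega> - \<rho> d)\<^sup>2 \<partial>M d)"
    and eps_pos: "\<And>d. d \<ge> 1 \<Longrightarrow> \<epsilon> d > 0"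
    and xi_def: "\<And>d \<omega>. \<xi> d \<omega> = (R d \<omega> - \<rho> d) / \<epsilon> d"
    and tau_def: "\<And>d. \<tau> d = \<epsilon> d / \<rho> d"
    and lam_def: "\<And>d. lam d = sqrt (real d) * \<tau> d"
    and prob_N: "prob_space N"
    and meas_Xi: "\<Xi> \<in> borel_measurable N"
    and F_def: "F = distr N borel \<Xi>"
    and tau_lim: "\<tau> \<longlonglongrightarrow> 0"
    and xi_lim: "weak_conv_m (\<lambda>d. distr (M d) borel (\<xi> d)) F"
  shows "(lam \<longlonglongrightarrow> 0 \<longrightarrow> (\<lambda>d. triplet_entropy (P d) (euclid_dist d)) \<longlonglongrightarrow> ln 3)
    \<and> (\<forall>l>0. lam \<longlonglongrightarrow> l \<longrightarrow>
          (\<lambda>d. triplet_entropy (P d) (euclid_dist d)) \<longlonglongrightarrow> master_entropy l F)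
    \<and> (filterlim lam at_top sequentially \<longrightarrow> continuous_on UNIV (cdf F) \<longrightarrow>
          (\<lambda>d. triplet_entropy (P d) (euclid_dist d)) \<longlonglongrightarrow> 0)"
proof -
  define \<mu> where "\<mu> d = distr (M d) borel (R d)" for d
  define H where "H d = triplet_entropy (P d) (euclid_dist d)" for d
  have F: "real_distribution F"
    unfolding F_def by (rule prob_space.real_distribution_distr[OF prob_N meas_Xi])
  interpret F: real_distribution F by fact
  have \<mu>: "prob_space (\<mu> d)" "sets (\<mu> d) = sets borel" if "d \<ge> 1" for d
    using prob_space.prob_space_distr[OF prob_M meas_R] that by (auto simp: \<mu>_def)
  have int_R: "integrable (M d) (R d)" if "d \<ge> 1" for d
  proof -
    interpret prob_space "M d" by (rule prob_M[OF that])
    show ?thesis by (rule square_integrable_imp_integrable[OF meas_R square_integrable_R]) (use that in auto)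
  qed
  have rho_pos: "\<rho> d > 0" if d: "d \<ge> 1" for d
  proof -
    interpret prob_space "M d" by (rule prob_M[OF d])
    have nn: "AE \<omega> in M d. 0 \<le> R d \<omega>" using pos_R[OF d] by eventually_elim simp
    then have "\<rho> d \<ge> 0" unfolding rho_def by (rule integral_nonneg_AE)
    moreover have "\<rho> d \<noteq> 0"
    proof
      assume "\<rho> d = 0"
      then have "AE \<omega> in M d. R d \<omega> = 0"
        using integral_nonneg_eq_0_iff_AE[OF int_R[OF d] nn] by (simp add: rho_def)
      with pos_R[OF d] have "AE \<omega> in M d. False" by eventually_elim simp
      then show False by simp
    qed
    ultimately show ?thesis by simp
  qed
  have tau_pos: "\<tau> d > 0" if "d \<ge> 1" for d
    using rho_pos[OF that] eps_pos[OF that] by (simp add: tau_def)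
  have eps_eq: "\<epsilon> d = \<tau> d * \<rho> d" if "d \<ge> 1" for d
    using rho_pos[OF that] by (simp add: tau_def)
  have P_eq: "P d = distr (polar_law d (\<mu> d)) (euclid_borel d) (polar d)" if d: "d \<ge> 1" for d
    unfolding P_def X_def[abs_def] \<mu>_def
    by (rule prob_space.law_radius_times_direction[OF prob_M meas_R meas_U law_U indep]) (use d in auto)
  have concentrated: "\<P>(r in \<mu> d. \<bar>r / \<rho> d - 1\<bar> > t) \<le> (\<tau> d)\<^sup>2 / t\<^sup>2"
    if d: "d \<ge> 1" and t: "t > 0" for d t
  proof -
    interpret prob_space "M d" by (rule prob_M[OF d])
    note [measurable] = meas_R[OF d]
    have "\<P>(r in \<mu> d. \<bar>r / \<rho> d - 1\<bar> > t) = \<P>(\<omega> in M d. \<bar>R d \<omega> / \<rho> d - 1\<bar> > t)"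
      unfolding \<mu>_def by (subst measure_distr) (auto intro!: arg_cong[where f = prob])
    also have "\<dots> \<le> \<P>(\<omega> in M d. t * \<rho> d \<le> \<bar>R d \<omega> - expectation (R d)\<bar>)"
    proof (rule finite_measure_mono)
      show "{\<omega> \<in> space (M d). \<bar>R d \<omega> / \<rho> d - 1\<bar> > t} \<subseteq> {\<omega> \<in> space (M d). t * \<rho> d \<le> \<bar>R d \<omega> - expectation (R d)\<bar>}"
      proof safe
        fix \<omega> assume *: "\<bar>R d \<omega> / \<rho> d - 1\<bar> > t"
        have "R d \<omega> / \<rho> d - 1 = (R d \<omega> - \<rho> d) / \<rho> d" using rho_pos[OF d] by (simp add: diff_divide_distrib)
        then have "\<bar>R d \<omega> / \<rho> d - 1\<bar> = \<bar>R d \<omega> - \<rho> d\<bar> / \<rho> d" using rho_pos[OF d] by (simp add: abs_divide)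
        then show "t * \<rho> d \<le> \<bar>R d \<omega> - expectation (R d)\<bar>"
          using * rho_pos[OF d] by (simp add: rho_def[symmetric] pos_less_divide_eq)
      qed
    qed measurable
    also have "\<dots> \<le> variance (R d) / (t * \<rho> d)\<^sup>2"
      using t rho_pos[OF d] square_integrable_R[OF d] by (intro Chebyshev_inequality) auto
    also have "variance (R d) = (\<epsilon> d)\<^sup>2" by (simp add: eps_def rho_def[symmetric])
    also have "(\<epsilon> d)\<^sup>2 / (t * \<rho> d)\<^sup>2 = (\<tau> d)\<^sup>2 / t\<^sup>2"
      by (simp add: tau_def power_divide power_mult_distrib)
    finally show ?thesis .
  qed
  have xi_meas: "\<xi> d \<in> borel_measurable (M d)" if "d \<ge> 1" for d
    unfolding xi_def[abs_def] using meas_R[OF that] by measurable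
  have xi_real: "real_distribution (distr (M (Suc n)) borel (\<xi> (Suc n)))" for n
    by (intro prob_space.real_distribution_distr prob_M xi_meas) auto
  \<comment> \<open>Dimension 0 carries no hypotheses, so the sequences are shifted by one.\<close>
  have xi_lim': "weak_conv_m (\<lambda>n. distr (M (Suc n)) borel (\<xi> (Suc n))) F"
    using xi_lim unfolding weak_conv_m_def weak_conv_def by (auto intro: LIMSEQ_Suc)
  obtain \<Omega> :: "real measure" and Y :: "nat \<Rightarrow> real \<Rightarrow> real" and Z :: "real \<Rightarrow> real"
    where \<Omega>: "prob_space \<Omega>" and Y[measurable]: "\<And>n. Y n \<in> borel_measurable \<Omega>"
      and law_Y: "\<And>n. distr \<Omega> borel (Y n) = distr (M (Suc n)) borel (\<xi> (Suc n))"
      and Z[measurable]: "Z \<in> borel_measurable \<Omega>" and law_Z: "distr \<Omega> borel Z = F"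
      and Y_lim: "\<And>x. x \<in> space \<Omega> \<Longrightarrow> (\<lambda>n. Y n x) \<longlonglongrightarrow> Z x"
    using Skorohod[OF xi_real F xi_lim']
    by (elim exE conjE) (rule that; (assumption | (elim allE, assumption) | (erule bspec, assumption) | simp))
  \<comment> \<open>Standardized radii with their quadratic correction: the values \<open>w\<close> of the scores.\<close>
  define W where "W n x = Y n x + \<tau> (Suc n) * (Y n x)\<^sup>2 / 2" for n x
  have W[measurable]: "W n \<in> borel_measurable \<Omega>" for n unfolding W_def by measurable
  have W_lim: "(\<lambda>n. W n x) \<longlonglongrightarrow> Z x" if "x \<in> space \<Omega>" for x
  proof -
    have "(\<lambda>n. W n x) \<longlonglongrightarrow> Z x + 0 * (Z x)\<^sup>2 / 2"
      unfolding W_def by (intro tendsto_intros Y_lim[OF that] LIMSEQ_Suc[OF tau_lim]) auto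
    then show ?thesis by simp
  qed
  define A where "A n = (\<integral>\<omega>. entropy3 (master_prob (lam (Suc n)) (\<lambda>j. W n (\<omega> j))) \<partial>PiM {1..3} (\<lambda>_. \<Omega>))" for n
  have A_eq: "(\<integral>r. entropy3 (master_prob (lam d) (\<lambda>j. scaled_radius (\<rho> d) (\<tau> d) (r j))) \<partial>PiM {1..3} (\<lambda>_. \<mu> d)) = A n"
    if dn: "d = Suc n" for d n
  proof -
    have d: "d \<ge> 1" using dn by simp
    have sr: "scaled_radius (\<rho> d) (\<tau> d) \<in> borel_measurable borel" unfolding scaled_radius_def[abs_def] by measurable
    have "R d \<omega> = \<rho> d + \<tau> d * \<rho> d * \<xi> d \<omega>" for \<omega>
      using eps_pos[OF d] by (simp add: xi_def eps_eq[OF d, symmetric])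
    then have "\<mu> d = distr (distr (M d) borel (\<xi> d)) borel (\<lambda>y. \<rho> d + \<tau> d * \<rho> d * y)"
      unfolding \<mu>_def using xi_meas[OF d] by (subst distr_distr) (auto simp: comp_def intro!: distr_cong)
    also have "\<dots> = distr \<Omega> borel (\<lambda>x. \<rho> d + \<tau> d * \<rho> d * Y n x)"
      unfolding dn law_Y[symmetric] by (subst distr_distr) (auto simp: comp_def)
    finally have "(\<integral>r. entropy3 (master_prob (lam d) (\<lambda>j. scaled_radius (\<rho> d) (\<tau> d) (r j))) \<partial>PiM {1..3} (\<lambda>_. \<mu> d)) =
      (\<integral>\<omega>. entropy3 (master_prob (lam d) (\<lambda>j. scaled_radius (\<rho> d) (\<tau> d) (\<rho> d + \<tau> d * \<rho> d * Y n (\<omega> j)))) \<partial>PiM {1..3} (\<lambda>_. \<Omega>))"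
      using integral_entropy_master_distr[OF \<Omega> _ sr, of "\<lambda>x. \<rho> d + \<tau> d * \<rho> d * Y n x"] by simp
    then show ?thesis
      using rho_pos[OF d] tau_pos[OF d] by (simp add: scaled_radius_affine A_def W_def dn)
  qed
  have close: "(\<lambda>n. H (Suc n) - A n) \<longlonglongrightarrow> 0"
  proof (rule LIMSEQ_I)
    fix r :: real assume r: "r > 0"
    obtain C where C: "C \<ge> 0" "\<And>p q. (\<And>i. i \<in> {1..3} \<Longrightarrow> p i \<in> {0..1}) \<Longrightarrow> (\<And>i. i \<in> {1..3} \<Longrightarrow> q i \<in> {0..1}) \<Longrightarrow>
        \<bar>entropy3 p - entropy3 q\<bar> \<le> r / 4 + C * (\<Sum>i\<in>{1..3}. \<bar>p i - q i\<bar>)"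
      by (rule entropy3_modulus[of "r / 4"]) (use r in auto)
    \<comment> \<open>With \<open>C\<close> fixed first, this \<open>s\<close> makes the part of the error that does not vanish with \<open>n\<close>,
      \<open>C * (3 * (38 * s))\<close>, at most \<open>r / 4\<close>.\<close>
    define s where "s = min (1/2) (r / (4 * (114 * C + 1)))"
    have "0 < s" unfolding s_def using r C(1) by (auto intro!: divide_pos_pos)
    moreover have "s \<le> 1/2" unfolding s_def by (rule min.cobounded1)
    ultimately have s: "0 < s" "s \<le> 1/2" by auto
    have "s * (114 * C) \<le> r / (4 * (114 * C + 1)) * (114 * C + 1)"
      using C(1) s r by (intro mult_mono) (auto simp: s_def)
    also have "\<dots> = r / 4" using C(1) by (simp add: field_simps add_nonneg_eq_0_iff)
    finally have sC: "C * (3 * (38 * s)) \<le> r / 4" by (simp add: mult_ac)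
    define \<beta> where "\<beta> n = 19 * ((\<tau> (Suc n))\<^sup>2 / s ^ 4) + 116 * (1 / (real (Suc n) * s ^ 4))" for n
    have bound: "\<bar>H (Suc n) - A n\<bar> \<le> r / 4 + C * (3 * (38 * s + \<beta> n))" for n
    proof -
      let ?d = "Suc n"
      have d: "?d \<ge> 1" by simp
      have sr: "scaled_radius (\<rho> ?d) (\<tau> ?d) \<in> borel_measurable borel" unfolding scaled_radius_def[abs_def] by measurable
      show ?thesis
        unfolding H_def P_eq[OF d] A_eq[OF refl, symmetric]
      proof (rule triplet_entropy_near_master[OF \<mu>[OF d] C sr])
        fix i :: nat assume i: "i \<in> {1..3}"
        show "(\<integral>v. \<bar>label_prob (distr (polar_law ?d (\<mu> ?d)) (euclid_borel ?d) (polar ?d)) (euclid_dist ?d)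
            (compose {1..3} (polar ?d) v) i - master_prob (lam ?d) (\<lambda>j. scaled_radius (\<rho> ?d) (\<tau> ?d) (fst (v j))) i\<bar>
            \<partial>PiM {1..3} (\<lambda>_. polar_law ?d (\<mu> ?d))) \<le> 38 * s + \<beta> n"
          using expected_label_gap[OF \<mu>[OF d] d rho_pos[OF d] tau_pos[OF d] concentrated[OF d] i s]
          unfolding lam_def \<beta>_def by (simp only: add.assoc)
      qed
    qed
    have "(\<lambda>n. C * (3 * \<beta> n)) \<longlonglongrightarrow> C * (3 * (19 * (0\<^sup>2 / s ^ 4) + 116 * (0 * (1 / s ^ 4))))"
    proof -
      have "(\<lambda>n. 1 / real (Suc n) * (1 / s ^ 4)) \<longlonglongrightarrow> 0 * (1 / s ^ 4)"
        by (intro tendsto_intros LIMSEQ_Suc[OF lim_1_over_n])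
      moreover have "1 / real (Suc n) * (1 / s ^ 4) = 1 / (real (Suc n) * s ^ 4)" for n by simp
      ultimately have "(\<lambda>n. 1 / (real (Suc n) * s ^ 4)) \<longlonglongrightarrow> 0 * (1 / s ^ 4)" by (simp only:)
      then show ?thesis unfolding \<beta>_def using s by (intro tendsto_intros LIMSEQ_Suc[OF tau_lim]) auto
    qed
    then have "(\<lambda>n. C * (3 * \<beta> n)) \<longlonglongrightarrow> 0" by simp
    then have "\<forall>\<^sub>F n in sequentially. C * (3 * \<beta> n) < r / 4"
      using r by (intro order_tendstoD(2)) auto
    then obtain n0 where n0: "\<And>n. n \<ge> n0 \<Longrightarrow> C * (3 * \<beta> n) < r / 4"
      unfolding eventually_sequentially by blast
    show "\<exists>n0. \<forall>n\<ge>n0. norm (H (Suc n) - A n - 0) < r"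
    proof (intro exI[of _ n0] allI impI)
      fix n assume "n \<ge> n0"
      have "C * (3 * (38 * s + \<beta> n)) = C * (3 * (38 * s)) + C * (3 * \<beta> n)" by (simp add: algebra_simps)
      then show "norm (H (Suc n) - A n - 0) < r" using bound[of n] sC n0[OF \<open>n \<ge> n0\<close>] r by simp
    qed
  qed
  have transfer: "H \<longlonglongrightarrow> L" if "A \<longlonglongrightarrow> L" for L
  proof -
    have "(\<lambda>n. (H (Suc n) - A n) + A n) \<longlonglongrightarrow> 0 + L" by (intro tendsto_add close that)
    then have "(\<lambda>n. H (Suc n)) \<longlonglongrightarrow> L" by simp
    then show ?thesis by (rule LIMSEQ_imp_Suc)
  qed
  have finite_lam: "A \<longlonglongrightarrow> master_entropy l F" if l: "lam \<longlonglongrightarrow> l" for l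
  proof -
    have "A \<longlonglongrightarrow> (\<integral>\<omega>. entropy3 (master_prob l (\<lambda>j. Z (\<omega> j))) \<partial>PiM {1..3} (\<lambda>_. \<Omega>))"
      unfolding A_def
    proof (rule tendsto_integral_entropy_master[OF \<Omega> W measurable_entropy_master_of[OF Z]], rule AE_I2)
      fix \<omega> assume "\<omega> \<in> space (PiM {1..3::nat} (\<lambda>_. \<Omega>))"
      then have in_space: "\<omega> j \<in> space \<Omega>" if "j \<in> {1..3}" for j using that by (auto simp: space_PiM PiE_def)
      show "(\<lambda>n. entropy3 (master_prob (lam (Suc n)) (\<lambda>j. W n (\<omega> j)))) \<longlonglongrightarrow> entropy3 (master_prob l (\<lambda>j. Z (\<omega> j)))"
        using master_prob_bounds
        by (intro tendsto_entropy3 tendsto_master_prob tendsto_mult LIMSEQ_Suc[OF l] W_lim in_space) auto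
    qed
    moreover have "(\<integral>\<omega>. entropy3 (master_prob l (\<lambda>j. Z (\<omega> j))) \<partial>PiM {1..3} (\<lambda>_. \<Omega>)) = master_entropy l F"
      using integral_entropy_master_distr[OF \<Omega> Z, of "\<lambda>x. x" l] by (simp add: law_Z master_entropy_def)
    ultimately show ?thesis by simp
  qed
  have infinite_lam: "A \<longlonglongrightarrow> 0" if l: "filterlim lam at_top sequentially" and cont: "continuous_on UNIV (cdf F)"
  proof -
    have atomless: "measure \<Omega> {x \<in> space \<Omega>. Z x = c} = 0" for c
    proof -
      have "measure F {c} = 0"
        using cont F.isCont_cdf by (simp add: continuous_on_eq_continuous_at)
      then show ?thesis unfolding law_Z[symmetric] by (subst (asm) measure_distr) (auto simp: vimage_def Int_def conj_commute)
    qed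
    have "A \<longlonglongrightarrow> (\<integral>\<omega>. 0 \<partial>PiM {1..3::nat} (\<lambda>_. \<Omega>))"
      unfolding A_def
    proof (rule tendsto_integral_entropy_master[OF \<Omega> W])
      have "AE \<omega> in PiM {1..3::nat} (\<lambda>_. \<Omega>). \<forall>p\<in>{(i, j) \<in> {1..3} \<times> {1..3}. i \<noteq> j}. Z (\<omega> (fst p)) \<noteq> Z (\<omega> (snd p))"
        by (rule AE_finite_allI) (auto intro!: AE_PiM_distinct[OF \<Omega> Z atomless] intro: finite_subset[of _ "{1..3} \<times> {1..3}"])
      then show "AE \<omega> in PiM {1..3} (\<lambda>_. \<Omega>). (\<lambda>n. entropy3 (master_prob (lam (Suc n)) (\<lambda>j. W n (\<omega> j)))) \<longlonglongrightarrow> 0"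
      proof (rule AE_mp, intro AE_I2 impI)
        fix \<omega> assume "\<omega> \<in> space (PiM {1..3::nat} (\<lambda>_. \<Omega>))"
          and neq: "\<forall>p\<in>{(i, j) \<in> {1..3} \<times> {1..3}. i \<noteq> j}. Z (\<omega> (fst p)) \<noteq> Z (\<omega> (snd p))"
        then have in_space: "\<omega> j \<in> space \<Omega>" if "j \<in> {1..3}" for j using that by (auto simp: space_PiM PiE_def)
        have lam_Suc: "filterlim (\<lambda>n. lam (Suc n)) at_top sequentially"
          using l by (simp add: filterlim_sequentially_Suc)
        have "(\<lambda>n. entropy3 (master_prob (lam (Suc n)) (\<lambda>j. W n (\<omega> j)))) \<longlonglongrightarrow>
            entropy3 (\<lambda>i. of_bool (\<forall>j\<in>{1..3}. Z (\<omega> j) \<le> Z (\<omega> i)))"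
        proof (rule tendsto_entropy3)
          fix i :: nat assume i: "i \<in> {1..3}"
          show "(\<lambda>n. master_prob (lam (Suc n)) (\<lambda>j. W n (\<omega> j)) i) \<longlonglongrightarrow> of_bool (\<forall>j\<in>{1..3}. Z (\<omega> j) \<le> Z (\<omega> i))"
          proof (rule tendsto_master_prob_at_top[OF i lam_Suc])
            show "(\<lambda>n. W n (\<omega> j)) \<longlonglongrightarrow> Z (\<omega> j)" if "j \<in> {1..3}" for j by (rule W_lim[OF in_space[OF that]])
            show "Z (\<omega> i) \<noteq> Z (\<omega> j)" if "j \<in> {1..3}" "j \<noteq> i" for j using neq i that by force
          qed
        qed (use master_prob_bounds in auto)
        then show "(\<lambda>n. entropy3 (master_prob (lam (Suc n)) (\<lambda>j. W n (\<omega> j)))) \<longlonglongrightarrow> 0"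
          by (simp add: entropy3_vertex)
      qed
    qed simp
    then show ?thesis by simp
  qed
  show ?thesis
  proof (intro conjI allI impI)
    assume "lam \<longlonglongrightarrow> 0"
    then show "(\<lambda>d. triplet_entropy (P d) (euclid_dist d)) \<longlonglongrightarrow> ln 3"
      using transfer[OF finite_lam, of 0] master_entropy_zero[OF F.prob_space_axioms] by (simp add: H_def[abs_def])
  next
    fix l :: real assume "lam \<longlonglongrightarrow> l"
    then show "(\<lambda>d. triplet_entropy (P d) (euclid_dist d)) \<longlonglongrightarrow> master_entropy l F"
      using transfer[OF finite_lam] unfolding H_def[abs_def] by simp
  next
    assume "filterlim lam at_top sequentially" "continuous_on UNIV (cdf F)"
    then show "(\<lambda>d. triplet_entropy (P d) (euclid_dist d)) \<longlonglongrightarrow> 0"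
      using transfer[OF infinite_lam] unfolding H_def[abs_def] by simp
  qed
qed

end
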